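(* Let $L$ be a binary $\mathbb{Z}$-lattice on a positive definite quadratic space over $\mathbb{Q}$ with $-4d_L$ being the discriminant of an imaginary quadratic field. Both $\zeta^{\mathrm{SL}}_L(s)$ and $\zeta^{\mathrm{GL}}_L(s)$ can be meromorphically continued to $\{s\in\mathbb{C}:\Re(s)>1\}$, and they both have a simple pole at $s=2$ in that region. In particular, the abscissae of convergence of $\zeta^{\mathrm{SL}}_L(s)$ and $\zeta^{\mathrm{GL}}_L(s)$ are both equal to $2$.
   Context: $V$ is a positive definite quadratic space over $\mathbb{Q}$; a $\mathbb{Z}$-lattice $L$ on $V$ is the $\mathbb{Z}$-span of a basis of $V$ with integral quadratic values, and $d_L$ is the determinant of its Gram matrix. $O(V)$ is the orthogonal group, $O^+(V)=O(V)\cap \mathrm{SL}(V)$. $a_m^+(L)$ (resp. $a_m(L)$) is the number of classes of sublattices of $L$ of index $m$ under equivalence by elements of $O^+(V)$ (resp. $O(V)$), and $\zeta^{\mathrm{SL}}_L(s)=\sum_{m\ge1}a_m^+(L)m^{-s}$, $\zeta^{\mathrm{GL}}_L(s)=\sum_{m\ge1}a_m(L)m^{-s}$. *)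

theory Defs
  imports
    "HOL-Complex_Analysis.Complex_Analysis"
    "HOL-Combinatorics.Permutations"
begin

section \<open>Discriminants of imaginary quadratic fields\<close>

text \<open>For a negative integer \<open>n\<close>, not necessarily squarefree, this is $\mathbb{Q}(\sqrt{n})$ as a
  subfield of the complex numbers.\<close>

definition imag_quadratic_field :: "complex set \<Rightarrow> bool" where
  "imag_quadratic_field K \<longleftrightarrow>
     (\<exists>n::int. n < 0 \<and> K = {of_rat a + of_rat b * csqrt (of_int n) | a b. True})"

definition ring_of_integers :: "complex set \<Rightarrow> complex set" where
  "ring_of_integers K = {z \<in> K. algebraic_int z}"

definition integral_basis :: "complex set \<Rightarrow> complex \<Rightarrow> complex \<Rightarrow> bool" where
  "integral_basis K w1 w2 \<longleftrightarrow>
     bij_betw (\<lambda>(a::int, b::int). of_int a * w1 + of_int b * w2) UNIV (ring_of_integers K)"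

text \<open>The two embeddings of an imaginary quadratic field into the complex numbers are the inclusion
  and complex conjugation, so the discriminant is the square of the determinant with rows
  \<open>w1, w2\<close> and \<open>cnj w1, cnj w2\<close> for an integral basis \<open>w1, w2\<close>.\<close>

definition field_discriminant :: "complex set \<Rightarrow> rat \<Rightarrow> bool" where
  "field_discriminant K D \<longleftrightarrow>
     (\<exists>w1 w2. integral_basis K w1 w2 \<and> of_rat D = (w1 * cnj w2 - w2 * cnj w1)\<^sup>2)"

definition imag_quadratic_discriminant :: "rat \<Rightarrow> bool" where
  "imag_quadratic_discriminant D \<longleftrightarrow>
     (\<exists>K. imag_quadratic_field K \<and> field_discriminant K D)"


section \<open>Lattices on positive definite quadratic spaces\<close>

text \<open>Leibniz formula for a square matrix with rows and columns indexed by the finite set \<open>S\<close>.\<close>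

definition det_on :: "'b set \<Rightarrow> ('b \<Rightarrow> 'b \<Rightarrow> 'a::comm_ring_1) \<Rightarrow> 'a" where
  "det_on S A = (\<Sum>p | p permutes S. of_int (sign p) * (\<Prod>i\<in>S. A i (p i)))"

text \<open>The quadratic form is \<open>Q x = B x x\<close>. With this normalisation the Gram matrix of
  $a x^2 + b x y + c y^2$ has determinant $a c - b^2/4$, so that \<open>-4\<close> times it is $b^2 - 4 a c$.\<close>

locale posdef_quadratic_space = vector_space scale
  for scale :: "rat \<Rightarrow> 'v::ab_group_add \<Rightarrow> 'v" +
  fixes B :: "'v \<Rightarrow> 'v \<Rightarrow> rat"
  assumes finite_dim: "\<exists>S. finite S \<and> span S = UNIV"
    and B_sym: "B x y = B y x"
    and B_add: "B (x + y) z = B x z + B y z"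
    and B_scale: "B (scale c x) y = c * B x y"
    and B_pos: "x \<noteq> 0 \<Longrightarrow> 0 < B x x"
begin

definition basis_of_space :: "'v set \<Rightarrow> bool" where
  "basis_of_space S \<longleftrightarrow> finite S \<and> independent S \<and> span S = UNIV"

definition int_span :: "'v set \<Rightarrow> 'v set" where
  "int_span S = {(\<Sum>b\<in>S. scale (of_int (c b)) b) | c :: 'v \<Rightarrow> int. True}"

definition lattice :: "'v set \<Rightarrow> bool" where
  "lattice L \<longleftrightarrow> (\<exists>S. basis_of_space S \<and> L = int_span S) \<and> (\<forall>x\<in>L. B x x \<in> \<int>)"

text \<open>The determinant of the Gram matrix does not depend on the chosen \<open>\<int>\<close>-basis.\<close>

definition lattice_det :: "'v set \<Rightarrow> rat" where
  "lattice_det L = det_on (SOME S. basis_of_space S \<and> L = int_span S) B"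

text \<open>Likewise, the determinant of an endomorphism does not depend on the chosen basis.\<close>

definition endo_det :: "('v \<Rightarrow> 'v) \<Rightarrow> rat" where
  "endo_det f = (let S = (SOME S. basis_of_space S)
                 in det_on S (\<lambda>b b'. representation S (f b) b'))"

definition orthogonal_group :: "('v \<Rightarrow> 'v) set" where
  "orthogonal_group =
     {f. Vector_Spaces.linear scale scale f \<and> bij f \<and> (\<forall>x y. B (f x) (f y) = B x y)}"

definition special_orthogonal_group :: "('v \<Rightarrow> 'v) set" where
  "special_orthogonal_group = {f \<in> orthogonal_group. endo_det f = 1}"

text \<open>The index is the number of cosets, and is \<open>0\<close> when there are infinitely many of them.\<close>

definition lattice_index :: "'v set \<Rightarrow> 'v set \<Rightarrow> nat" where
  "lattice_index L M = card ((\<lambda>x. (+) x ` M) ` L)"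

definition sublattices :: "'v set \<Rightarrow> nat \<Rightarrow> 'v set set" where
  "sublattices L m = {M. lattice M \<and> M \<subseteq> L \<and> lattice_index L M = m}"

text \<open>The isometries range over a group \<open>G\<close> of isometries of the whole space; they need not
  preserve \<open>L\<close>.\<close>

definition num_classes :: "('v \<Rightarrow> 'v) set \<Rightarrow> 'v set \<Rightarrow> nat \<Rightarrow> nat" where
  "num_classes G L m =
     card (sublattices L m //
           {(M, N). M \<in> sublattices L m \<and> N \<in> sublattices L m \<and> (\<exists>f\<in>G. f ` M = N)})"

definition a_SL :: "'v set \<Rightarrow> nat \<Rightarrow> nat" where
  "a_SL L m = num_classes special_orthogonal_group L m"

definition a_GL :: "'v set \<Rightarrow> nat \<Rightarrow> nat" where
  "a_GL L m = num_classes orthogonal_group L m"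

end


section \<open>Dirichlet series\<close>

text \<open>The coefficient at index \<open>0\<close> is ignored: the sum runs over positive integers.\<close>

definition dirichlet_term :: "(nat \<Rightarrow> nat) \<Rightarrow> complex \<Rightarrow> nat \<Rightarrow> complex" where
  "dirichlet_term a s k = of_nat (a (Suc k)) * of_nat (Suc k) powr (- s)"

definition dirichlet_series :: "(nat \<Rightarrow> nat) \<Rightarrow> complex \<Rightarrow> complex" where
  "dirichlet_series a s = (\<Sum>k. dirichlet_term a s k)"

definition abscissa_of_convergence :: "(nat \<Rightarrow> nat) \<Rightarrow> ereal" where
  "abscissa_of_convergence a = (INF s \<in> {s. summable (dirichlet_term a s)}. ereal (Re s))"

text \<open>\<open>F\<close> is a meromorphic continuation to \<open>U\<close> of the function given by the Dirichlet series on
  its open half-plane of convergence.\<close>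

definition meromorphic_continuation ::
    "(nat \<Rightarrow> nat) \<Rightarrow> complex set \<Rightarrow> (complex \<Rightarrow> complex) \<Rightarrow> bool" where
  "meromorphic_continuation a U F \<longleftrightarrow> F meromorphic_on U \<and>
     (\<forall>s\<in>U. abscissa_of_convergence a < ereal (Re s) \<longrightarrow> F s = dirichlet_series a s)"

definition simple_pole :: "(complex \<Rightarrow> complex) \<Rightarrow> complex \<Rightarrow> bool" where
  "simple_pole F z \<longleftrightarrow> is_pole F z \<and> zorder F z = -1"

end

theory Submission
  imports Defs
begin

text \<open>Up to scaling, \<open>L\<close> is an ideal of the maximal order \<open>\<O>\<close> of the imaginary quadratic field \<open>\<K>\<close> of
  discriminant $-4 d_L$ with the norm form, proper isometries are the multiplications by elements of
  \<open>\<K>\<close> of absolute value 1, and the improper ones are composed with complex conjugation.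

  A sublattice \<open>M\<close> generates the \<open>\<O>\<close>-module \<open>J = M + \<tau> M\<close>. The number $\psi(f)$ of \<open>M\<close> of index \<open>f\<close> in a
  given \<open>J\<close> with \<open>J = M + \<tau> M\<close> does not depend on \<open>J\<close>, because \<open>J\<close> is locally principal. The units of
  \<open>\<O>\<close> act on these \<open>M\<close> with stabiliser \<open>\<plusminus>1\<close> if \<open>f > 1\<close>. Hence $\zeta^{SL}_L$ is the product of a series over classes
  of ideals, absolutely convergent for \<open>Re s > 1\<close>, with the series of $\psi(f)$ divided by half the
  number of units, except for the term $\psi(1) = 1$. Counting all sublattices
  of \<open>\<O>\<close> in the same way gives $\zeta(s) \zeta(s-1) = \zeta_K(s) \sum \psi(f) f^{-s}$, so the pole at 2
  is that of $\zeta(s-1)$.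

  For $\zeta^{GL}_L$ a class has to be given weight 1/2 if its conjugate embeds into \<open>L\<close>, which only depends on \<open>J\<close>,
  and this is wrong only for the classes invariant under conjugation. Each of these is determined by a divisor of
  $4 d_L m^2$ and a parity, so they contribute a series converging for \<open>Re s > 1\<close>.\<close>

section \<open>Index and Hermite normal form\<close>

text \<open>The acting group is infinite, and a class meets the sublattices of index m in a finite
  set whose size varies. Classes are therefore counted as a sum of 1/(class size) over sublattices,
  which can be regrouped by \<open>J\<close>. The point is then that the class size, and for the
  full orthogonal group the existence of improper images, depend on \<open>M\<close> only through
  \<open>J\<close> and the index f; what fails to do so goes into an error series.

  The hypothesis on the discriminant enters as maximality of \<O>. It makes modules locally
  principal, and it forces a rotation preserving a module to be a unit.

  The series zeta_K occurs as a denominator: it converges for Re s > 1, is nonzero at 2 by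
  positivity, and a zero elsewhere could at worst produce a pole. Its convergence comes from
  encoding an ideal by a short element and one of finitely many overmodules of \<O>. On Re s > 1 the
  factor zeta(s - 1) requires zeta on Re w > 0. The lower bound for the abscissa is read off the
  pole.\<close>

definition add_subgroup :: "'a::ab_group_add set \<Rightarrow> bool" where
  "add_subgroup M \<longleftrightarrow> 0 \<in> M \<and> (\<forall>x\<in>M. \<forall>y\<in>M. x - y \<in> M)"

text \<open>The same count as \<open>lattice_index\<close>, available both in the quadratic space
  and in the complex numbers. Infinite index gives 0, so \<open>idx A M > 0\<close> expresses finite
  index.\<close>

definition idx :: "'a::ab_group_add set \<Rightarrow> 'a set \<Rightarrow> nat" where
  "idx A M = card ((\<lambda>x. (+) x ` M) ` A)"

lemma add_subgroup_zero: "add_subgroup M \<Longrightarrow> 0 \<in> M"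
  by (simp add: add_subgroup_def)

lemma add_subgroup_diff: "add_subgroup M \<Longrightarrow> x \<in> M \<Longrightarrow> y \<in> M \<Longrightarrow> x - y \<in> M"
  by (simp add: add_subgroup_def)

lemma add_subgroup_minus: "add_subgroup M \<Longrightarrow> x \<in> M \<Longrightarrow> - x \<in> M"
  using add_subgroup_diff[of M 0 x] by (simp add: add_subgroup_zero)

lemma add_subgroup_add: "add_subgroup M \<Longrightarrow> x \<in> M \<Longrightarrow> y \<in> M \<Longrightarrow> x + y \<in> M"
  using add_subgroup_diff[of M x "- y"] by (simp add: add_subgroup_minus)

lemma coset_eq_iff:
  assumes "add_subgroup M"
  shows "(+) x ` M = (+) y ` M \<longleftrightarrow> x - y \<in> M"
proof
  assume "(+) x ` M = (+) y ` M"
  moreover have "x \<in> (+) x ` M" using add_subgroup_zero[OF assms] by force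
  ultimately show "x - y \<in> M" by auto
next
  have *: "(+) x ` M \<subseteq> (+) y ` M" if "x - y \<in> M" for x y
  proof
    fix z assume "z \<in> (+) x ` M"
    then obtain w where w: "w \<in> M" "z = x + w" by auto
    then have "z = y + ((x - y) + w)" by simp
    moreover have "(x - y) + w \<in> M" using that w assms by (simp add: add_subgroup_add)
    ultimately show "z \<in> (+) y ` M" by blast
  qed
  assume "x - y \<in> M"
  moreover from this have "y - x \<in> M" using add_subgroup_minus[OF assms, of "x - y"] by simp
  ultimately show "(+) x ` M = (+) y ` M" using * by blast
qed

text \<open>The maps have the same fibres on \<open>A\<close>, so sending \<open>g x\<close> to
  \<open>h x\<close> is a well-defined bijection between the images.\<close>

lemma card_image_eq_card_image:
  assumes "\<And>x y. x \<in> A \<Longrightarrow> y \<in> A \<Longrightarrow> g x = g y \<longleftrightarrow> h x = h y"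
  shows "card (g ` A) = card (h ` A)"
proof (rule bij_betw_same_card[of "\<lambda>z. h (inv_into A g z)"])
  have *: "h (inv_into A g (g x)) = h x" if "x \<in> A" for x
    using assms[of "inv_into A g (g x)" x] that by (simp add: f_inv_into_f inv_into_into)
  show "bij_betw (\<lambda>z. h (inv_into A g z)) (g ` A) (h ` A)"
    unfolding bij_betw_def inj_on_def by (auto simp: * assms image_image)
qed

text \<open>First isomorphism theorem in coset form. Surjectivity is asked modulo \<open>N\<close>,
  because multiplication by a local generator reaches a module \<open>J\<close> only modulo f times
  \<open>J\<close>.\<close>

lemma idx_cong_hom:
  assumes N: "add_subgroup N" and M: "add_subgroup M"
    and f: "\<And>x y. f (x - y) = f x - f y" and fA: "f ` A \<subseteq> B"
    and surj: "\<And>z. z \<in> B \<Longrightarrow> \<exists>x\<in>A. z - f x \<in> N"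
    and ker: "\<And>x y. x \<in> A \<Longrightarrow> y \<in> A \<Longrightarrow> x - y \<in> M \<longleftrightarrow> f (x - y) \<in> N"
  shows "idx A M = idx B N"
proof -
  have "(\<lambda>z. (+) z ` N) ` B = (\<lambda>x. (+) (f x) ` N) ` A"
    using fA surj by (fastforce simp: image_iff coset_eq_iff[OF N])
  then show ?thesis
    unfolding idx_def
    using card_image_eq_card_image[of A "\<lambda>x. (+) x ` M" "\<lambda>x. (+) (f x) ` N"]
    by (simp add: coset_eq_iff[OF N] coset_eq_iff[OF M] ker f)
qed

lemma add_subgroup_image:
  assumes "add_subgroup M" "\<And>x y. f (x - y) = f x - f y"
  shows "add_subgroup (f ` M)"
  unfolding add_subgroup_def
proof (intro conjI ballI)
  have "f 0 = 0" using assms(2)[of 0 0] by simp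
  then show "0 \<in> f ` M" using add_subgroup_zero[OF assms(1)] by (metis image_eqI)
  fix x y assume "x \<in> f ` M" "y \<in> f ` M"
  then obtain x' y' where "x = f x'" "y = f y'" "x' \<in> M" "y' \<in> M" by blast
  then show "x - y \<in> f ` M" using add_subgroup_diff[OF assms(1)] assms(2) by (metis image_eqI)
qed

lemma idx_image:
  assumes M: "add_subgroup M" and f: "\<And>x y. f (x - y) = f x - f y" and inj: "inj f"
  shows "idx (f ` A) (f ` M) = idx A M"
proof -
  have "add_subgroup (f ` M)" using M f by (rule add_subgroup_image)
  then show ?thesis
  proof (intro idx_cong_hom[symmetric, where f = f] M f)
    fix z assume "z \<in> f ` A"
    then show "\<exists>x\<in>A. z - f x \<in> f ` M"
      using add_subgroup_zero[OF \<open>add_subgroup (f ` M)\<close>] by (metis diff_self imageE)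
  qed (auto simp only: inj_image_mem_iff[OF inj])
qed

text \<open>Fix a representative of each coset of \<open>J\<close> in \<open>A\<close>. Translating
  the cosets of \<open>M\<close> in \<open>J\<close> by these representatives yields every coset of
  \<open>M\<close> in \<open>A\<close> exactly once.\<close>

lemma idx_tower:
  assumes M: "add_subgroup M" and J: "add_subgroup J" and A: "add_subgroup A" and MJ: "M \<subseteq> J" and JA: "J \<subseteq> A"
  shows "idx A M = idx A J * idx J M"
proof -
  define \<rho> where "\<rho> C = (SOME x. x \<in> A \<and> C = (+) x ` J)" for C
  have \<rho>: "\<rho> C \<in> A \<and> C = (+) (\<rho> C) ` J" if "C \<in> (\<lambda>x. (+) x ` J) ` A" for C
    using someI_ex[of "\<lambda>x. x \<in> A \<and> C = (+) x ` J"] that unfolding \<rho>_def by blast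
  let ?F = "\<lambda>(C, E). (+) (\<rho> C) ` E"
  have comp: "(+) u ` (+) v ` M = (+) (u + v) ` M" for u v
    unfolding image_image by (rule image_cong) (simp_all add: add.assoc)
  have "bij_betw ?F ((\<lambda>x. (+) x ` J) ` A \<times> (\<lambda>x. (+) x ` M) ` J) ((\<lambda>x. (+) x ` M) ` A)"
    unfolding bij_betw_def
  proof
    show "inj_on ?F ((\<lambda>x. (+) x ` J) ` A \<times> (\<lambda>x. (+) x ` M) ` J)"
    proof (rule inj_onI, clarify)
      fix x x' y y'
      assume x: "x \<in> A" "x' \<in> A" "y \<in> J" "y' \<in> J"
        and eq: "(+) (\<rho> ((+) x ` J)) ` (+) y ` M = (+) (\<rho> ((+) x' ` J)) ` (+) y' ` M"
      let ?u = "\<rho> ((+) x ` J)" and ?v = "\<rho> ((+) x' ` J)"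
      have d: "?u + y - (?v + y') \<in> M" using eq by (simp add: comp coset_eq_iff[OF M])
      then have "(?u + y - (?v + y')) - (y - y') \<in> J"
        using MJ x J by (meson add_subgroup_diff subsetD)
      then have "?u - ?v \<in> J" by (simp add: algebra_simps)
      then have *: "(+) ?u ` J = (+) ?v ` J" by (simp add: coset_eq_iff[OF J])
      have u: "(+) x ` J = (+) ?u ` J" and v: "(+) x' ` J = (+) ?v ` J" using \<rho> x by blast+
      have 1: "(+) x ` J = (+) x' ` J" using * u v by (rule box_equals[OF _ sym sym])
      then have "?u = ?v" by simp
      then have "y - y' \<in> M" using d by simp
      then have "(+) y ` M = (+) y' ` M" by (simp add: coset_eq_iff[OF M])
      with 1 show "(+) x ` J = (+) x' ` J \<and> (+) y ` M = (+) y' ` M" by simp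
    qed
    show "?F ` ((\<lambda>x. (+) x ` J) ` A \<times> (\<lambda>x. (+) x ` M) ` J) = (\<lambda>x. (+) x ` M) ` A"
    proof (intro subset_antisym subsetI)
      fix E assume "E \<in> ?F ` ((\<lambda>x. (+) x ` J) ` A \<times> (\<lambda>x. (+) x ` M) ` J)"
      then obtain x y where "x \<in> A" "y \<in> J" "E = (+) (\<rho> ((+) x ` J)) ` (+) y ` M" by auto
      moreover have "\<rho> ((+) x ` J) \<in> A" using \<rho> \<open>x \<in> A\<close> by blast
      ultimately show "E \<in> (\<lambda>x. (+) x ` M) ` A"
        using JA A by (auto simp: comp add_subgroup_add)
    next
      fix E assume "E \<in> (\<lambda>x. (+) x ` M) ` A"
      then obtain x where x: "x \<in> A" "E = (+) x ` M" by auto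
      have "(+) x ` J = (+) (\<rho> ((+) x ` J)) ` J" using \<rho> x by blast
      then have "x - \<rho> ((+) x ` J) \<in> J" using coset_eq_iff[OF J] by blast
      moreover have "E = ?F ((+) x ` J, (+) (x - \<rho> ((+) x ` J)) ` M)"
        using x by (simp add: comp)
      ultimately show "E \<in> ?F ` ((\<lambda>x. (+) x ` J) ` A \<times> (\<lambda>x. (+) x ` M) ` J)"
        using x by blast
    qed
  qed
  then show ?thesis
    unfolding idx_def by (metis bij_betw_same_card card_cartesian_product)
qed

lemma idx_self: "add_subgroup M \<Longrightarrow> idx M M = 1"
proof -
  assume M: "add_subgroup M"
  have "(+) x ` M = (+) 0 ` M" if "x \<in> M" for x
    using that by (subst coset_eq_iff[OF M]) simp
  then have "(\<lambda>x. (+) x ` M) ` M = {(+) 0 ` M}"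
    using add_subgroup_zero[OF M] by blast
  then show ?thesis unfolding idx_def by (metis card_1_singleton_iff One_nat_def)
qed

lemma idx_eq_1D:
  assumes M: "add_subgroup M" and J: "add_subgroup J" and MJ: "M \<subseteq> J" and 1: "idx J M = 1"
  shows "M = J"
proof
  show "J \<subseteq> M"
  proof
    fix x assume "x \<in> J"
    moreover have "0 \<in> J" using J by (rule add_subgroup_zero)
    moreover obtain C where "(\<lambda>x. (+) x ` M) ` J = {C}"
      using 1 unfolding idx_def by (metis card_1_singletonE)
    ultimately have "(+) x ` M = (+) 0 ` M" by (metis imageI singletonD)
    then have "x - 0 \<in> M" by (simp only: coset_eq_iff[OF M])
    then show "x \<in> M" by simp
  qed
qed fact

lemma idx_pos_imp_finite: "idx A M > 0 \<Longrightarrow> finite ((\<lambda>x. (+) x ` M) ` A)"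
  unfolding idx_def using card_ge_0_finite by blast

lemma int_add_subgroup_cyclic:
  fixes G :: "int set"
  assumes G: "add_subgroup G" and n: "n \<in> G" "n > 0"
  obtains d where "d > 0" "G = range (\<lambda>k. k * d)"
proof -
  define d where "d = (LEAST d::nat. d > 0 \<and> int d \<in> G)"
  have d: "d > 0 \<and> int d \<in> G"
    unfolding d_def by (rule LeastI[of _ "nat n"]) (use n in auto)
  have dmin: "d \<le> e" if "e > 0" "int e \<in> G" for e
    unfolding d_def by (rule Least_le) (use that in auto)
  have natmul: "int k * int d \<in> G" for k
    by (induction k) (use d G in \<open>auto simp: add_subgroup_zero add_subgroup_add distrib_right\<close>)
  have mul: "k * int d \<in> G" for k
    using natmul[of "nat k"] add_subgroup_minus[OF G natmul[of "nat (- k)"]] by (cases "k \<ge> 0") auto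
  have "x \<in> range (\<lambda>k. k * int d)" if "x \<in> G" for x
  proof -
    have "x - (x div int d) * int d \<in> G" using that mul G by (simp add: add_subgroup_diff)
    then have "x mod int d \<in> G" by (simp add: minus_div_mult_eq_mod)
    moreover have "0 \<le> x mod int d" "x mod int d < int d" using d by simp_all
    ultimately have "x mod int d = 0" using dmin[of "nat (x mod int d)"] by fastforce
    then show ?thesis by (metis div_mult_mod_eq add.right_neutral rangeI)
  qed
  then have "G = range (\<lambda>k. k * int d)" using mul by blast
  then show ?thesis using that[of "int d"] d by simp
qed

section \<open>Lattices in the complex plane and their normal forms\<close>

definition zspan :: "complex \<Rightarrow> complex \<Rightarrow> complex set" where
  "zspan \<alpha> \<beta> = {of_int x * \<alpha> + of_int y * \<beta> | x y. True}"

lemma zspanI: "of_int x * \<alpha> + of_int y * \<beta> \<in> zspan \<alpha> \<beta>"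
  unfolding zspan_def by blast

lemma add_subgroup_zspan: "add_subgroup (zspan \<alpha> \<beta>)"
  unfolding add_subgroup_def
proof (intro conjI ballI)
  show "0 \<in> zspan \<alpha> \<beta>" using zspanI[of 0 \<alpha> 0 \<beta>] by simp
  fix z w assume "z \<in> zspan \<alpha> \<beta>" "w \<in> zspan \<alpha> \<beta>"
  then obtain x y x' y' where
    "z = of_int x * \<alpha> + of_int y * \<beta>" "w = of_int x' * \<alpha> + of_int y' * \<beta>"
    unfolding zspan_def by blast
  then have "z - w = of_int (x - x') * \<alpha> + of_int (y - y') * \<beta>" by (simp add: algebra_simps)
  then show "z - w \<in> zspan \<alpha> \<beta>" by (simp only: zspanI)
qed

lemma add_subgroup_int_mult:
  fixes M :: "'a::ring_1 set"
  assumes "add_subgroup M" "x \<in> M"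
  shows "of_int k * x \<in> M"
proof -
  have *: "of_nat n * x \<in> M" for n
    by (induction n) (use assms in \<open>auto simp: add_subgroup_zero add_subgroup_add distrib_right\<close>)
  show ?thesis using *[of "nat k"] add_subgroup_minus[OF assms(1) *[of "nat (- k)"]]
    by (cases "k \<ge> 0") simp_all
qed

lemma zspan_subset: "add_subgroup M \<Longrightarrow> \<alpha> \<in> M \<Longrightarrow> \<beta> \<in> M \<Longrightarrow> zspan \<alpha> \<beta> \<subseteq> M"
  unfolding zspan_def by (auto intro!: add_subgroup_add add_subgroup_int_mult[of M])

lemma in_zspan: "\<alpha> \<in> zspan \<alpha> \<beta>" "\<beta> \<in> zspan \<alpha> \<beta>"
  using zspanI[of 1 \<alpha> 0 \<beta>] zspanI[of 0 \<alpha> 1 \<beta>] by auto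

lemma image_mult_zspan: "(*) u ` zspan \<alpha> \<beta> = zspan (u * \<alpha>) (u * \<beta>)"
proof -
  have "u * (of_int x * \<alpha> + of_int y * \<beta>) = of_int x * (u * \<alpha>) + of_int y * (u * \<beta>)" for x y
    by (simp add: algebra_simps)
  then show ?thesis unfolding zspan_def by (auto simp: image_iff) metis+
qed

text \<open>\<open>Im (cnj \<alpha> * \<beta>)\<close> is the signed area of the parallelogram on
  \<alpha> and \<beta>. It serves as the covolume throughout, and its being nonzero expresses
  independence over the reals.\<close>

lemma real_coords_unique:
  assumes "Im (cnj \<alpha> * \<beta>) \<noteq> 0"
    and "of_real x * \<alpha> + of_real y * \<beta> = of_real x' * \<alpha> + of_real y' * \<beta>"
  shows "x = x' \<and> y = y'"
proof -
  define u v where "u = x - x'" and "v = y - y'"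
  have 0: "of_real u * \<alpha> + of_real v * \<beta> = 0"
    using assms(2) by (simp add: u_def v_def algebra_simps)
  \<comment> \<open>Pairing with \<alpha> and with \<beta> isolates one coordinate each, as in
    Cramer's rule.\<close>
  have "v * Im (cnj \<alpha> * \<beta>) = Im (cnj \<alpha> * (of_real u * \<alpha> + of_real v * \<beta>))"
    and "u * Im (cnj \<alpha> * \<beta>) = - Im (cnj \<beta> * (of_real u * \<alpha> + of_real v * \<beta>))"
    by (simp_all add: algebra_simps)
  then have "v * Im (cnj \<alpha> * \<beta>) = 0" "u * Im (cnj \<alpha> * \<beta>) = 0" unfolding 0 by simp_all
  with assms(1) show ?thesis unfolding u_def v_def mult_eq_0_iff by simp
qed

lemma int_coords_unique:
  assumes "Im (cnj \<alpha> * \<beta>) \<noteq> 0"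
    and "of_int x * \<alpha> + of_int y * \<beta> = of_int x' * \<alpha> + of_int y' * \<beta>"
  shows "x = x' \<and> y = y'"
  using real_coords_unique[OF assms(1), of "of_int x" "of_int y" "of_int x'" "of_int y'"] assms(2)
  by simp

lemma Im_cnj_mult_combination:
  "Im (cnj (of_int p * \<alpha> + of_int q * \<beta>) * (of_int r * \<alpha> + of_int t * \<beta>))
     = of_int (p * t - q * r) * Im (cnj \<alpha> * \<beta>)"
  by (simp add: algebra_simps)

text \<open>Each basis is an integral combination of the other. The two determinants multiply to 1,
  hence each is 1 or -1.\<close>

lemma covolume_unique:
  assumes eq: "zspan \<alpha> \<beta> = zspan \<alpha>' \<beta>'" and nz: "Im (cnj \<alpha> * \<beta>) \<noteq> 0"
  shows "\<bar>Im (cnj \<alpha> * \<beta>)\<bar> = \<bar>Im (cnj \<alpha>' * \<beta>')\<bar>"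
proof -
  have *: "\<exists>k::int. Im (cnj \<gamma>' * \<delta>') = of_int k * Im (cnj \<gamma> * \<delta>)"
    if "zspan \<gamma> \<delta> = zspan \<gamma>' \<delta>'" for \<gamma> \<delta> \<gamma>' \<delta>'
  proof -
    have "\<gamma>' \<in> zspan \<gamma> \<delta>" "\<delta>' \<in> zspan \<gamma> \<delta>" using in_zspan[of \<gamma>' \<delta>'] in_zspan[of \<delta>'] that by simp_all
    then obtain p q r t where "\<gamma>' = of_int p * \<gamma> + of_int q * \<delta>" "\<delta>' = of_int r * \<gamma> + of_int t * \<delta>"
      unfolding zspan_def by blast
    then show ?thesis using Im_cnj_mult_combination[of p \<gamma> q \<delta> r t] by blast
  qed
  obtain k l :: int where kl: "Im (cnj \<alpha>' * \<beta>') = of_int k * Im (cnj \<alpha> * \<beta>)"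
    "Im (cnj \<alpha> * \<beta>) = of_int l * Im (cnj \<alpha>' * \<beta>')"
    using *[OF eq] *[OF eq[symmetric]] by blast
  then have "of_int (l * k) * Im (cnj \<alpha> * \<beta>) = 1 * Im (cnj \<alpha> * \<beta>)" by simp
  then have "l * k = 1" using nz by (metis mult_cancel_right of_int_eq_1_iff)
  then have "\<bar>k\<bar> = 1" by (auto simp: zmult_eq_1_iff)
  then have "\<bar>real_of_int k\<bar> = 1" by (metis of_int_1 of_int_abs)
  then show ?thesis using kl(1) by (metis abs_mult mult_1)
qed

text \<open>The generators form a triangular matrix: t is determined by the coefficient of \<beta>,
  and then s by that of \<alpha>.\<close>

lemma zspan_hnf_memb:
  assumes nz: "Im (cnj \<alpha> * \<beta>) \<noteq> 0" 
  shows "of_int x * \<alpha> + of_int y * \<beta> \<in> zspan (of_int d * \<alpha>) (of_int k * \<alpha> + of_int g * \<beta>) \<longleftrightarrow>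
         (\<exists>s t. x = s * d + t * k \<and> y = t * g)"
proof
  assume "of_int x * \<alpha> + of_int y * \<beta> \<in> zspan (of_int d * \<alpha>) (of_int k * \<alpha> + of_int g * \<beta>)"
  then obtain s t where "of_int x * \<alpha> + of_int y * \<beta> =
      of_int s * (of_int d * \<alpha>) + of_int t * (of_int k * \<alpha> + of_int g * \<beta>)"
    unfolding zspan_def by blast
  also have "\<dots> = of_int (s * d + t * k) * \<alpha> + of_int (t * g) * \<beta>" by (simp add: algebra_simps)
  finally show "\<exists>s t. x = s * d + t * k \<and> y = t * g" using int_coords_unique[OF nz] by blast
next
  assume "\<exists>s t. x = s * d + t * k \<and> y = t * g"
  then obtain s t where st: "x = s * d + t * k" "y = t * g" by blast
  have "of_int x * \<alpha> + of_int y * \<beta> =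
      of_int s * (of_int d * \<alpha>) + of_int t * (of_int k * \<alpha> + of_int g * \<beta>)"
    unfolding st by (simp add: algebra_simps)
  then show "of_int x * \<alpha> + of_int y * \<beta> \<in> zspan (of_int d * \<alpha>) (of_int k * \<alpha> + of_int g * \<beta>)"
    by (simp only: zspanI)
qed

lemma idx_hnf:
  assumes nz: "Im (cnj \<alpha> * \<beta>) \<noteq> 0" and d: "d > 0" and g: "g > 0"
  shows "idx (zspan \<alpha> \<beta>) (zspan (of_int d * \<alpha>) (of_int k * \<alpha> + of_int g * \<beta>)) = nat (d * g)"
proof -
  let ?M = "zspan (of_int d * \<alpha>) (of_int k * \<alpha> + of_int g * \<beta>)"
  let ?e = "\<lambda>(x, y). of_int x * \<alpha> + of_int y * \<beta>"
  let ?T = "{0..<d} \<times> {0..<g}"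
  have M: "add_subgroup ?M" by (rule add_subgroup_zspan)
  have diff: "?e p - ?e q \<in> ?M \<longleftrightarrow> (\<exists>s t. fst p - fst q = s * d + t * k \<and> snd p - snd q = t * g)" for p q
  proof -
    have "?e p - ?e q = of_int (fst p - fst q) * \<alpha> + of_int (snd p - snd q) * \<beta>"
      by (cases p; cases q) (simp add: algebra_simps)
    then show ?thesis by (simp only: zspan_hnf_memb[OF nz])
  qed
  have "inj_on (\<lambda>p. (+) (?e p) ` ?M) ?T"
  proof (rule inj_onI)
    fix p q assume p: "p \<in> ?T" and q: "q \<in> ?T" and "(+) (?e p) ` ?M = (+) (?e q) ` ?M"
    then obtain s t where st: "fst p - fst q = s * d + t * k" "snd p - snd q = t * g"
      using diff[of p q] by (auto simp: coset_eq_iff[OF M])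
    have "\<bar>t * g\<bar> < g" using p q st(2) by auto
    then have "t = 0" using g by (simp add: abs_mult) 
    moreover from this have "\<bar>s * d\<bar> < d" using p q st(1) by auto
    then have "s = 0" using d by (simp add: abs_mult)
    ultimately show "p = q" using st by (simp add: prod_eq_iff)
  qed
  moreover have "(\<lambda>z. (+) z ` ?M) ` zspan \<alpha> \<beta> = (\<lambda>p. (+) (?e p) ` ?M) ` ?T"
  proof (intro subset_antisym subsetI)
    fix C assume "C \<in> (\<lambda>z. (+) z ` ?M) ` zspan \<alpha> \<beta>"
    then obtain x y where C: "C = (+) (?e (x, y)) ` ?M" unfolding zspan_def by auto
    \<comment> \<open>Reduce the \<beta>-coordinate first. Subtracting t times the second generator
      also shifts the \<alpha>-coordinate by t * k, which is taken into account before reducing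
      modulo d.\<close>
    define t where "t = y div g"
    define s where "s = (x - t * k) div d"
    let ?q = "((x - t * k) mod d, y mod g)"
    have "x - (x - t * k) mod d = s * d + t * k" "y - y mod g = t * g"
      unfolding t_def s_def by (simp_all add: minus_mod_eq_div_mult algebra_simps)
    then have "?e (x, y) - ?e ?q \<in> ?M" by (subst diff) auto
    then have "C = (+) (?e ?q) ` ?M" unfolding C by (simp only: coset_eq_iff[OF M])
    moreover have "?q \<in> ?T" using d g by simp
    ultimately show "C \<in> (\<lambda>p. (+) (?e p) ` ?M) ` ?T" by blast
  next
    fix C assume "C \<in> (\<lambda>p. (+) (?e p) ` ?M) ` ?T"
    then obtain x y where "C = (+) (?e (x, y)) ` ?M" by auto
    then show "C \<in> (\<lambda>z. (+) z ` ?M) ` zspan \<alpha> \<beta>" using zspanI[of x \<alpha> y \<beta>] by auto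
  qed
  ultimately have "idx (zspan \<alpha> \<beta>) ?M = card ?T"
    unfolding idx_def by (simp only: card_image)
  then show ?thesis using d g by (simp add: nat_mult_distrib)
qed

text \<open>Here d generates the multiples of \<alpha> in \<open>M\<close>, g generates the
  \<beta>-coordinates of \<open>M\<close>, and k is the \<alpha>-coordinate of a lift of g, reduced
  modulo d. Finite index ensures that neither group of integers is zero.\<close>

lemma hnf_exists:
  assumes nz: "Im (cnj \<alpha> * \<beta>) \<noteq> 0" and M: "add_subgroup M" and MA: "M \<subseteq> zspan \<alpha> \<beta>"
    and fin: "idx (zspan \<alpha> \<beta>) M > 0"
  obtains d g k where "d > 0" "g > 0" "0 \<le> k" "k < d"
    "M = zspan (of_int d * \<alpha>) (of_int k * \<alpha> + of_int g * \<beta>)"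
proof -
  \<comment> \<open>Pigeonhole: two multiples of z lie in the same of finitely many cosets.\<close>
  have mult: "\<exists>n::int. n > 0 \<and> of_int n * z \<in> M" if z: "z \<in> zspan \<alpha> \<beta>" for z
  proof -
    have "finite ((\<lambda>n::nat. (+) (of_int (int n) * z) ` M) ` UNIV)"
      by (rule finite_subset[OF _ idx_pos_imp_finite[OF fin]])
         (use z in \<open>auto intro!: imageI add_subgroup_int_mult add_subgroup_zspan simp del: of_int_of_nat_eq\<close>)
    then have "\<not> inj (\<lambda>n::nat. (+) (of_int (int n) * z) ` M)"
      using finite_imageD infinite_UNIV_nat by blast
    then obtain i j :: nat where "i < j" "(+) (of_int (int i) * z) ` M = (+) (of_int (int j) * z) ` M"
      unfolding inj_def by (metis nat_neq_iff)
    then have "of_int (int j) * z - of_int (int i) * z \<in> M" using coset_eq_iff[OF M] by metis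
    then show ?thesis using \<open>i < j\<close>
      by (intro exI[of _ "int j - int i"]) (simp add: algebra_simps)
  qed
  define X where "X = {x::int. of_int x * \<alpha> \<in> M}"
  define Y where "Y = {y::int. \<exists>x::int. of_int x * \<alpha> + of_int y * \<beta> \<in> M}"
  have X: "add_subgroup X"
    using add_subgroup_diff[OF M] add_subgroup_zero[OF M] unfolding X_def add_subgroup_def by (auto simp: left_diff_distrib)
  have Y: "add_subgroup Y"
    unfolding add_subgroup_def
  proof (intro conjI ballI)
    show "0 \<in> Y" using add_subgroup_zero[OF M] unfolding Y_def by (auto intro: exI[of _ 0])
    fix y y' assume "y \<in> Y" "y' \<in> Y"
    then obtain x x' :: int where
      "of_int x * \<alpha> + of_int y * \<beta> \<in> M" "of_int x' * \<alpha> + of_int y' * \<beta> \<in> M"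
      unfolding Y_def by blast
    then have "(of_int x * \<alpha> + of_int y * \<beta>) - (of_int x' * \<alpha> + of_int y' * \<beta>) \<in> M"
      by (rule add_subgroup_diff[OF M])
    then have "of_int (x - x') * \<alpha> + of_int (y - y') * \<beta> \<in> M" by (simp add: algebra_simps)
    then show "y - y' \<in> Y" unfolding Y_def by blast
  qed
  obtain n1 where n1: "n1 > 0" "n1 \<in> X" using mult[OF in_zspan(1)] unfolding X_def by blast
  obtain n2 where n2: "n2 > 0" "n2 \<in> Y" using mult[OF in_zspan(2)] unfolding Y_def
    by (metis (mono_tags, lifting) add_0 mem_Collect_eq mult_zero_left of_int_0)
  obtain d where d: "d > 0" "X = range (\<lambda>k. k * d)" using int_add_subgroup_cyclic[OF X n1(2,1)] .
  obtain g where g: "g > 0" "Y = range (\<lambda>k. k * g)" using int_add_subgroup_cyclic[OF Y n2(2,1)] .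
  have "1 * g \<in> Y" unfolding g by blast
  then obtain k0 :: int where k0: "of_int k0 * \<alpha> + of_int g * \<beta> \<in> M" unfolding Y_def by auto
  define k where "k = k0 mod d"
  have dM: "of_int d * \<alpha> \<in> M" using d unfolding X_def by (metis mem_Collect_eq mult_1 rangeI)
  have "of_int k * \<alpha> + of_int g * \<beta> = (of_int k0 * \<alpha> + of_int g * \<beta>) - of_int (k0 div d) * (of_int d * \<alpha>)"
    unfolding k_def by (simp add: minus_div_mult_eq_mod[symmetric] algebra_simps)
  then have kM: "of_int k * \<alpha> + of_int g * \<beta> \<in> M"
    using add_subgroup_diff[OF M k0 add_subgroup_int_mult[OF M dM]] by metis
  have "M \<subseteq> zspan (of_int d * \<alpha>) (of_int k * \<alpha> + of_int g * \<beta>)"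
  proof
    fix z assume z: "z \<in> M"
    then obtain x y where xy: "z = of_int x * \<alpha> + of_int y * \<beta>" using MA unfolding zspan_def by blast
    then have "y \<in> Y" using z unfolding Y_def by blast
    then obtain t where t: "y = t * g" using g by blast
    have "z - of_int t * (of_int k * \<alpha> + of_int g * \<beta>) \<in> M"
      using z kM M by (simp add: add_subgroup_diff add_subgroup_int_mult)
    moreover have "z - of_int t * (of_int k * \<alpha> + of_int g * \<beta>) = of_int (x - t * k) * \<alpha>"
      unfolding xy t by (simp add: algebra_simps)
    ultimately have "x - t * k \<in> X" unfolding X_def by simp
    then obtain s where "x - t * k = s * d" using d by blast
    then have "x = s * d + t * k" by simp
    then show "z \<in> zspan (of_int d * \<alpha>) (of_int k * \<alpha> + of_int g * \<beta>)"
      unfolding xy t by (subst zspan_hnf_memb[OF nz]) blast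
  qed
  then have "M = zspan (of_int d * \<alpha>) (of_int k * \<alpha> + of_int g * \<beta>)"
    using zspan_subset[OF M dM kM] by blast
  then show ?thesis using that[of d g k] d g by (simp add: k_def)
qed

lemma add_subgroup_basis:
  assumes nz: "Im (cnj \<alpha> * \<beta>) \<noteq> 0" and M: "add_subgroup M" and MA: "M \<subseteq> zspan \<alpha> \<beta>"
    and fin: "idx (zspan \<alpha> \<beta>) M > 0"
  obtains \<alpha>' \<beta>' where "M = zspan \<alpha>' \<beta>'"
    "\<bar>Im (cnj \<alpha>' * \<beta>')\<bar> = idx (zspan \<alpha> \<beta>) M * \<bar>Im (cnj \<alpha> * \<beta>)\<bar>"
proof -
  obtain d g k where *: "d > 0" "g > 0" "M = zspan (of_int d * \<alpha>) (of_int k * \<alpha> + of_int g * \<beta>)"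
    using hnf_exists[OF assms] .
  have "Im (cnj (of_int d * \<alpha>) * (of_int k * \<alpha> + of_int g * \<beta>)) = of_int (d * g) * Im (cnj \<alpha> * \<beta>)"
    using Im_cnj_mult_combination[of d \<alpha> 0 \<beta> k g] by simp
  moreover have "real (idx (zspan \<alpha> \<beta>) M) = of_int (d * g)"
    using idx_hnf[OF nz *(1,2), of k] * by simp
  ultimately show ?thesis using that[OF *(3)] *(1,2) by (simp add: abs_mult)
qed

lemma covolume_idx:
  assumes nz: "Im (cnj \<alpha> * \<beta>) \<noteq> 0" and MA: "zspan \<alpha>' \<beta>' \<subseteq> zspan \<alpha> \<beta>"
    and fin: "idx (zspan \<alpha> \<beta>) (zspan \<alpha>' \<beta>') > 0"
  shows "\<bar>Im (cnj \<alpha>' * \<beta>')\<bar> = idx (zspan \<alpha> \<beta>) (zspan \<alpha>' \<beta>') * \<bar>Im (cnj \<alpha> * \<beta>)\<bar>"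
proof -
  obtain \<gamma> \<delta> where *: "zspan \<alpha>' \<beta>' = zspan \<gamma> \<delta>"
    "\<bar>Im (cnj \<gamma> * \<delta>)\<bar> = idx (zspan \<alpha> \<beta>) (zspan \<alpha>' \<beta>') * \<bar>Im (cnj \<alpha> * \<beta>)\<bar>"
    using add_subgroup_basis[OF nz add_subgroup_zspan MA fin] by metis
  then have "Im (cnj \<gamma> * \<delta>) \<noteq> 0" using nz fin by auto
  then show ?thesis using covolume_unique[OF *(1)[symmetric]] * by simp
qed

text \<open>Lagrange's theorem for the quotient. In normal form the index is d * g, and multiplying
  by it clears both pivots of the triangular system.\<close>

lemma idx_mult_subset:
  assumes nz: "Im (cnj \<alpha> * \<beta>) \<noteq> 0" and M: "add_subgroup M" and MA: "M \<subseteq> zspan \<alpha> \<beta>"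
    and fin: "idx (zspan \<alpha> \<beta>) M > 0" and z: "z \<in> zspan \<alpha> \<beta>"
  shows "of_nat (idx (zspan \<alpha> \<beta>) M) * z \<in> M"
proof -
  obtain d g k where *: "d > 0" "g > 0" "M = zspan (of_int d * \<alpha>) (of_int k * \<alpha> + of_int g * \<beta>)"
    using hnf_exists[OF nz M MA fin] .
  obtain x y where z: "z = of_int x * \<alpha> + of_int y * \<beta>" using z unfolding zspan_def by blast
  have "of_nat (idx (zspan \<alpha> \<beta>) M) = (of_int (d * g) :: complex)"
    using idx_hnf[OF nz *(1,2), of k] * by simp
  then have "of_nat (idx (zspan \<alpha> \<beta>) M) * z = of_int (d * g * x) * \<alpha> + of_int (d * g * y) * \<beta>"
    unfolding z by (simp add: algebra_simps)
  also have "\<dots> \<in> M" unfolding *(3)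
    by (subst zspan_hnf_memb[OF nz], rule exI[of _ "g * x - y * k"], rule exI[of _ "d * y"])
       (simp add: algebra_simps)
  finally show ?thesis .
qed

text \<open>Mutual inclusion makes the pivots divide each other; then k and k' agree modulo d and
  both are reduced.\<close>

lemma hnf_inj:
  assumes nz: "Im (cnj \<alpha> * \<beta>) \<noteq> 0" and pos: "d > 0" "g > 0" "d' > 0" "g' > 0"
    and k: "0 \<le> k" "k < d" "0 \<le> k'" "k' < d'"
    and eq: "zspan (of_int d * \<alpha>) (of_int k * \<alpha> + of_int g * \<beta>)
       = zspan (of_int d' * \<alpha>) (of_int k' * \<alpha> + of_int g' * \<beta>)"
  shows "d = d' \<and> k = k' \<and> g = g'"
proof -
  have *: "d' dvd d \<and> g' dvd g \<and> (g = g' \<longrightarrow> d' dvd k - k')"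
    if eq: "zspan (of_int d * \<alpha>) (of_int k * \<alpha> + of_int g * \<beta>)
       = zspan (of_int d' * \<alpha>) (of_int k' * \<alpha> + of_int g' * \<beta>)" and pos: "g' > 0" for d d' g g' k k'
  proof -
    have "of_int d * \<alpha> + of_int 0 * \<beta> \<in> zspan (of_int d' * \<alpha>) (of_int k' * \<alpha> + of_int g' * \<beta>)"
      using in_zspan(1)[of "of_int d * \<alpha>" "of_int k * \<alpha> + of_int g * \<beta>"] eq by simp
    moreover have "of_int k * \<alpha> + of_int g * \<beta> \<in> zspan (of_int d' * \<alpha>) (of_int k' * \<alpha> + of_int g' * \<beta>)"
      using in_zspan(2)[of "of_int k * \<alpha> + of_int g * \<beta>" "of_int d * \<alpha>"] eq by simp
    ultimately obtain s t s' t' where st: "d = s * d' + t * k'" "0 = t * g'"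
      "k = s' * d' + t' * k'" "g = t' * g'"
      unfolding zspan_hnf_memb[OF nz] by blast
    then have "t = 0" using pos by simp
    moreover have "t' = 1" if "g = g'" using st(4) pos that by simp
    ultimately show ?thesis using st by auto
  qed
  have 1: "d = d'" "g = g'"
    using *[OF eq] *[OF eq[symmetric]] pos by (auto intro: zdvd_antisym_nonneg)
  then have "d dvd k - k'" using *[OF eq] pos by simp
  moreover have "\<bar>k - k'\<bar> < d" using k 1 by linarith
  ultimately have "k = k'" using dvd_imp_le_int[of "k - k'" d] pos by force
  with 1 show ?thesis by simp
qed

text \<open>A normal form of index m is a divisor d of m, which fixes the other pivot, together with
  a residue modulo d. This is why the number of sublattices is the sum of divisors.\<close>

lemma bij_betw_hnf:
  assumes nz: "Im (cnj \<alpha> * \<beta>) \<noteq> 0" and m: "m > 0"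
  shows "bij_betw (\<lambda>(d, k). zspan (of_nat d * \<alpha>) (of_nat k * \<alpha> + of_nat (m div d) * \<beta>))
     (SIGMA d:{d. d dvd m}. {..<d}) {M. add_subgroup M \<and> M \<subseteq> zspan \<alpha> \<beta> \<and> idx (zspan \<alpha> \<beta>) M = m}"
  (is "bij_betw ?F ?T ?S")
  unfolding bij_betw_def
proof
  have pos: "m div d > 0" "d > 0" if "d dvd m" for d
    using that m by (metis dvd_div_eq_0_iff gr0I less_nat_zero_code, metis dvd_pos_nat)
  show "inj_on ?F ?T"
  proof (rule inj_onI, clarify)
    fix d k d' k'
    assume d: "d dvd m" "d' dvd m" and k: "k < d" "k' < d'" and
      eq: "zspan (of_nat d * \<alpha>) (of_nat k * \<alpha> + of_nat (m div d) * \<beta>) =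
           zspan (of_nat d' * \<alpha>) (of_nat k' * \<alpha> + of_nat (m div d') * \<beta>)"
    have "int d = int d' \<and> int k = int k' \<and> int (m div d) = int (m div d')"
      using pos[OF d(1)] pos[OF d(2)] k eq by (intro hnf_inj[OF nz]) simp_all
    then show "d = d' \<and> k = k'" by simp
  qed
  show "?F ` ?T = ?S"
  proof (intro subset_antisym subsetI)
    fix M assume "M \<in> ?F ` ?T"
    then obtain d k where d: "d dvd m" "k < d"
      and M: "M = zspan (of_int (int d) * \<alpha>) (of_int (int k) * \<alpha> + of_int (int (m div d)) * \<beta>)" by auto
    have "idx (zspan \<alpha> \<beta>) M = m"
      unfolding M using pos[OF d(1)] d by (subst idx_hnf[OF nz]) (simp_all flip: of_nat_mult)
    moreover have "M \<subseteq> zspan \<alpha> \<beta>" unfolding M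
      by (intro zspan_subset add_subgroup_zspan add_subgroup_int_mult add_subgroup_add in_zspan)
    ultimately show "M \<in> ?S" by (simp add: M add_subgroup_zspan)
  next
    fix M assume M: "M \<in> ?S"
    then obtain d g k where *: "d > 0" "g > 0" "0 \<le> k" "k < d"
      "M = zspan (of_int d * \<alpha>) (of_int k * \<alpha> + of_int g * \<beta>)"
      using hnf_exists[OF nz, of M] m by blast
    have "m = nat (d * g)" using M idx_hnf[OF nz *(1,2), of k] * by simp
    then have dg: "m = nat d * nat g" using * by (simp add: nat_mult_distrib)
    have "M = ?F (nat d, nat k)" using * by (simp add: dg)
    moreover have "(nat d, nat k) \<in> ?T" using * by (simp add: dg)
    ultimately show "M \<in> ?F ` ?T" by blast
  qed
qed

lemma
  assumes nz: "Im (cnj \<alpha> * \<beta>) \<noteq> 0" and m: "m > 0"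
  shows finite_add_subgroups_idx: "finite {M. add_subgroup M \<and> M \<subseteq> zspan \<alpha> \<beta> \<and> idx (zspan \<alpha> \<beta>) M = m}"
    and card_add_subgroups_idx: "card {M. add_subgroup M \<and> M \<subseteq> zspan \<alpha> \<beta> \<and> idx (zspan \<alpha> \<beta>) M = m} = \<Sum>{d. d dvd m}"
proof -
  have "finite (SIGMA d:{d. d dvd m}. {..<d})" using m by (intro finite_SigmaI) auto
  then show "finite {M. add_subgroup M \<and> M \<subseteq> zspan \<alpha> \<beta> \<and> idx (zspan \<alpha> \<beta>) M = m}"
    using bij_betw_finite[OF bij_betw_hnf[OF assms]] by blast
  show "card {M. add_subgroup M \<and> M \<subseteq> zspan \<alpha> \<beta> \<and> idx (zspan \<alpha> \<beta>) M = m} = \<Sum>{d. d dvd m}"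
    using bij_betw_same_card[OF bij_betw_hnf[OF assms]] m by (simp add: card_SigmaI)
qed

section \<open>Dirichlet series\<close>

definition ds :: "(nat \<Rightarrow> real) \<Rightarrow> complex \<Rightarrow> complex" where
  "ds f s = (\<Sum>k. of_real (f (Suc k)) * of_nat (Suc k) powr (- s))"

text \<open>Absolute convergence depends only on Re s, so it is recorded at a real point.\<close>

definition dsummable :: "(nat \<Rightarrow> real) \<Rightarrow> real \<Rightarrow> bool" where
  "dsummable f x \<longleftrightarrow> summable (\<lambda>k. \<bar>f (Suc k)\<bar> * real (Suc k) powr (- x))"

definition dconv :: "(nat \<Rightarrow> real) \<Rightarrow> (nat \<Rightarrow> real) \<Rightarrow> nat \<Rightarrow> real" where
  "dconv f g n = (\<Sum>d | d dvd n. f d * g (n div d))"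

lemma norm_of_nat_powr: "norm (of_nat (Suc k) powr s) = real (Suc k) powr Re s"
proof -
  have "(of_nat (Suc k) :: complex) = of_real (real (Suc k))" by simp
  then show ?thesis by (simp only: norm_powr_real_powr' Re_complex_of_real) (simp add: norm_powr_real_powr)
qed

lemma dsummable_iff:
  "dsummable f (Re s) \<longleftrightarrow> summable (\<lambda>k. norm (of_real (f (Suc k)) * of_nat (Suc k) powr (- s)))"
  unfolding dsummable_def norm_mult norm_of_nat_powr by simp

lemma dsummable_mono:
  assumes "dsummable g x" "\<And>n. n > 0 \<Longrightarrow> \<bar>f n\<bar> \<le> \<bar>g n\<bar>" "x \<le> y"
  shows "dsummable f y"
  unfolding dsummable_def
proof (rule summable_comparison_test'[where N = 0])
  show "summable (\<lambda>k. \<bar>g (Suc k)\<bar> * real (Suc k) powr (- x))"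
    using assms(1) by (simp add: dsummable_def)
  show "norm (\<bar>f (Suc k)\<bar> * real (Suc k) powr (- y)) \<le> \<bar>g (Suc k)\<bar> * real (Suc k) powr (- x)" for k
    unfolding real_norm_def abs_mult by (intro mult_mono) (use assms in \<open>auto intro!: powr_mono\<close>)
qed

lemma dsummable_cmult: "dsummable f x \<Longrightarrow> dsummable (\<lambda>n. c * f n) x"
  unfolding dsummable_def abs_mult mult.assoc by (rule summable_mult)

lemma dsummable_add:
  assumes "dsummable f x" "dsummable g x"
  shows "dsummable (\<lambda>n. f n + g n) x"
  unfolding dsummable_def
proof (rule summable_comparison_test'[where N = 0])
  show "summable (\<lambda>k. \<bar>f (Suc k)\<bar> * real (Suc k) powr (- x) + \<bar>g (Suc k)\<bar> * real (Suc k) powr (- x))"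
    using assms unfolding dsummable_def by (rule summable_add)
  show "norm (\<bar>f (Suc k) + g (Suc k)\<bar> * real (Suc k) powr (- x))
    \<le> \<bar>f (Suc k)\<bar> * real (Suc k) powr (- x) + \<bar>g (Suc k)\<bar> * real (Suc k) powr (- x)" for k
    unfolding distrib_right[symmetric] real_norm_def abs_mult
    by (intro mult_mono) auto
qed

lemma dsummable_one: "x > 1 \<Longrightarrow> dsummable (\<lambda>_. 1) x"
  unfolding dsummable_def using summable_Suc_iff[of "\<lambda>n. real n powr (- x)"]
  by (simp add: summable_real_powr_iff del: of_nat_Suc)

lemma of_nat_mult_powr: "of_nat (Suc k) * of_nat (Suc k) powr (- s) = (of_nat (Suc k) :: complex) powr (- (s - 1))"
  by (simp add: powr_diff powr_minus divide_simps del: of_nat_Suc)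

lemma dsummable_of_nat: "x > 2 \<Longrightarrow> dsummable real x"
proof -
  assume x: "x > 2"
  have "real (Suc k) * real (Suc k) powr (- x) = real (Suc k) powr (- (x - 1))" for k
    by (simp add: powr_diff powr_minus divide_simps del: of_nat_Suc)
  then show ?thesis using dsummable_one[of "x - 1"] x
    unfolding dsummable_def by (simp del: of_nat_Suc)
qed

lemma ds_of_nat: "ds real s = ds (\<lambda>_. 1) (s - 1)"
  unfolding ds_def of_real_of_nat_eq of_nat_mult_powr by simp

lemma dsummable_imp_summable:
  assumes "dsummable f (Re s)"
  shows "summable (\<lambda>k. of_real (f (Suc k)) * of_nat (Suc k) powr (- s) :: complex)"
  using assms unfolding dsummable_iff by (rule summable_norm_cancel)

lemma ds_sums:
  assumes "dsummable f (Re s)"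
  shows "(\<lambda>k. of_real (f (Suc k)) * of_nat (Suc k) powr (- s)) sums ds f s"
  unfolding ds_def by (intro summable_sums dsummable_imp_summable assms)

lemma ds_add:
  assumes "dsummable f (Re s)" "dsummable g (Re s)"
  shows "ds (\<lambda>n. f n + g n) s = ds f s + ds g s"
  using sums_add[OF ds_sums[OF assms(1)] ds_sums[OF assms(2)]]
  unfolding ds_def by (simp add: sums_iff algebra_simps)

lemma ds_cmult:
  assumes "dsummable f (Re s)"
  shows "ds (\<lambda>n. c * f n) s = of_real c * ds f s"
  using sums_mult[OF ds_sums[OF assms], of "of_real c"]
  unfolding ds_def by (simp add: sums_iff algebra_simps)

lemma ds_cong: "(\<And>n. n > 0 \<Longrightarrow> f n = g n) \<Longrightarrow> ds f s = ds g s"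
  unfolding ds_def by simp

lemma dsummable_cong: "(\<And>n. n > 0 \<Longrightarrow> f n = g n) \<Longrightarrow> dsummable f x \<longleftrightarrow> dsummable g x"
  unfolding dsummable_def by simp

lemma delta_sums: "(\<lambda>k. of_real (if Suc k = 1 then 1 else 0) * of_nat (Suc k) powr (- s)) sums (1::complex)"
proof -
  have "(\<lambda>k. of_real (if Suc k = 1 then 1 else 0) * of_nat (Suc k) powr (- s))
    = (\<lambda>k. if k = 0 then 1 else (0::complex))" by auto
  then show ?thesis using sums_single[of 0 "\<lambda>_. 1::complex"] by simp
qed

lemma ds_delta: "ds (\<lambda>n. if n = 1 then 1 else 0) s = 1"
  unfolding ds_def using delta_sums by (rule sums_unique[symmetric])

lemma dsummable_delta: "dsummable (\<lambda>n. if n = 1 then 1 else 0) x"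
proof -
  have "(\<lambda>k. \<bar>if Suc k = 1 then 1 else 0\<bar> * real (Suc k) powr (- x)) = (\<lambda>k. if k = 0 then 1 else 0)" by auto
  then show ?thesis unfolding dsummable_def by (simp add: summable_single)
qed

text \<open>Passes from ordered series to unconditional sums over the positive integers, so that
  double sums may be rearranged.\<close>

lemma summable_Suc_imp_has_sum:
  fixes u :: "nat \<Rightarrow> complex"
  assumes "summable (\<lambda>k. norm (u (Suc k)))"
  shows "(\<lambda>n. norm (u n)) summable_on {0<..}" "(u has_sum (\<Sum>k. u (Suc k))) {0<..}"
proof -
  have r: "range Suc = {0<..}" by (auto simp: image_iff gr0_conv_Suc)
  have "((\<lambda>k. u (Suc k)) has_sum (\<Sum>k. u (Suc k))) UNIV"
    by (intro norm_summable_imp_has_sum assms summable_sums) (rule summable_norm_cancel[OF assms])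
  then show "(u has_sum (\<Sum>k. u (Suc k))) {0<..}"
    unfolding r[symmetric] by (subst has_sum_reindex) (auto simp: o_def)
  then show "(\<lambda>n. norm (u n)) summable_on {0<..}"
    by (metis has_sum_imp_summable summable_on_iff_abs_summable_on_complex)
qed

text \<open>The product of the sums is an absolutely convergent double sum over pairs (i, j). The
  pair corresponds to n = i j with the marked divisor i, and summing over divisors first gives the
  convolution.\<close>

lemma conv_has_sum:
  fixes u v :: "nat \<Rightarrow> complex"
  assumes u: "summable (\<lambda>k. norm (u (Suc k)))" and v: "summable (\<lambda>k. norm (v (Suc k)))"
  shows "((\<lambda>n. \<Sum>d | d dvd n. u d * v (n div d)) has_sum (\<Sum>k. u (Suc k)) * (\<Sum>k. v (Suc k))) {0<..}"
proof -
  let ?P = "{0<..} :: nat set"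
  let ?F = "\<lambda>(i, j). u i * v j"
  note u' = summable_Suc_imp_has_sum[OF u] and v' = summable_Suc_imp_has_sum[OF v]
  have "(\<lambda>p. norm (?F p)) summable_on ?P \<times> ?P"
    unfolding Infinite_Sum.abs_summable_on_Sigma_iff
    using u'(1) v'(1) by (auto simp: norm_mult infsum_cmult_right' abs_mult infsum_nonneg
      intro!: summable_on_cmult_right summable_on_cmult_left)
  then have sF: "?F summable_on ?P \<times> ?P" by (rule abs_summable_summable)
  have "infsum ?F (?P \<times> ?P) = infsum (\<lambda>i. infsum (\<lambda>j. ?F (i, j)) ?P) ?P"
    using infsum_Sigma_banach[OF sF] by simp
  also have "\<dots> = (\<Sum>k. u (Suc k)) * (\<Sum>k. v (Suc k))"
    using infsumI[OF u'(2)] infsumI[OF v'(2)] by (simp add: infsum_cmult_right' infsum_cmult_left')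
  finally have 1: "(?F has_sum (\<Sum>k. u (Suc k)) * (\<Sum>k. v (Suc k))) (?P \<times> ?P)"
    using has_sum_infsum[OF sF] by simp
  have 2: "((\<lambda>(n, d). u d * v (n div d)) has_sum (\<Sum>k. u (Suc k)) * (\<Sum>k. v (Suc k)))
      (SIGMA n:?P. {d. d dvd n})"
    using 1
    by (subst has_sum_reindex_bij_witness[of _ "\<lambda>(i, j). (i * j, i)" "\<lambda>(n, d). (d, n div d)" "?P \<times> ?P" ?F])
       (auto simp: dvd_div_eq_0_iff dest: dvd_pos_nat intro!: Nat.gr0I)
  show ?thesis
  proof (rule has_sum_Sigma'[OF 2])
    fix n :: nat assume "n \<in> ?P"
    then show "((\<lambda>y. case (n, y) of (n, d) \<Rightarrow> u d * v (n div d)) has_sum (\<Sum>d | d dvd n. u d * v (n div d)))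
        {d. d dvd n}"
      by (intro has_sum_finiteI) auto
  qed
qed

lemma dconv_term:
  assumes "n > 0"
  shows "of_real (dconv f g n) * (of_nat n :: complex) powr (- s) =
    (\<Sum>d | d dvd n. (of_real (f d) * of_nat d powr (- s)) * (of_real (g (n div d)) * of_nat (n div d) powr (- s)))"
  unfolding dconv_def of_real_sum sum_distrib_right
proof (rule sum.cong[OF refl])
  fix d assume "d \<in> {d. d dvd n}"
  then obtain e where e: "n = d * e" by auto
  then have "d > 0" using assms by auto
  have "(of_nat n :: complex) powr (- s) = of_nat d powr (- s) * of_nat (n div d) powr (- s)"
    using e \<open>d > 0\<close> powr_times_real[of "of_nat d" "of_nat e" "- s"] by simp
  then show "of_real (f d * g (n div d)) * (of_nat n :: complex) powr (- s) =
    of_real (f d) * of_nat d powr (- s) * (of_real (g (n div d)) * of_nat (n div d) powr (- s))"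
    by simp
qed

text \<open>The product of the series of absolute values is treated at a real point; the convolution
  itself is then dominated by that of the absolute values.\<close>

lemma dsummable_dconv:
  assumes "dsummable f x" "dsummable g x"
  shows "dsummable (dconv f g) x"
proof -
  define u v :: "nat \<Rightarrow> complex"
    where "u n = of_real \<bar>f n\<bar> * of_nat n powr (- of_real x)" and "v n = of_real \<bar>g n\<bar> * of_nat n powr (- of_real x)" for n
  have s: "summable (\<lambda>k. norm (u (Suc k)))" "summable (\<lambda>k. norm (v (Suc k)))"
    using assms dsummable_iff[of "\<lambda>n. \<bar>f n\<bar>" "of_real x"] dsummable_iff[of "\<lambda>n. \<bar>g n\<bar>" "of_real x"]
    unfolding u_def v_def by (simp_all add: dsummable_def)
  let ?w = "\<lambda>n. \<Sum>d | d dvd n. u d * v (n div d)"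
  have r: "range Suc = {0<..}" by (auto simp: image_iff gr0_conv_Suc)
  have "(\<lambda>n. norm (?w n)) summable_on {0<..}"
    using has_sum_imp_summable[OF conv_has_sum[OF s]]
    by (simp only: summable_on_iff_abs_summable_on_complex)
  then have "((\<lambda>n. norm (?w n)) \<circ> Suc) summable_on UNIV"
    unfolding r[symmetric] by (subst (asm) summable_on_reindex) auto
  then have "summable (\<lambda>k. norm (?w (Suc k)))"
    using summable_on_UNIV_nonneg_real_iff[of "\<lambda>k. norm (?w (Suc k))"] by (simp add: o_def)
  moreover have "norm (?w (Suc k)) = norm (of_real (dconv (\<lambda>n. \<bar>f n\<bar>) (\<lambda>n. \<bar>g n\<bar>) (Suc k)) * (of_nat (Suc k) :: complex) powr (- of_real x))" for k
    unfolding u_def v_def by (subst dconv_term) simp_all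
  ultimately have "dsummable (dconv (\<lambda>n. \<bar>f n\<bar>) (\<lambda>n. \<bar>g n\<bar>)) x"
    using dsummable_iff[of "dconv (\<lambda>n. \<bar>f n\<bar>) (\<lambda>n. \<bar>g n\<bar>)" "of_real x"] by simp
  then show ?thesis
  proof (rule dsummable_mono)
    fix n :: nat
    have "\<bar>dconv f g n\<bar> \<le> dconv (\<lambda>n. \<bar>f n\<bar>) (\<lambda>n. \<bar>g n\<bar>) n"
      unfolding dconv_def abs_mult[symmetric] by (rule sum_abs)
    then show "\<bar>dconv f g n\<bar> \<le> \<bar>dconv (\<lambda>n. \<bar>f n\<bar>) (\<lambda>n. \<bar>g n\<bar>) n\<bar>" by linarith
  qed simp
qed

lemma ds_dconv:
  assumes f: "dsummable f (Re s)" and g: "dsummable g (Re s)"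
  shows "ds (dconv f g) s = ds f s * ds g s"
proof -
  define u v :: "nat \<Rightarrow> complex"
    where "u n = of_real (f n) * of_nat n powr (- s)" and "v n = of_real (g n) * of_nat n powr (- s)" for n
  have s: "summable (\<lambda>k. norm (u (Suc k)))" "summable (\<lambda>k. norm (v (Suc k)))"
    using f g unfolding dsummable_iff u_def v_def by simp_all
  have "((\<lambda>n. \<Sum>d | d dvd n. u d * v (n div d)) has_sum ds f s * ds g s) {0<..}"
    using conv_has_sum[OF s] unfolding ds_def u_def v_def .
  moreover have "((\<lambda>n. of_real (dconv f g n) * of_nat n powr (- s)) has_sum ds (dconv f g) s) {0<..}"
    using summable_Suc_imp_has_sum(2)[of "\<lambda>n. of_real (dconv f g n) * of_nat n powr (- s)"]
      dsummable_dconv[OF f g] unfolding dsummable_iff ds_def by simp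
  moreover have eq: "(\<Sum>d | d dvd n. u d * v (n div d)) = of_real (dconv f g n) * of_nat n powr (- s)"
    if "n \<in> {0<..}" for n
    unfolding u_def v_def using that by (subst dconv_term) auto
  have "((\<lambda>n. \<Sum>d | d dvd n. u d * v (n div d)) has_sum ds (dconv f g) s) {0<..}"
    using calculation(2) by (subst has_sum_cong[OF eq])
  ultimately show ?thesis by (blast intro: has_sum_unique)
qed

text \<open>Weierstrass test with a local majorant around each point.\<close>

lemma holomorphic_on_suminf:
  fixes f :: "nat \<Rightarrow> complex \<Rightarrow> complex"
  assumes S: "open S" and hol: "\<And>n. f n holomorphic_on S"
    and bound: "\<And>x. x \<in> S \<Longrightarrow> \<exists>d h. 0 < d \<and> summable h \<and> (\<forall>n. \<forall>y\<in>ball x d \<inter> S. norm (f n y) \<le> h n)"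
  shows "(\<lambda>x. \<Sum>n. f n x) holomorphic_on S"
proof -
  have "\<exists>g g'. \<forall>x\<in>S. (\<lambda>n. f n x) sums g x \<and> (\<lambda>n. deriv (f n) x) sums g' x \<and> (g has_field_derivative g' x) (at x)"
  proof (rule series_and_derivative_comparison_local[OF S])
    show "(f n has_field_derivative deriv (f n) x) (at x)" if "x \<in> S" for n x
      using holomorphic_derivI[OF hol S that] .
    show "\<exists>d h. 0 < d \<and> summable h \<and> (\<forall>\<^sub>F n in sequentially. \<forall>y\<in>ball x d \<inter> S. norm (f n y) \<le> h n)"
      if x: "x \<in> S" for x
    proof -
      obtain d h where "0 < d" "summable h" "\<forall>n. \<forall>y\<in>ball x d \<inter> S. norm (f n y) \<le> h n"
        using bound[OF x] by blast
      then show ?thesis by (intro exI[of _ d] exI[of _ h] conjI always_eventually)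
    qed
  qed
  then obtain g g' where g: "\<And>x. x \<in> S \<Longrightarrow> (\<lambda>n. f n x) sums g x"
    "\<And>x. x \<in> S \<Longrightarrow> (g has_field_derivative g' x) (at x)" by blast
  have "g holomorphic_on S"
    using g(2) has_field_derivative_at_within unfolding holomorphic_on_def field_differentiable_def by blast
  then show ?thesis
    by (rule holomorphic_transform) (use g(1) in \<open>simp add: sums_iff\<close>)
qed

lemma ds_holomorphic:
  assumes "\<And>x. x > x0 \<Longrightarrow> dsummable f x"
  shows "ds f holomorphic_on {s. x0 < Re s}"
  unfolding ds_def
proof (rule holomorphic_on_suminf)
  show "open {s. x0 < Re s}" by (rule open_halfspace_Re_gt)
  show "(\<lambda>s. of_real (f (Suc n)) * of_nat (Suc n) powr (- s)) holomorphic_on {s. x0 < Re s}" for n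
    by (intro holomorphic_intros) (simp del: of_nat_Suc)
  fix s assume "s \<in> {s. x0 < Re s}"
  define d where "d = (Re s - x0) / 2"
  have d: "d > 0" "x0 + d > x0" "Re s = x0 + 2 * d" using \<open>s \<in> _\<close> by (auto simp: d_def field_simps)
  have "norm (of_real (f (Suc n)) * of_nat (Suc n) powr (- y) :: complex) \<le> \<bar>f (Suc n)\<bar> * real (Suc n) powr - (x0 + d)"
    if "y \<in> ball s d" for n y
  proof -
    have "\<bar>Re (s - y)\<bar> < d" using that abs_Re_le_cmod[of "s - y"] by (simp add: dist_norm)
    then have "x0 + d \<le> Re y" using d(3) by (simp add: abs_less_iff)
    then show ?thesis unfolding norm_mult norm_of_nat_powr
      by (intro mult_mono) (auto intro!: powr_mono)
  qed
  moreover have "summable (\<lambda>n. \<bar>f (Suc n)\<bar> * real (Suc n) powr - (x0 + d))"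
    using assms[OF d(2)] by (simp add: dsummable_def)
  ultimately show "\<exists>d h. 0 < d \<and> summable h \<and> (\<forall>n. \<forall>y\<in>ball s d \<inter> {s. x0 < Re s}.
      norm (of_real (f (Suc n)) * of_nat (Suc n) powr (- y) :: complex) \<le> h n)"
    using d(1) by blast
qed

section \<open>Continuation of (w - 1) zeta(w) to Re w > 0\<close>

lemma powr_diff_bound:
  fixes n t :: real
  assumes n: "n > 0" and t: "n \<le> t" and w: "Re w > -1"
  shows "norm (of_real t powr (- w) - of_real n powr (- w)) \<le> norm w * n powr (- Re w - 1) * (t - n)"
proof -
  have "norm (of_real t powr (- w) - of_real n powr (- w)) \<le> norm w * n powr (- Re w - 1) * norm (of_real t - of_real n :: complex)"
  proof (rule field_differentiable_bound[where S = "closed_segment (of_real n) (of_real t)" and f' = "\<lambda>z. - w * z powr (- w - 1)"])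
    fix z assume "z \<in> closed_segment (of_real n) (of_real t :: complex)"
    then obtain x where x: "z = of_real x" "x \<ge> n"
      unfolding closed_segment_of_real using t by (auto simp: closed_segment_eq_real_ivl)
    then have z: "z \<notin> \<real>\<^sub>\<le>\<^sub>0" using n by simp
    then show "((\<lambda>z. z powr (- w)) has_field_derivative - w * z powr (- w - 1)) (at z within closed_segment (of_real n) (of_real t))"
      by (auto intro!: derivative_eq_intros)
    have "norm (z powr (- w - 1)) = x powr (- Re w - 1)"
      using x n by (simp add: norm_powr_real_powr)
    \<comment> \<open>The condition Re w > -1 makes the size of the derivative decrease along the
      segment, so the left end point bounds it.\<close>
    also have "\<dots> \<le> n powr (- Re w - 1)" using x n w by (intro powr_mono2') auto
    finally show "norm (- w * z powr (- w - 1)) \<le> norm w * n powr (- Re w - 1)"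
      by (simp add: norm_mult mult_left_mono)
  qed auto
  moreover have "norm (of_real t - of_real n :: complex) = t - n"
    using t by (simp flip: of_real_diff)
  ultimately show ?thesis by simp
qed

text \<open>With n = \<open>Suc k\<close> this equals (w - 1) times the difference between n^(-w)
  and the integral of x^(-w) from n to n + 1, except that it is written without dividing by w -
  1.\<close>

definition zeta_term :: "nat \<Rightarrow> complex \<Rightarrow> complex" where
  "zeta_term k w = (w - 1) * of_nat (Suc k) powr (- w) - of_nat (Suc k) powr (1 - w) + of_nat (Suc (Suc k)) powr (1 - w)"

text \<open>Comparing with the integral gains one power of n over n^(-w), which moves convergence
  from Re w > 1 to Re w > 0.\<close>

lemma zeta_term_bound:
  assumes w: "Re w > 0"
  shows "norm (zeta_term k w) \<le> norm (w - 1) * norm w * real (Suc k) powr (- Re w - 1)"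
proof -
  define n where "n = real (Suc k)"
  have n: "n > 0" by (simp add: n_def)
  \<comment> \<open>The increment of \<open>H\<close> from n to n + 1 is the term, and its
    derivative is (w - 1) (n^(-w) - z^(-w)), to which \<open>powr_diff_bound\<close>
    applies.\<close>
  define H where "H = (\<lambda>z. (w - 1) * of_real n powr (- w) * z + z powr (1 - w))"
  define C where "C = norm (w - 1) * (norm w * n powr (- Re w - 1))"
  have "norm (H (of_real (n + 1)) - H (of_real n)) \<le> C * norm (of_real (n + 1) - of_real n :: complex)"
  proof (rule field_differentiable_bound[where S = "closed_segment (of_real n) (of_real (n + 1))"
        and f' = "\<lambda>z. (w - 1) * of_real n powr (- w) + (1 - w) * z powr (- w)"])
    fix z assume "z \<in> closed_segment (of_real n) (of_real (n + 1) :: complex)"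
    then obtain x where x: "z = of_real x" "n \<le> x" "x \<le> n + 1"
      unfolding closed_segment_of_real by (auto simp: closed_segment_eq_real_ivl)
    then have z: "z \<notin> \<real>\<^sub>\<le>\<^sub>0" using n by simp
    then show "(H has_field_derivative (w - 1) * of_real n powr (- w) + (1 - w) * z powr (- w)) (at z within closed_segment (of_real n) (of_real (n + 1)))"
      unfolding H_def by (auto intro!: derivative_eq_intros)
    have "norm ((w - 1) * of_real n powr (- w) + (1 - w) * z powr (- w))
       = norm (w - 1) * norm (z powr (- w) - of_real n powr (- w))"
      by (simp flip: norm_mult add: norm_minus_commute algebra_simps)
    also have "norm (z powr (- w) - of_real n powr (- w)) \<le> norm w * n powr (- Re w - 1) * (x - n)"
      unfolding x(1) using n x w by (intro powr_diff_bound) auto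
    also have "\<dots> \<le> norm w * n powr (- Re w - 1) * 1"
      using x by (intro mult_left_mono) auto
    finally show "norm ((w - 1) * of_real n powr (- w) + (1 - w) * z powr (- w)) \<le> C"
      unfolding C_def by (simp add: mult_left_mono)
  qed auto
  moreover have "H (of_real (n + 1)) - H (of_real n) = zeta_term k w"
    unfolding H_def n_def zeta_term_def by (simp add: algebra_simps)
  ultimately show ?thesis by (simp add: C_def n_def mult.assoc)
qed

text \<open>This is (w - 1) zeta(w). The summand 1 compensates the telescoping part of the terms,
  whose sum is -1 for Re w > 1.\<close>

definition zeta_shifted :: "complex \<Rightarrow> complex" where
  "zeta_shifted w = 1 + (\<Sum>k. zeta_term k w)"

lemma zeta_shifted_holomorphic: "zeta_shifted holomorphic_on {w. 0 < Re w}"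
proof -
  have "(\<lambda>w. \<Sum>k. zeta_term k w) holomorphic_on {w. 0 < Re w}"
  proof (rule holomorphic_on_suminf)
    show "open {w. 0 < Re w}" by (rule open_halfspace_Re_gt)
    show "zeta_term n holomorphic_on {w. 0 < Re w}" for n
      unfolding zeta_term_def by (intro holomorphic_intros) (simp_all del: of_nat_Suc)
    fix s assume s: "s \<in> {w. 0 < Re w}"
    define d where "d = Re s / 2"
    have d: "d > 0" "Re s = 2 * d" using s by (auto simp: d_def)
    have "norm (zeta_term n y) \<le> (norm s + d + 1) * (norm s + d) * real (Suc n) powr (- d - 1)"
      if "y \<in> ball s d" for n y
    proof -
      have yd: "norm (s - y) < d" using that by (simp add: dist_norm)
      then have "\<bar>Re (s - y)\<bar> < d" using abs_Re_le_cmod[of "s - y"] by linarith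
      then have Re: "d \<le> Re y" using d(2) by (simp add: abs_less_iff)
      have y: "norm y \<le> norm s + d"
        using norm_triangle_ineq2[of y s] yd by (simp add: norm_minus_commute)
      moreover have "norm (y - 1) \<le> norm s + d + 1"
        using norm_triangle_ineq4[of y 1] y by simp
      ultimately have "norm (y - 1) * norm y * real (Suc n) powr (- Re y - 1)
          \<le> (norm s + d + 1) * (norm s + d) * real (Suc n) powr (- d - 1)"
        using Re d by (intro mult_mono powr_mono) auto
      then show ?thesis using zeta_term_bound[of y n] Re d by linarith
    qed
    moreover have "summable (\<lambda>n. (norm s + d + 1) * (norm s + d) * real (Suc n) powr (- d - 1))"
      using d summable_Suc_iff[of "\<lambda>n. real n powr (- d - 1)"]
      by (intro summable_mult) (simp add: summable_real_powr_iff del: of_nat_Suc)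
    ultimately show "\<exists>d h. 0 < d \<and> summable h \<and> (\<forall>n. \<forall>y\<in>ball s d \<inter> {w. 0 < Re w}. norm (zeta_term n y) \<le> h n)"
      using d(1) by blast
  qed
  then show ?thesis unfolding zeta_shifted_def by (intro holomorphic_intros)
qed

text \<open>Every term vanishes at w = 1. The value is the residue of zeta at its pole.\<close>

lemma zeta_shifted_1: "zeta_shifted 1 = 1"
  unfolding zeta_shifted_def zeta_term_def by (simp del: of_nat_Suc)

lemma zeta_shifted_eq:
  assumes w: "Re w > 1"
  shows "zeta_shifted w = (w - 1) * ds (\<lambda>_. 1) w"
proof -
  have 1: "(\<lambda>k. (w - 1) * of_nat (Suc k) powr (- w)) sums ((w - 1) * ds (\<lambda>_. 1) w)"
    using sums_mult[OF ds_sums[OF dsummable_one[OF w]]] by simp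
  have "(\<lambda>k. of_nat (Suc k) powr (1 - w) :: complex) \<longlonglongrightarrow> 0"
  proof (rule tendsto_norm_zero_cancel)
    have "(\<lambda>k. real (Suc k) powr (1 - Re w)) \<longlonglongrightarrow> 0"
      using w by (intro tendsto_neg_powr filterlim_compose[OF filterlim_real_sequentially filterlim_Suc]) auto
    then show "(\<lambda>k. norm (of_nat (Suc k) powr (1 - w) :: complex)) \<longlonglongrightarrow> 0"
      unfolding norm_of_nat_powr by simp
  qed
  then have "(\<lambda>k. of_nat (Suc (Suc k)) powr (1 - w) - of_nat (Suc k) powr (1 - w)) sums (0 - of_nat (Suc 0) powr (1 - w) :: complex)"
    by (rule telescope_sums)
  then have 2: "(\<lambda>k. of_nat (Suc (Suc k)) powr (1 - w) - of_nat (Suc k) powr (1 - w)) sums (- 1 :: complex)"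
    by simp
  have "(\<lambda>k. zeta_term k w) sums ((w - 1) * ds (\<lambda>_. 1) w + - 1)"
    using sums_add[OF 1 2] unfolding zeta_term_def by (simp add: algebra_simps del: of_nat_Suc)
  then show ?thesis unfolding zeta_shifted_def by (simp add: sums_iff)
qed

section \<open>From a factorised Dirichlet series to its pole and its abscissa\<close>

lemma bounded_imp_dsummable:
  assumes "\<And>n. n > 0 \<Longrightarrow> f n \<ge> 0" "\<And>N. (\<Sum>k<N. f (Suc k) * real (Suc k) powr (- x)) \<le> C"
  shows "dsummable f x"
  unfolding dsummable_def
proof (rule summableI_nonneg_bounded)
  show "(\<Sum>k<N. \<bar>f (Suc k)\<bar> * real (Suc k) powr (- x)) \<le> C" for N
    using assms by simp
qed simp

text \<open>Abel summation: convergence at one point gives convergence at every real point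
  further to the right.\<close>

lemma dirichlet_convergence_half_plane:
  assumes sum: "summable (dirichlet_term a s)" and x: "Re s < x"
  shows "dsummable (\<lambda>n. real (a n)) x"
proof -
  define b where "b = dirichlet_term a s"
  define B where "B n = (\<Sum>k<n. b k)" for n
  define w where "w = of_real x - s"
  define c where "c k = (of_nat (Suc k) :: complex) powr (- w)" for k
  have w: "Re w > 0" using x by (simp add: w_def)
  have "Bseq B"
    using sum unfolding B_def b_def by (intro convergent_imp_Bseq) (simp add: summable_iff_convergent)
  then obtain C where C: "C > 0" "\<And>n. norm (B n) \<le> C" by (auto elim: BseqE)
  define h where "h k = norm w * real (Suc k) powr (- Re w - 1)" for k
  have "summable h"
    unfolding h_def using w summable_Suc_iff[of "\<lambda>n. real n powr (- Re w - 1)"]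
    by (intro summable_mult) (simp add: summable_real_powr_iff del: of_nat_Suc)
  have c1: "norm (c n) \<le> 1" for n
    using powr_mono[of "- Re w" 0 "real (Suc n)"] w unfolding c_def norm_of_nat_powr by simp
  have cd: "norm (c k - c (Suc k)) \<le> h k" for k
    using powr_diff_bound[of "real (Suc k)" "real (Suc (Suc k))" w] w
    unfolding c_def h_def of_real_of_nat_eq
    by (subst norm_minus_commute) simp
  \<comment> \<open>Summation by parts: the partial sums \<open>B\<close> are bounded and the
    factors \<open>c\<close> have summable variation.\<close>
  have abel: "(\<Sum>k<n. b k * c k) = B n * c n + (\<Sum>k<n. B (Suc k) * (c k - c (Suc k)))" for n
    by (induction n) (auto simp: B_def algebra_simps)
  have hsum: "(\<Sum>k<n. h k) \<le> suminf h" for n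
    using \<open>summable h\<close> by (rule sum_le_suminf) (auto simp: h_def)
  have bound: "norm (\<Sum>k<n. b k * c k) \<le> C + C * suminf h" for n
  proof -
    have "norm (\<Sum>k<n. B (Suc k) * (c k - c (Suc k))) \<le> (\<Sum>k<n. C * h k)"
      unfolding norm_mult
      by (rule order_trans[OF norm_sum]) (use C cd in \<open>auto simp: norm_mult intro!: sum_mono mult_mono\<close>)
    also have "\<dots> \<le> C * suminf h"
      unfolding sum_distrib_left[symmetric] using C hsum by (intro mult_left_mono) auto
    finally have 1: "norm (\<Sum>k<n. B (Suc k) * (c k - c (Suc k))) \<le> C * suminf h" .
    have "norm (B n * c n) \<le> C * 1"
      unfolding norm_mult using C c1 by (intro mult_mono) auto
    with 1 show ?thesis unfolding abel by (intro order_trans[OF norm_triangle_ineq]) simp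
  qed
  \<comment> \<open>By the choice of w the product is the nonnegative term at the real point x, so
    bounded partial sums imply convergence.\<close>
  have summand: "b k * c k = of_real (real (a (Suc k)) * real (Suc k) powr (- x))" for k
  proof -
    have "of_nat (Suc k) powr (- s) * of_nat (Suc k) powr (- w) = (of_nat (Suc k) :: complex) powr (- of_real x)"
      unfolding powr_add[symmetric] w_def by (simp add: algebra_simps)
    also have "\<dots> = of_real (real (Suc k)) powr of_real (- x)" by simp
    also have "\<dots> = of_real (real (Suc k) powr (- x))" by (subst powr_of_real) auto
    finally show ?thesis unfolding b_def c_def dirichlet_term_def by (simp add: mult.assoc)
  qed
  show ?thesis
  proof (rule bounded_imp_dsummable)
    show "(\<Sum>k<N. real (a (Suc k)) * real (Suc k) powr (- x)) \<le> C + C * suminf h" for N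
      using bound[of N] unfolding summand of_real_sum[symmetric] norm_of_real by linarith
  qed simp
qed

lemma dirichlet_series_eq_ds: "dirichlet_series a s = ds (\<lambda>n. real (a n)) s"
  unfolding dirichlet_series_def ds_def dirichlet_term_def by simp

lemma ds_pos:
  assumes "dsummable f x" "\<And>n. n > 0 \<Longrightarrow> f n \<ge> 0" "f 1 > 0"
  shows "ds f (of_real x) \<noteq> 0"
proof -
  have t: "of_real (f (Suc k)) * of_nat (Suc k) powr (- of_real x)
      = (of_real (f (Suc k) * real (Suc k) powr (- x)) :: complex)" for k
    using powr_of_real[of "real (Suc k)" "- x"] by simp
  have s: "summable (\<lambda>k. f (Suc k) * real (Suc k) powr (- x))"
    using assms(1,2) unfolding dsummable_def by simp
  have "ds f (of_real x) = of_real (\<Sum>k. f (Suc k) * real (Suc k) powr (- x))"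
    unfolding ds_def t by (rule suminf_of_real[OF s, symmetric])
  moreover have "(\<Sum>k. f (Suc k) * real (Suc k) powr (- x)) > 0"
    using assms(2,3) by (intro suminf_pos2[OF s, of 0]) auto
  ultimately show ?thesis by simp
qed

lemma ds_norm_le:
  assumes "dsummable f x" "x \<le> Re s"
  shows "norm (ds f s) \<le> (\<Sum>k. \<bar>f (Suc k)\<bar> * real (Suc k) powr (- x))"
  unfolding ds_def
proof (rule norm_suminf_le)
  show "summable (\<lambda>k. \<bar>f (Suc k)\<bar> * real (Suc k) powr (- x))"
    using assms(1) by (simp add: dsummable_def)
  show "norm (of_real (f (Suc k)) * of_nat (Suc k) powr (- s) :: complex) \<le> \<bar>f (Suc k)\<bar> * real (Suc k) powr (- x)" for k
    unfolding norm_mult norm_of_nat_powr using assms(2)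
    by (intro mult_mono) (auto intro!: powr_mono)
qed

text \<open>The analytic core, detached from lattices. In the application \<gamma> counts weighted
  classes of ideals, r counts the ideals of \<O>, \<psi> counts the sublattices generating a given
  module, \<open>W\<close> is half the number of units and h is the contribution of ambiguous
  classes.\<close>

theorem dirichlet_series_simple_pole:
  fixes a :: "nat \<Rightarrow> nat" and \<gamma> r \<psi> h :: "nat \<Rightarrow> real"
  assumes W: "W > 0"
    and \<gamma>: "\<And>n. \<gamma> n \<ge> 0" "\<gamma> 1 > 0" "\<And>x. x > 1 \<Longrightarrow> dsummable \<gamma> x"
    and r: "\<And>n. r n \<ge> 0" "r 1 = 1" "\<And>x. x > 1 \<Longrightarrow> dsummable r x"
    and \<psi>: "\<And>n. \<psi> n \<ge> 0" "\<And>n. n > 0 \<Longrightarrow> dconv r \<psi> n = real (\<Sum>{d. d dvd n})"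
    and h: "\<And>x. x > 1 \<Longrightarrow> dsummable h x"
    and a: "\<And>n. n > 0 \<Longrightarrow> real (a n) = dconv \<gamma> (\<lambda>f. if f = 1 then 1 else \<psi> f / W) n + h n"
  shows "(\<exists>F. meromorphic_continuation a {s. 1 < Re s} F \<and> simple_pole F 2) \<and> abscissa_of_convergence a = 2"
proof -
  let ?S = "{s. 1 < Re s}"
  let ?A = "ds (\<lambda>n. real (a n))"
  define \<delta> where "\<delta> n = (if n = 1 then 1 else 0 :: real)" for n :: nat
  define \<psi>' where "\<psi>' f = (if f = 1 then 1 else \<psi> f / W)" for f
  have S: "open ?S" "connected ?S" "2 \<in> ?S"
    by (auto intro: open_halfspace_Re_gt convex_connected convex_halfspace_Re_gt)
  have \<sigma>: "real (\<Sum>{d. d dvd n}) = dconv (\<lambda>_. 1) real n" if "n > 0" for n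
  proof -
    have "(\<Sum>d | d dvd n. real d) = (\<Sum>d | d dvd n. real (n div d))"
      by (rule sum.reindex_bij_witness[of _ "\<lambda>d. n div d" "\<lambda>d. n div d"]) (use that in auto)
    then show ?thesis by (simp add: dconv_def)
  qed
  have \<psi>1: "\<psi> 1 = 1" using \<psi>(2)[of 1] r(2) by (simp add: dconv_def)
  \<comment> \<open>The divisor 1 alone contributes \<psi> n to a sum of nonnegative terms, so
    \<psi> is dominated by the sum of divisors and its series converges to the right of 2.\<close>
  have \<psi>_le: "\<psi> n \<le> dconv (\<lambda>_. 1) real n" if "n > 0" for n
  proof -
    have "r 1 * \<psi> (n div 1) \<le> dconv r \<psi> n"
      unfolding dconv_def using that r(1) \<psi>(1) by (intro member_le_sum) auto
    then show ?thesis using r(2) \<sigma>[OF that] \<psi>(2)[OF that] by simp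
  qed
  have s\<sigma>: "dsummable (dconv (\<lambda>_. 1) real) x" if "x > 2" for x
    using that by (intro dsummable_dconv dsummable_one dsummable_of_nat) auto
  have s\<psi>: "dsummable \<psi> x" if "x > 2" for x
  proof (rule dsummable_mono[OF s\<sigma>[OF that]])
    fix n :: nat assume "n > 0"
    from \<psi>_le[OF this] \<psi>(1)[of n] show "\<bar>\<psi> n\<bar> \<le> \<bar>dconv (\<lambda>_. 1) real n\<bar>" by linarith
  qed simp
  \<comment> \<open>Since \<psi> 1 = 1, the exceptional value at 1 is a multiple of the convolution
    unit \<delta>. This is the origin of the constant 1 - 1 / W.\<close>
  have \<psi>'_eq: "\<psi>' = (\<lambda>n. (1 / W) * \<psi> n + (1 - 1 / W) * \<delta> n)"
    using \<psi>1 by (auto simp: \<psi>'_def \<delta>_def fun_eq_iff)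
  have s\<delta>: "dsummable \<delta> x" for x unfolding \<delta>_def by (rule dsummable_delta)
  have s\<psi>': "dsummable \<psi>' x" if "x > 2" for x
    unfolding \<psi>'_eq by (intro dsummable_add dsummable_cmult s\<psi> s\<delta> that)
  have a': "real (a n) = dconv \<gamma> \<psi>' n + h n" if "n > 0" for n
    using a[OF that] unfolding \<psi>'_def .
  have sa: "dsummable (\<lambda>n. real (a n)) x" if "x > 2" for x
  proof -
    have "dsummable (\<lambda>n. dconv \<gamma> \<psi>' n + h n) x"
      using that by (intro dsummable_add dsummable_dconv \<gamma>(3) h s\<psi>') auto
    then show ?thesis
      using dsummable_cong[of "\<lambda>n. real (a n)" "\<lambda>n. dconv \<gamma> \<psi>' n + h n" x] a' by blast
  qed

  have "ds \<delta> s = 1" for s unfolding \<delta>_def by (rule ds_delta)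
  then have ds\<psi>': "ds \<psi>' s = ds \<psi> s / of_real W + (1 - 1 / of_real W)" if "Re s > 2" for s
  proof -
    note summ = s\<psi>[OF that] s\<delta>[of "Re s"]
    have "ds \<psi>' s = of_real (1 / W) * ds \<psi> s + of_real (1 - 1 / W) * ds \<delta> s"
      unfolding \<psi>'_eq by (simp only: ds_add ds_cmult dsummable_cmult summ)
    then show ?thesis using \<open>\<And>s. ds \<delta> s = 1\<close> by simp
  qed
  have dsa: "?A s = ds \<gamma> s * ds \<psi>' s + ds h s" if "Re s > 2" for s
  proof -
    have "?A s = ds (\<lambda>n. dconv \<gamma> \<psi>' n + h n) s" by (rule ds_cong[OF a'])
    also have "\<dots> = ds \<gamma> s * ds \<psi>' s + ds h s"
      using that ds_dconv[of \<gamma> s \<psi>'] by (subst ds_add) (simp_all add: dsummable_dconv \<gamma>(3) h s\<psi>')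
    finally show ?thesis .
  qed
  have R\<psi>: "ds r s * ds \<psi> s = ds (\<lambda>_. 1) s * ds (\<lambda>_. 1) (s - 1)" if "Re s > 2" for s
  proof -
    have "ds r s * ds \<psi> s = ds (dconv r \<psi>) s"
      using that by (intro ds_dconv[symmetric] r s\<psi>) auto
    also have "\<dots> = ds (dconv (\<lambda>_. 1) real) s" by (rule ds_cong) (metis \<psi>(2) \<sigma>)
    also have "\<dots> = ds (\<lambda>_. 1) s * ds real s"
      using that by (intro ds_dconv dsummable_one dsummable_of_nat) auto
    finally show ?thesis by (simp add: ds_of_nat)
  qed

  have hol: "ds \<gamma> holomorphic_on ?S" "ds r holomorphic_on ?S" "ds h holomorphic_on ?S"
    "ds (\<lambda>_. 1) holomorphic_on ?S"
    by (intro ds_holomorphic \<gamma> r h dsummable_one; assumption)+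
  have holZ: "(\<lambda>s. zeta_shifted (s - 1)) holomorphic_on ?S"
    by (rule holomorphic_on_compose_gen[OF _ zeta_shifted_holomorphic, unfolded o_def])
       (auto intro!: holomorphic_intros)
  have R2: "ds r 2 \<noteq> 0" using ds_pos[of r 2] r by simp
  \<comment> \<open>\<open>ds r\<close> is holomorphic on a connected set and nonzero at 2, so its
    zeros are isolated.\<close>
  have Rne: "\<forall>\<^sub>F w in at s. ds r w \<noteq> 0 \<and> w \<in> ?S" if "s \<in> ?S" for s
    using non_zero_neighbour_alt[OF hol(2) S(1,2) that S(3) R2] .

  \<comment> \<open>The series of \<psi> is replaced by zeta(s) zeta(s - 1) divided by
    \<open>ds r\<close>, where \<open>zeta_shifted (s - 1) / (s - 2)\<close> stands for zeta(s -
    1).\<close>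
  define F0 where "F0 s = ds \<gamma> s * (ds (\<lambda>_. 1) s * zeta_shifted (s - 1) / ((s - 2) * of_real W * ds r s)
      + (1 - 1 / of_real W)) + ds h s" for s
  have F0_eq: "F0 s = ?A s" if s: "Re s > 2" "ds r s \<noteq> 0" for s
  proof -
    have "s \<noteq> 2" using s by auto
    have "ds (\<lambda>_. 1) s * zeta_shifted (s - 1) = ds r s * ds \<psi> s * (s - 2)"
      using R\<psi>[OF s(1)] zeta_shifted_eq[of "s - 1"] s by simp
    then have "ds (\<lambda>_. 1) s * zeta_shifted (s - 1) / ((s - 2) * of_real W * ds r s) = ds \<psi> s / of_real W"
      using s \<open>s \<noteq> 2\<close> W by simp
    then show ?thesis unfolding F0_def dsa[OF s(1)] ds\<psi>'[OF s(1)] by simp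
  qed
  have mero0: "F0 meromorphic_on ?S"
  proof -
    have "g meromorphic_on ?S" if "g holomorphic_on ?S" for g
      using that S(1) by (simp add: analytic_on_imp_meromorphic_on analytic_on_open)
    note m = this[OF hol(1)] this[OF hol(2)] this[OF hol(3)] this[OF hol(4)] this[OF holZ]
    show ?thesis unfolding F0_def by (intro meromorphic_intros m)
  qed
  \<comment> \<open>At a zero of \<open>ds r\<close> the value of \<open>F0\<close> comes from
    division by zero. Removing singularities restores agreement with the series at every point with
    Re s > 2.\<close>
  define F where "F = remove_sings F0"
  have merF: "F meromorphic_on ?S" unfolding F_def by (intro remove_sings_meromorphic mero0)

  have A_hol: "?A holomorphic_on {s. 2 < Re s}" by (intro ds_holomorphic sa)
  have F_eq: "F s = ?A s" if s: "Re s > 2" for s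
    unfolding F_def
  proof (rule remove_sings_eqI)
    have "isCont ?A s"
      using holomorphic_on_imp_continuous_on[OF A_hol] s continuous_on_eq_continuous_at[OF open_halfspace_Re_gt]
      by blast
    then have lim: "?A \<midarrow>s\<rightarrow> ?A s" by (rule isContD)
    have "\<forall>\<^sub>F w in at s. w \<in> {s. 2 < Re s}"
      using s by (intro eventually_at_in_open') (auto intro: open_halfspace_Re_gt)
    moreover have "\<forall>\<^sub>F w in at s. ds r w \<noteq> 0 \<and> w \<in> ?S" using s by (intro Rne) simp
    ultimately have "\<forall>\<^sub>F w in at s. ?A w = F0 w"
      by eventually_elim (simp add: F0_eq)
    then show "F0 \<midarrow>s\<rightarrow> ?A s" using lim by (rule Lim_transform_eventually[rotated])
  qed

  \<comment> \<open>\<open>G\<close> is (s - 2) \<open>F0 s\<close> with the factor s - 2 cancelled.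
    It is holomorphic near 2, and at 2 only the product with \<open>zeta_shifted 1\<close> = 1
    survives.\<close>
  define G where "G s = ds \<gamma> s * (ds (\<lambda>_. 1) s * zeta_shifted (s - 1) / (of_real W * ds r s)
      + (1 - 1 / of_real W) * (s - 2)) + ds h s * (s - 2)" for s
  have F0G: "F0 s = G s / (s - 2)" if "s \<noteq> 2" for s
  proof -
    define X where "X = ds (\<lambda>_. 1) s * zeta_shifted (s - 1) / (of_real W * ds r s)"
    have "ds (\<lambda>_. 1) s * zeta_shifted (s - 1) / ((s - 2) * of_real W * ds r s) = X / (s - 2)"
      unfolding X_def by (simp add: mult_ac)
    moreover have "(\<gamma>' * (X + c * (s - 2)) + h' * (s - 2)) / (s - 2) = \<gamma>' * (X / (s - 2) + c) + h'" for \<gamma>' c h'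
      using that by (simp add: field_simps)
    ultimately show ?thesis unfolding F0_def G_def X_def[symmetric] by simp
  qed
  have G2: "G 2 \<noteq> 0"
    using ds_pos[of \<gamma> 2] ds_pos[of "\<lambda>_. 1" 2] \<gamma> R2 W dsummable_one zeta_shifted_1
    unfolding G_def by simp
  obtain e where e: "e > 0" "ball 2 e \<subseteq> ?S" "\<And>w. w \<in> ball 2 e \<Longrightarrow> ds r w \<noteq> 0"
  proof -
    obtain d where "d > 0" "\<And>w. w \<noteq> 2 \<Longrightarrow> dist w 2 < d \<Longrightarrow> ds r w \<noteq> 0 \<and> w \<in> ?S"
      using Rne[OF S(3)] unfolding eventually_at by blast
    then show ?thesis using that[of d] R2 S(3) by (metis dist_commute mem_ball subsetI)
  qed
  let ?U = "ball (2::complex) e"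
  have hU: "ds \<gamma> holomorphic_on ?U" "ds r holomorphic_on ?U" "ds h holomorphic_on ?U"
    "ds (\<lambda>_. 1) holomorphic_on ?U" "(\<lambda>s. zeta_shifted (s - 1)) holomorphic_on ?U"
    using hol holZ e(2) by (auto intro: holomorphic_on_subset)
  have holG: "G holomorphic_on ?U"
    unfolding G_def using e(3) W by (intro holomorphic_intros hU) auto
  have FG: "F w = G w / (w - 2)" if w: "w \<in> ?U" "w \<noteq> 2" for w
  proof -
    have "F0 holomorphic_on ?U - {2}"
    proof (rule holomorphic_transform)
      show "(\<lambda>w. G w / (w - 2)) holomorphic_on ?U - {2}"
        by (intro holomorphic_intros holomorphic_on_subset[OF holG]) auto
    qed (use F0G in auto)
    then have "F0 analytic_on {w}"
      unfolding analytic_at using w by (intro exI[of _ "?U - {2}"]) (simp add: open_delete)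
    then have "F w = F0 w" unfolding F_def by (rule remove_sings_at_analytic)
    then show ?thesis using F0G[OF w(2)] by simp
  qed
  have pole: "is_pole F 2"
  proof -
    have "is_pole (\<lambda>w. G w / (w - 2) ^ 1) 2"
      by (rule is_pole_basic[OF holG]) (use e G2 in auto)
    moreover have "\<forall>\<^sub>F w in at 2. F w = G w / (w - 2) ^ 1"
      unfolding eventually_at using FG e(1) by (auto simp: dist_commute intro!: exI[of _ e])
    ultimately show ?thesis using is_pole_cong[of F "\<lambda>w. G w / (w - 2) ^ 1" 2 2] by simp
  qed
  have "zorder F 2 = -1"
    by (rule zorder_eqI[OF open_ball _ holG G2]) (use e(1) FG in \<open>simp_all add: divide_inverse power_int_minus\<close>)
  with pole have sp: "simple_pole F 2" by (simp add: simple_pole_def)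

  have sumD: "summable (dirichlet_term a (of_real x))" if "x > 2" for x
    using dsummable_imp_summable[of "\<lambda>n. real (a n)" "of_real x"] sa[OF that]
    unfolding dirichlet_term_def by simp
  \<comment> \<open>Convergence left of 2 would give absolute convergence at 2 itself, hence a bound
    \<open>C\<close> for \<open>F\<close> on the real axis right of 2, which the pole
    excludes.\<close>
  have no: "Re s \<ge> 2" if "summable (dirichlet_term a s)" for s
  proof (rule ccontr)
    assume "\<not> Re s \<ge> 2"
    then have s2: "dsummable (\<lambda>n. real (a n)) 2" using dirichlet_convergence_half_plane[OF that] by simp
    define C where "C = (\<Sum>k. \<bar>real (a (Suc k))\<bar> * real (Suc k) powr (- 2))"
    have "\<forall>\<^sub>F w in at 2. norm (F w) \<ge> C + 1"
      using pole unfolding is_pole_def filterlim_at_infinity_conv_norm_at_top filterlim_at_top by blast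
    then obtain d where d: "d > 0" "\<And>w. w \<noteq> 2 \<Longrightarrow> dist w 2 < d \<Longrightarrow> norm (F w) \<ge> C + 1"
      unfolding eventually_at by auto
    let ?w = "of_real (2 + d / 2) :: complex"
    have "dist ?w 2 = d / 2"
      using d(1) by (simp add: dist_norm)
    moreover have "?w \<noteq> 2" using d(1) by (simp add: complex_eq_iff)
    ultimately have "norm (F ?w) \<ge> C + 1" using d by simp
    moreover have "norm (F ?w) \<le> C"
      unfolding C_def using d(1) ds_norm_le[OF s2, of ?w] by (subst F_eq) (simp_all del: of_nat_Suc)
    ultimately show False by simp
  qed
  have abs: "abscissa_of_convergence a = 2"
  proof (rule antisym)
    show "abscissa_of_convergence a \<le> 2"
    proof (rule ereal_le_epsilon2)
      fix e :: real assume "0 < e"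
      then have "abscissa_of_convergence a \<le> ereal (Re (of_real (2 + e)))"
        unfolding abscissa_of_convergence_def using sumD[of "2 + e"] by (intro INF_lower) simp
      then show "abscissa_of_convergence a \<le> 2 + ereal e" by simp
    qed
    show "2 \<le> abscissa_of_convergence a"
      unfolding abscissa_of_convergence_def using no by (intro INF_greatest) simp
  qed
  have "meromorphic_continuation a ?S F"
    unfolding meromorphic_continuation_def abs
    using merF F_eq by (simp add: dirichlet_series_eq_ds)
  with sp abs show ?thesis by blast
qed

section \<open>Modules over the maximal order\<close>

definition full_lattice :: "complex set \<Rightarrow> bool" where
  "full_lattice L \<longleftrightarrow> (\<exists>\<alpha> \<beta>. L = zspan \<alpha> \<beta> \<and> Im (cnj \<alpha> * \<beta>) \<noteq> 0)"

definition subs :: "complex set \<Rightarrow> nat \<Rightarrow> complex set set" where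
  "subs A m = {M. add_subgroup M \<and> M \<subseteq> A \<and> idx A M = m}"

lemma full_lattice_add_subgroup: "full_lattice L \<Longrightarrow> add_subgroup L"
  unfolding full_lattice_def using add_subgroup_zspan by blast

lemma finite_subs: "full_lattice A \<Longrightarrow> m > 0 \<Longrightarrow> finite (subs A m)"
  unfolding full_lattice_def subs_def using finite_add_subgroups_idx by blast

lemma card_subs: "full_lattice A \<Longrightarrow> m > 0 \<Longrightarrow> card (subs A m) = \<Sum>{d. d dvd m}"
  unfolding full_lattice_def subs_def using card_add_subgroups_idx by blast

lemma full_lattice_sub:
  assumes A: "full_lattice A" and M: "M \<in> subs A m" and m: "m > 0"
  shows "full_lattice M"
proof -
  obtain \<alpha> \<beta> where A': "A = zspan \<alpha> \<beta>" "Im (cnj \<alpha> * \<beta>) \<noteq> 0" using A full_lattice_def by blast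
  have "add_subgroup M" "M \<subseteq> zspan \<alpha> \<beta>" "idx (zspan \<alpha> \<beta>) M > 0" "idx (zspan \<alpha> \<beta>) M = m"
    using M m by (simp_all add: subs_def A')
  then obtain \<alpha>' \<beta>' where "M = zspan \<alpha>' \<beta>'" "\<bar>Im (cnj \<alpha>' * \<beta>')\<bar> = m * \<bar>Im (cnj \<alpha> * \<beta>)\<bar>"
    using add_subgroup_basis[OF A'(2)] by metis
  moreover from this have "Im (cnj \<alpha>' * \<beta>') \<noteq> 0" using A'(2) m by auto
  ultimately show ?thesis unfolding full_lattice_def by blast
qed

lemma subs_mult_subset:
  assumes A: "full_lattice A" and M: "M \<in> subs A m" and m: "m > 0" and z: "z \<in> A"
  shows "of_nat m * z \<in> M"
proof -
  obtain \<alpha> \<beta> where A': "A = zspan \<alpha> \<beta>" "Im (cnj \<alpha> * \<beta>) \<noteq> 0" using A full_lattice_def by blast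
  then show ?thesis using idx_mult_subset[OF A'(2), of M z] M m z by (simp add: subs_def)
qed

lemma idx_of_nat_mult:
  assumes A: "full_lattice A" and f: "f > 0"
  shows "idx A ((*) (of_nat f) ` A) = f\<^sup>2"
proof -
  obtain \<alpha> \<beta> where A': "A = zspan \<alpha> \<beta>" "Im (cnj \<alpha> * \<beta>) \<noteq> 0" using A full_lattice_def by blast
  have "(*) (of_nat f) ` A = zspan (of_int (int f) * \<alpha>) (of_int 0 * \<alpha> + of_int (int f) * \<beta>)"
    unfolding A' image_mult_zspan by simp
  then show ?thesis using idx_hnf[OF A'(2), of "int f" "int f" 0] f
    by (simp add: A' nat_mult_distrib power2_eq_square)
qed

lemma idx_mult_image: "add_subgroup M \<Longrightarrow> u \<noteq> 0 \<Longrightarrow> idx ((*) u ` A) ((*) u ` M) = idx A (M :: complex set)"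
  by (rule idx_image) (auto simp: right_diff_distrib inj_on_def)

lemma add_subgroup_mult_image: "add_subgroup M \<Longrightarrow> add_subgroup ((*) u ` (M :: complex set))"
  by (rule add_subgroup_image) (auto simp: right_diff_distrib)

lemma mult_image_image: "(*) u ` (*) v ` M = (*) (u * v) ` (M :: complex set)"
  by (simp add: image_image mult.assoc)

lemma mult_image_cancel:
  "u \<noteq> 0 \<Longrightarrow> (*) u ` M = (*) u ` N \<longleftrightarrow> M = (N :: complex set)"
  by (rule inj_image_eq_iff) (simp add: inj_on_def)

text \<open>For every prime p dividing f, x and y are chosen so that exactly one term of the form
  survives modulo p: the first if p does not divide a, the last if p divides a but not c, and the
  middle one if p divides both, where primitivity makes b a unit modulo p.\<close>

lemma primitive_value_coprime:
  fixes a b c f :: int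
  assumes prim: "\<And>p. prime p \<Longrightarrow> p dvd a \<Longrightarrow> p dvd b \<Longrightarrow> p dvd c \<Longrightarrow> False" and f: "f > 0"
  shows "\<exists>x y. coprime (a * x\<^sup>2 + b * x * y + c * y\<^sup>2) f"
proof -
  define P where "P = {p. prime p \<and> p dvd f}"
  have "finite P" unfolding P_def
    by (rule finite_subset[of _ "{0..f}"]) (use f in \<open>auto simp: prime_ge_0_int zdvd_imp_le\<close>)
  \<comment> \<open>Each prime p of \<open>P\<close> divides x if only the last term is to survive,
    and divides y if only the first is.\<close>
  define x where "x = \<Prod>{p\<in>P. p dvd a \<and> \<not> p dvd c}"
  define y where "y = \<Prod>{p\<in>P. \<not> p dvd a}"
  have dvd_prod: "p dvd \<Prod>Q \<longleftrightarrow> p \<in> Q" if "prime p" "Q \<subseteq> P" for p Q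
  proof -
    have fin: "finite Q" using that \<open>finite P\<close> finite_subset by blast
    have "p dvd \<Prod>Q \<longleftrightarrow> (\<exists>q\<in>Q. p dvd q)" using prime_dvd_prod_iff[OF fin that(1), of "\<lambda>x. x"] by simp
    also have "\<dots> \<longleftrightarrow> p \<in> Q"
    proof
      assume "\<exists>q\<in>Q. p dvd q"
      then obtain q where q: "q \<in> Q" "p dvd q" by blast
      then have "prime q" using that(2) by (auto simp: P_def)
      then show "p \<in> Q" using primes_dvd_imp_eq[OF that(1) _ q(2)] q(1) by simp
    qed (blast intro: dvd_refl)
    finally show ?thesis .
  qed
  have "coprime (a * x\<^sup>2 + b * x * y + c * y\<^sup>2) f"
  proof (rule ccontr)
    assume "\<not> coprime (a * x\<^sup>2 + b * x * y + c * y\<^sup>2) f"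
    then have "\<not> is_unit (gcd (a * x\<^sup>2 + b * x * y + c * y\<^sup>2) f)"
      by (simp add: coprime_iff_gcd_eq_1)
    moreover have "gcd (a * x\<^sup>2 + b * x * y + c * y\<^sup>2) f \<noteq> 0" using f by simp
    ultimately obtain p where p: "prime p" "p dvd gcd (a * x\<^sup>2 + b * x * y + c * y\<^sup>2) f"
      using prime_divisor_exists by blast
    then have v: "p dvd a * x\<^sup>2 + b * x * y + c * y\<^sup>2" and pP: "p \<in> P" by (auto simp: P_def)
    have px: "p dvd x \<longleftrightarrow> p dvd a \<and> \<not> p dvd c" and py: "p dvd y \<longleftrightarrow> \<not> p dvd a"
      unfolding x_def y_def using pP by (subst dvd_prod[OF p(1)]; auto)+
    show False
    proof (cases "p dvd a")
      case True
      then have "p dvd b * x * y + c * y\<^sup>2"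
        using v dvd_add_right_iff[of p "a * x\<^sup>2" "b * x * y + c * y\<^sup>2"] by (simp add: add.assoc)
      moreover have "p dvd c \<longrightarrow> \<not> p dvd b" using prim[OF p(1) True] by blast
      ultimately show False
        using px py True p(1) 
        by (cases "p dvd c")
           (auto simp: prime_dvd_mult_iff power2_eq_square dvd_add_left_iff dvd_add_right_iff)
    next
      case False
      then have "p dvd b * x * y + c * y\<^sup>2" using py by (simp add: power2_eq_square)
      then have "p dvd a * x\<^sup>2"
        using v dvd_add_left_iff[of p "b * x * y + c * y\<^sup>2" "a * x\<^sup>2"] by (simp add: add.assoc)
      then show False using False px p(1) by (simp add: prime_dvd_mult_iff power2_eq_square)
    qed
  qed
  then show ?thesis by blast
qed

text \<open>\<tau> is the root (b + sqrt D) / 2 of X^2 - b X + a c with D = b^2 - 4 a c, and \<A> is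
  the ideal whose norm form is a times a x^2 + b x y + c y^2. The last assumption is maximality: it
  puts every element of \<K> that is a root of a monic integral quadratic into \<O>.\<close>

locale quad_order =
  fixes a b c :: int and \<tau> :: complex and \<K> \<O> \<A> :: "complex set"
  assumes a_pos: "a > 0" and Im_\<tau>: "Im \<tau> > 0"
    and \<tau>_add_cnj: "\<tau> + cnj \<tau> = of_int b" and \<tau>_mult_cnj: "\<tau> * cnj \<tau> = of_int (a * c)"
    and \<K>_eq: "\<K> = {x + y * \<tau> | x y. x \<in> \<rat> \<and> y \<in> \<rat>}"
    and \<O>_eq: "\<O> = zspan 1 \<tau>" and \<A>_eq: "\<A> = zspan (of_int a) \<tau>"
    and maximal: "\<And>z t n. z \<in> \<K> \<Longrightarrow> z * z = of_int t * z - of_int n \<Longrightarrow> z \<in> \<O>"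
begin

lemma \<tau>_square: "\<tau> * \<tau> = of_int b * \<tau> - of_int (a * c)"
proof -
  have "\<tau> * \<tau> = \<tau> * (\<tau> + cnj \<tau>) - \<tau> * cnj \<tau>" by (simp add: algebra_simps)
  then show ?thesis unfolding \<tau>_add_cnj \<tau>_mult_cnj by (simp add: mult.commute)
qed

lemma \<K>I: "x \<in> \<rat> \<Longrightarrow> y \<in> \<rat> \<Longrightarrow> x + y * \<tau> \<in> \<K>"
  unfolding \<K>_eq by blast

lemma \<K>_add: "z \<in> \<K> \<Longrightarrow> w \<in> \<K> \<Longrightarrow> z + w \<in> \<K>"
proof -
  assume "z \<in> \<K>" "w \<in> \<K>"
  then obtain x y x' y' where *: "z = x + y * \<tau>" "w = x' + y' * \<tau>" "x \<in> \<rat>" "y \<in> \<rat>" "x' \<in> \<rat>" "y' \<in> \<rat>"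
    unfolding \<K>_eq by blast
  then have "z + w = (x + x') + (y + y') * \<tau>" by (simp add: algebra_simps)
  then show ?thesis using *(3-6) by (simp only: \<K>I Rats_add)
qed

lemma \<K>_mult: "z \<in> \<K> \<Longrightarrow> w \<in> \<K> \<Longrightarrow> z * w \<in> \<K>"
proof -
  assume "z \<in> \<K>" "w \<in> \<K>"
  then obtain x y x' y' where *: "z = x + y * \<tau>" "w = x' + y' * \<tau>" "x \<in> \<rat>" "y \<in> \<rat>" "x' \<in> \<rat>" "y' \<in> \<rat>"
    unfolding \<K>_eq by blast
  have "z * w = x * x' + (x * y' + y * x') * \<tau> + y * y' * (\<tau> * \<tau>)" by (simp add: * algebra_simps)
  also have "\<dots> = (x * x' - y * y' * of_int (a * c)) + (x * y' + y * x' + y * y' * of_int b) * \<tau>"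
    unfolding \<tau>_square by (simp add: algebra_simps)
  finally show ?thesis using * by (metis \<K>I Rats_add Rats_diff Rats_mult Rats_of_int)
qed

lemma Rats_\<K>: "x \<in> \<rat> \<Longrightarrow> x \<in> \<K>"
  using \<K>I[of x 0] by simp

lemma of_int_\<K>: "of_int k \<in> \<K>"
  by (rule Rats_\<K>) simp

lemma \<tau>_\<K>: "\<tau> \<in> \<K>"
  using \<K>I[of 0 1] by simp

lemma cnj_Rats: "x \<in> \<rat> \<Longrightarrow> cnj x = x"
  by (elim Rats_cases') simp

lemma \<K>_cnj: "z \<in> \<K> \<Longrightarrow> cnj z \<in> \<K>"
proof -
  assume "z \<in> \<K>"
  then obtain x y where *: "z = x + y * \<tau>" "x \<in> \<rat>" "y \<in> \<rat>" unfolding \<K>_eq by blast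
  have "cnj \<tau> = of_int b - \<tau>" using \<tau>_add_cnj by (simp add: algebra_simps)
  then have "cnj z = x + y * (of_int b - \<tau>)" using * by (simp add: cnj_Rats)
  then have "cnj z = (x + y * of_int b) + (- y) * \<tau>" by (simp add: algebra_simps)
  then show ?thesis using * by (metis \<K>I Rats_add Rats_minus_iff Rats_mult Rats_of_int)
qed

lemma \<K>_norm_square: "z \<in> \<K> \<Longrightarrow> z * cnj z \<in> \<rat>" and \<K>_trace: "z \<in> \<K> \<Longrightarrow> z + cnj z \<in> \<rat>"
proof -
  assume "z \<in> \<K>"
  then obtain x y where *: "z = x + y * \<tau>" "x \<in> \<rat>" "y \<in> \<rat>" unfolding \<K>_eq by blast
  then have cnj: "cnj z = x + y * cnj \<tau>" by (simp add: cnj_Rats)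
  have "z * cnj z = x * x + x * y * (\<tau> + cnj \<tau>) + y * y * (\<tau> * cnj \<tau>)"
    and "z + cnj z = x + x + y * (\<tau> + cnj \<tau>)"
    unfolding cnj unfolding *(1) by (simp_all add: algebra_simps)
  then show "z * cnj z \<in> \<rat>" "z + cnj z \<in> \<rat>" using *(2,3) unfolding \<tau>_add_cnj \<tau>_mult_cnj
    by (simp_all only: Rats_add Rats_mult Rats_of_int)
qed

lemma \<K>_inverse: "z \<in> \<K> \<Longrightarrow> inverse z \<in> \<K>"
proof -
  assume z: "z \<in> \<K>"
  have "inverse z = inverse (z * cnj z) * cnj z" by (cases "z = 0") simp_all
  then show ?thesis using z by (metis Rats_\<K> Rats_inverse \<K>_cnj \<K>_mult \<K>_norm_square)
qed

lemma \<K>_divide: "z \<in> \<K> \<Longrightarrow> w \<in> \<K> \<Longrightarrow> z / w \<in> \<K>"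
  by (simp add: divide_inverse \<K>_mult \<K>_inverse)

lemma zspan_subset_\<K>: "\<alpha> \<in> \<K> \<Longrightarrow> \<beta> \<in> \<K> \<Longrightarrow> zspan \<alpha> \<beta> \<subseteq> \<K>"
  unfolding zspan_def by (auto intro!: \<K>_add \<K>_mult of_int_\<K>)

lemma \<O>_subset_\<K>: "\<O> \<subseteq> \<K>" and \<A>_subset_\<K>: "\<A> \<subseteq> \<K>"
  unfolding \<O>_eq \<A>_eq by (intro zspan_subset_\<K> \<tau>_\<K> Rats_\<K>; simp)+

lemma full_lattice_\<O>: "full_lattice \<O>" and full_lattice_\<A>: "full_lattice \<A>"
proof -
  have "Im (cnj 1 * \<tau>) \<noteq> 0" "Im (cnj (of_int a) * \<tau>) \<noteq> 0" using Im_\<tau> a_pos by simp_all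
  then show "full_lattice \<O>" "full_lattice \<A>"
    unfolding full_lattice_def \<O>_eq \<A>_eq by blast+
qed

definition omod :: "complex set \<Rightarrow> bool" where
  "omod J \<longleftrightarrow> add_subgroup J \<and> (\<forall>x\<in>J. \<tau> * x \<in> J)"

lemma omod_add_subgroup: "omod J \<Longrightarrow> add_subgroup J"
  by (simp add: omod_def)

lemma omod_mult: "omod J \<Longrightarrow> z \<in> \<O> \<Longrightarrow> x \<in> J \<Longrightarrow> z * x \<in> J"
proof -
  assume J: "omod J" and "z \<in> \<O>" and x: "x \<in> J"
  then obtain p q where z: "z = of_int p * 1 + of_int q * \<tau>" unfolding \<O>_eq zspan_def by blast
  have "z * x = of_int p * x + of_int q * (\<tau> * x)" unfolding z by (simp add: algebra_simps)
  then show ?thesis using J x unfolding omod_def by (metis add_subgroup_add add_subgroup_int_mult)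
qed

lemma omod_zspan: "\<tau> * \<alpha> \<in> zspan \<alpha> \<beta> \<Longrightarrow> \<tau> * \<beta> \<in> zspan \<alpha> \<beta> \<Longrightarrow> omod (zspan \<alpha> \<beta>)"
  unfolding omod_def
proof (intro conjI ballI)
  assume *: "\<tau> * \<alpha> \<in> zspan \<alpha> \<beta>" "\<tau> * \<beta> \<in> zspan \<alpha> \<beta>"
  fix z assume "z \<in> zspan \<alpha> \<beta>"
  then obtain x y where "z = of_int x * \<alpha> + of_int y * \<beta>" unfolding zspan_def by blast
  then have "\<tau> * z = of_int x * (\<tau> * \<alpha>) + of_int y * (\<tau> * \<beta>)" by (simp add: algebra_simps)
  then show "\<tau> * z \<in> zspan \<alpha> \<beta>" using * add_subgroup_zspan by (metis add_subgroup_add add_subgroup_int_mult)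
qed (rule add_subgroup_zspan)

lemma omod_\<O>: "omod \<O>" and omod_\<A>: "omod \<A>"
proof -
  have "\<tau> * \<tau> = of_int (- (a * c)) * 1 + of_int b * \<tau>" "\<tau> * \<tau> = of_int (- c) * of_int a + of_int b * \<tau>"
    unfolding \<tau>_square by simp_all
  moreover have "\<tau> * of_int a = of_int 0 * of_int a + of_int a * \<tau>" by simp
  ultimately show "omod \<O>" "omod \<A>"
    unfolding \<O>_eq \<A>_eq by (intro omod_zspan; metis zspanI mult.right_neutral in_zspan(2))+
qed

lemma one_\<O>: "1 \<in> \<O>" and \<tau>_\<O>: "\<tau> \<in> \<O>"
  unfolding \<O>_eq by (rule in_zspan)+

lemma \<O>_mult: "z \<in> \<O> \<Longrightarrow> w \<in> \<O> \<Longrightarrow> z * w \<in> \<O>"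
  using omod_mult[OF omod_\<O>] .

definition gen :: "complex set \<Rightarrow> complex set" where
  "gen M = {x + \<tau> * y | x y. x \<in> M \<and> y \<in> M}"

lemma genI: "x \<in> M \<Longrightarrow> y \<in> M \<Longrightarrow> x + \<tau> * y \<in> gen M"
  unfolding gen_def by blast

lemma subset_gen: "add_subgroup M \<Longrightarrow> M \<subseteq> gen M"
  using genI[of _ M 0] add_subgroup_zero[of M] by fastforce

lemma omod_gen:
  assumes M: "add_subgroup M"
  shows "omod (gen M)"
  unfolding omod_def add_subgroup_def
proof (intro conjI ballI)
  show "0 \<in> gen M" using genI[of 0 M 0] add_subgroup_zero[OF M] by simp
  fix z assume "z \<in> gen M"
  then obtain x y where z: "z = x + \<tau> * y" "x \<in> M" "y \<in> M" unfolding gen_def by blast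
  have "\<tau> * z = \<tau> * x + (\<tau> * \<tau>) * y" unfolding z by (simp add: algebra_simps)
  also have "\<dots> = of_int (- (a * c)) * y + \<tau> * (x + of_int b * y)"
    unfolding \<tau>_square by (simp add: algebra_simps)
  also have "\<dots> \<in> gen M" using z M by (intro genI add_subgroup_add add_subgroup_int_mult)
  finally show "\<tau> * z \<in> gen M" .
  fix w assume "w \<in> gen M"
  then obtain x' y' where w: "w = x' + \<tau> * y'" "x' \<in> M" "y' \<in> M" unfolding gen_def by blast
  have "z - w = (x - x') + \<tau> * (y - y')" unfolding z w by (simp add: algebra_simps)
  then show "z - w \<in> gen M" using z w M by (metis genI add_subgroup_diff)
qed

lemma gen_subset: "omod J \<Longrightarrow> M \<subseteq> J \<Longrightarrow> gen M \<subseteq> J"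
  unfolding gen_def omod_def by (auto intro!: add_subgroup_add)

lemma gen_omod: "omod J \<Longrightarrow> gen J = J"
  using gen_subset[of J J] subset_gen[of J] omod_add_subgroup[of J] by blast

lemma gen_mult: "gen ((*) u ` M) = (*) u ` gen M"
proof -
  have *: "u * x + \<tau> * (u * y) = u * (x + \<tau> * y)" for x y by (simp add: algebra_simps)
  show ?thesis unfolding gen_def image_def using * by (auto; metis)
qed

definition ideals :: "complex set \<Rightarrow> nat \<Rightarrow> complex set set" where
  "ideals I e = {J \<in> subs I e. omod J}"

definition over :: "complex set \<Rightarrow> nat \<Rightarrow> complex set set" where
  "over J f = {M \<in> subs J f. gen M = J}"

text \<open>Every \<open>M\<close> lies between its generated module and \<open>I\<close>, so
  \<open>idx_tower\<close> splits m into the index of \<open>gen M\<close> in \<open>I\<close> and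
  that of \<open>M\<close> in \<open>gen M\<close>. All Dirichlet convolutions in the count arise
  from this splitting.\<close>

lemma sum_subs_by_gen:
  fixes F :: "complex set \<Rightarrow> real"
  assumes I: "full_lattice I" "omod I" and m: "m > 0"
  shows "(\<Sum>M\<in>subs I m. F M) = (\<Sum>e | e dvd m. \<Sum>J\<in>ideals I e. \<Sum>M\<in>over J (m div e). F M)"
proof -
  let ?T = "\<Union>e\<in>{e. e dvd m}. ideals I e"
  note sI = full_lattice_add_subgroup[OF I(1)]
  have fin: "finite (ideals I e)" if "e dvd m" for e
    using finite_subs[OF I(1), of e] that m unfolding ideals_def by (auto simp: dvd_pos_nat)
  have gen: "gen M \<in> ideals I (idx I (gen M)) \<and> m = idx I (gen M) * idx (gen M) M" if "M \<in> subs I m" for M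
  proof -
    have M: "add_subgroup M" "M \<subseteq> I" "idx I M = m" using that by (auto simp: subs_def)
    note g = omod_gen[OF M(1)] gen_subset[OF I(2) M(2)] subset_gen[OF M(1)]
    show ?thesis using idx_tower[OF M(1) omod_add_subgroup[OF g(1)] sI g(3,2)] g M
      by (simp add: ideals_def subs_def omod_add_subgroup)
  qed
  have "(\<Sum>M\<in>subs I m. F M) = (\<Sum>J\<in>?T. \<Sum>M | M \<in> subs I m \<and> gen M = J. F M)"
  proof (rule sum.group[symmetric])
    show "finite (subs I m)" using finite_subs I m by blast
    show "finite ?T" using fin m by simp
    show "gen ` subs I m \<subseteq> ?T" 
    proof (rule image_subsetI)
      fix M assume "M \<in> subs I m"
      note g = gen[OF this]
      then have "idx I (gen M) dvd m" by (metis dvd_triv_left)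
      with g show "gen M \<in> ?T" by blast
    qed
  qed
  also have "\<dots> = (\<Sum>e | e dvd m. \<Sum>J\<in>ideals I e. \<Sum>M | M \<in> subs I m \<and> gen M = J. F M)"
    by (rule sum.UNION_disjoint) (use m fin in \<open>auto simp: ideals_def subs_def\<close>)
  also have "\<dots> = (\<Sum>e | e dvd m. \<Sum>J\<in>ideals I e. \<Sum>M\<in>over J (m div e). F M)"
  proof (intro sum.cong refl)
    fix e J assume e: "e \<in> {e. e dvd m}" and J: "J \<in> ideals I e"
    have sJ: "add_subgroup J" "J \<subseteq> I" "idx I J = e" using J by (auto simp: ideals_def subs_def omod_def)
    have e0: "e > 0" using e m by (auto simp: dvd_pos_nat)
    show "{M \<in> subs I m. gen M = J} = over J (m div e)"
    proof (intro set_eqI iffI)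
      fix M assume M: "M \<in> {M \<in> subs I m. gen M = J}"
      then have "m = e * idx J M" using gen[of M] sJ by auto
      then show "M \<in> over J (m div e)" using M e0 subset_gen[of M] by (auto simp: over_def subs_def)
    next
      fix M assume M: "M \<in> over J (m div e)"
      then have s: "add_subgroup M" "M \<subseteq> J" "idx J M = m div e" "gen M = J" by (auto simp: over_def subs_def)
      then have "idx I M = m" using idx_tower[OF s(1) sJ(1) sI s(2) sJ(2)] sJ(3) e by simp
      then show "M \<in> {M \<in> subs I m. gen M = J}" using s sJ by (auto simp: subs_def)
    qed
  qed
  finally show ?thesis .
qed

text \<open>p X^2 - q X + r is a primitive integral polynomial with root z, obtained from trace and
  norm by clearing denominators and dividing by the content.\<close>

lemma \<K>_primitive_polynomial:
  assumes "z \<in> \<K>"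
  obtains p q r :: int where "p \<noteq> 0" "of_int p * (z + cnj z) = of_int q" "of_int p * (z * cnj z) = of_int r"
    "\<forall>l. prime l \<longrightarrow> \<not> (l dvd p \<and> l dvd q \<and> l dvd r)"
proof -
  obtain t1 t2 where t: "z + cnj z = of_int t1 / of_int t2" "t2 \<noteq> (0::int)"
    using \<K>_trace[OF assms] by (elim Rats_cases') auto
  obtain n1 n2 where n: "z * cnj z = of_int n1 / of_int n2" "n2 \<noteq> (0::int)"
    using \<K>_norm_square[OF assms] by (elim Rats_cases') auto
  define P Q R where "P = t2 * n2" and "Q = t1 * n2" and "R = n1 * t2"
  have PQR: "P \<noteq> 0" "of_int P * (z + cnj z) = of_int Q" "of_int P * (z * cnj z) = of_int R"
    using t n by (simp_all add: P_def Q_def R_def)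
  define g where "g = gcd P (gcd Q R)"
  have "gcd Q R dvd Q" "gcd Q R dvd R" by simp_all
  then have g: "g \<noteq> 0" "g dvd P" "g dvd Q" "g dvd R"
    using PQR(1) unfolding g_def by (simp, simp, (meson dvd_trans gcd_dvd2)+)
  then obtain p q r where pqr: "P = g * p" "Q = g * q" "R = g * r" by (elim dvdE)
  show ?thesis
  proof (rule that[of p q r])
    show "p \<noteq> 0" using PQR pqr by auto
    show "of_int p * (z + cnj z) = of_int q" "of_int p * (z * cnj z) = of_int r"
      using PQR(2,3) g(1) by (simp_all add: pqr mult.assoc del: complex_cnj_mult)
    show "\<forall>l. prime l \<longrightarrow> \<not> (l dvd p \<and> l dvd q \<and> l dvd r)"
    proof (intro allI impI notI)
      fix l :: int assume l: "prime l" "l dvd p \<and> l dvd q \<and> l dvd r"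
      then have "g * l dvd P" "g * l dvd Q" "g * l dvd R" unfolding pqr by (simp_all add: mult_dvd_mono)
      then have "g * l dvd g * 1" by (simp add: g_def)
      then have "is_unit l" using g(1) by simp
      then show False using l(1) by (simp add: not_prime_unit)
    qed
  qed
qed

text \<open>Locally at the primes dividing \<open>f\<close> every \<open>\<O>\<close>-module is principal.\<close>

lemma locally_principal:
  assumes J: "full_lattice J" "omod J" "J \<subseteq> \<K>" and f: "f > 0"
  obtains \<alpha> where "\<alpha> \<in> J" "\<And>z. z \<in> J \<Longrightarrow> \<exists>x\<in>\<O>. \<exists>y\<in>J. z = \<alpha> * x + of_nat f * y"
proof -
  obtain j1 j2 where j: "J = zspan j1 j2" "Im (cnj j1 * j2) \<noteq> 0" using J(1) full_lattice_def by blast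
  have j1: "j1 \<noteq> 0" using j by auto
  have jJ: "j1 \<in> J" "j2 \<in> J" unfolding j by (rule in_zspan)+
  define \<gamma> where "\<gamma> = j2 / j1"
  have \<gamma>: "\<gamma> \<in> \<K>" "j2 = j1 * \<gamma>" unfolding \<gamma>_def using J(3) jJ j1 by (auto intro: \<K>_divide)
  obtain p q r :: int where pqr: "p \<noteq> 0" "of_int p * (\<gamma> + cnj \<gamma>) = of_int q" "of_int p * (\<gamma> * cnj \<gamma>) = of_int r"
    "\<forall>l. prime l \<longrightarrow> \<not> (l dvd p \<and> l dvd q \<and> l dvd r)"
    using \<K>_primitive_polynomial[OF \<gamma>(1)] .
  have p\<gamma>cnj: "of_int p * cnj \<gamma> = of_int q - of_int p * \<gamma>" using pqr(2) by (simp add: algebra_simps)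
  \<comment> \<open>p \<gamma> is a root of the monic polynomial X^2 - q X + p r, so maximality of
    the order puts it into \<O>.\<close>
  have p\<gamma>: "of_int p * \<gamma> \<in> \<O>"
  proof (rule maximal)
    show "of_int p * \<gamma> \<in> \<K>" using \<gamma> by (simp add: \<K>_mult Rats_\<K>)
    have "(of_int p * \<gamma>) * (of_int p * \<gamma>) = (of_int p * \<gamma>) * (of_int p * (\<gamma> + cnj \<gamma>)) - of_int p * (of_int p * (\<gamma> * cnj \<gamma>))"
      by (simp add: algebra_simps)
    then show "(of_int p * \<gamma>) * (of_int p * \<gamma>) = of_int q * (of_int p * \<gamma>) - of_int (p * r)"
      unfolding pqr(2,3) by simp
  qed
  obtain x y where cop: "coprime (p * x\<^sup>2 + q * x * y + r * y\<^sup>2) (int f)"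
    using primitive_value_coprime[of p q r "int f"] pqr(4) f by auto
  define v where "v = p * x\<^sup>2 + q * x * y + r * y\<^sup>2"
  define \<alpha> where "\<alpha> = j1 * (of_int x + of_int y * \<gamma>)"
  have \<alpha>J: "\<alpha> \<in> J" unfolding \<alpha>_def j \<gamma>(2) using zspanI[of x j1 y "j1 * \<gamma>"] by (simp add: algebra_simps)
  \<comment> \<open>v is p times the norm of x + y \<gamma>. The cofactor of this norm lies in \<O>,
    hence \<alpha> divides both v j1 and v j2 over \<O>.\<close>
  have v: "of_int v = (of_int x + of_int y * \<gamma>) * (of_int p * of_int x + of_int y * (of_int p * cnj \<gamma>))"
  proof -
    have "(of_int x + of_int y * \<gamma>) * (of_int p * of_int x + of_int y * (of_int p * cnj \<gamma>))
       = of_int p * of_int x * of_int x + of_int x * of_int y * (of_int p * (\<gamma> + cnj \<gamma>)) + of_int y * of_int y * (of_int p * (\<gamma> * cnj \<gamma>))"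
      by (simp add: algebra_simps)
    then show ?thesis unfolding pqr(2,3) v_def by (simp add: power2_eq_square algebra_simps)
  qed
  have int\<O>: "of_int k \<in> \<O>" for k
    using add_subgroup_int_mult[OF omod_add_subgroup[OF omod_\<O>] one_\<O>, of k] by simp
  have vj1: "\<exists>x\<in>\<O>. of_int v * j1 = \<alpha> * x"
  proof
    show "of_int v * j1 = \<alpha> * (of_int p * of_int x + of_int y * (of_int p * cnj \<gamma>))"
      unfolding v \<alpha>_def by (simp add: algebra_simps)
    show "of_int p * of_int x + of_int y * (of_int p * cnj \<gamma>) \<in> \<O>"
      unfolding p\<gamma>cnj by (intro add_subgroup_add add_subgroup_diff \<O>_mult int\<O> p\<gamma> omod_add_subgroup[OF omod_\<O>])
  qed
  have vj2: "\<exists>x\<in>\<O>. of_int v * j2 = \<alpha> * x"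
  proof
    have "of_int v * j2 = \<alpha> * (of_int x * (of_int p * \<gamma>) + of_int y * (of_int p * (\<gamma> * cnj \<gamma>)))"
      unfolding v \<alpha>_def \<gamma>(2) by (simp add: algebra_simps)
    then show "of_int v * j2 = \<alpha> * (of_int x * (of_int p * \<gamma>) + of_int y * of_int r)" unfolding pqr(3) .
    show "of_int x * (of_int p * \<gamma>) + of_int y * of_int r \<in> \<O>"
      by (intro add_subgroup_add \<O>_mult int\<O> p\<gamma> omod_add_subgroup[OF omod_\<O>])
  qed
  obtain x1 x2 where x12: "x1 \<in> \<O>" "x2 \<in> \<O>" "of_int v * j1 = \<alpha> * x1" "of_int v * j2 = \<alpha> * x2"
    using vj1 vj2 by blast
  \<comment> \<open>Since v is coprime to f, an element of \<open>J\<close> is split into a multiple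
    of v, which \<alpha> divides, and a multiple of f.\<close>
  obtain s t where st: "s * v + t * int f = 1"
    using cop unfolding v_def[symmetric] by (metis bezout_int coprime_imp_gcd_eq_1)
  show ?thesis
  proof (rule that[OF \<alpha>J])
    fix z assume z: "z \<in> J"
    then obtain k l where kl: "z = of_int k * j1 + of_int l * j2" unfolding j zspan_def by blast
    have "of_int s * (of_int v * z) = \<alpha> * (of_int s * (of_int k * x1 + of_int l * x2))"
    proof -
      have "of_int s * (of_int v * z) = of_int s * (of_int k * (of_int v * j1) + of_int l * (of_int v * j2))"
        unfolding kl by (simp add: algebra_simps)
      then show ?thesis unfolding x12(3,4) by (simp add: algebra_simps)
    qed
    moreover have "z = of_int (s * v + t * int f) * z" unfolding st by simp
    then have "z = of_int s * (of_int v * z) + of_nat f * (of_int t * z)" by (simp add: algebra_simps)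
    ultimately have "z = \<alpha> * (of_int s * (of_int k * x1 + of_int l * x2)) + of_nat f * (of_int t * z)" by metis
    moreover have "of_int s * (of_int k * x1 + of_int l * x2) \<in> \<O>"
      using x12 by (intro add_subgroup_add \<O>_mult int\<O> omod_add_subgroup[OF omod_\<O>])
    moreover have "of_int t * z \<in> J" using z J(2) by (simp add: omod_add_subgroup add_subgroup_int_mult)
    ultimately show "\<exists>x\<in>\<O>. \<exists>y\<in>J. z = \<alpha> * x + of_nat f * y" by blast
  qed
qed

end

context quad_order
begin

text \<open>Every sublattice of index f contains f times the module, so only the quotients modulo f
  matter. Multiplication by a local generator \<alpha> identifies these quotients of \<O> and
  \<open>J\<close>: \<theta> is pulling back along it, with inverse sending \<open>M\<close> to
  \<alpha> \<open>M\<close> + f \<open>J\<close>.\<close>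

lemma card_over:
  assumes J: "full_lattice J" "omod J" "J \<subseteq> \<K>" and f: "f > 0"
  shows "card (over J f) = card (over \<O> f)"
proof -
  obtain \<alpha> where \<alpha>: "\<alpha> \<in> J" "\<And>z. z \<in> J \<Longrightarrow> \<exists>x\<in>\<O>. \<exists>y\<in>J. z = \<alpha> * x + of_nat f * y"
    using locally_principal[OF J f] by metis
  define \<theta> where "\<theta> N = {x \<in> \<O>. \<alpha> * x \<in> N}" for N
  note sJ = omod_add_subgroup[OF J(2)] and sO = omod_add_subgroup[OF omod_\<O>]
  have \<alpha>x: "\<alpha> * x \<in> J" if "x \<in> \<O>" for x
    using omod_mult[OF J(2) that \<alpha>(1)] by (simp add: mult.commute)
  have s\<theta>: "add_subgroup (\<theta> N)" if "add_subgroup N" for N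
    using that sO unfolding \<theta>_def add_subgroup_def by (auto simp: right_diff_distrib)
  have idx\<theta>: "idx \<O> (\<theta> N) = idx J N" if N: "add_subgroup N" "\<And>y. y \<in> J \<Longrightarrow> of_nat f * y \<in> N" for N
  proof (rule idx_cong_hom[OF N(1) s\<theta>[OF N(1)], where f = "(*) \<alpha>"])
    show "\<exists>x\<in>\<O>. z - \<alpha> * x \<in> N" if "z \<in> J" for z
    proof -
      obtain x y where "x \<in> \<O>" "y \<in> J" "z = \<alpha> * x + of_nat f * y" using \<alpha>(2)[OF \<open>z \<in> J\<close>] by blast
      then show ?thesis using N(2)[of y] by (intro bexI[of _ x]) simp_all
    qed
    show "x - y \<in> \<theta> N \<longleftrightarrow> \<alpha> * (x - y) \<in> N" if "x \<in> \<O>" "y \<in> \<O>" for x y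
      using add_subgroup_diff[OF sO that] by (simp add: \<theta>_def)
  qed (use \<alpha>x in \<open>auto simp: right_diff_distrib\<close>)
  have gen_\<O>: "gen M = \<O>" if "add_subgroup M" "M \<subseteq> \<O>" "1 \<in> gen M" for M
  proof
    show "gen M \<subseteq> \<O>" using gen_subset[OF omod_\<O>] that by blast
    show "\<O> \<subseteq> gen M" using omod_mult[OF omod_gen[OF that(1)] _ that(3)] by auto
  qed
  have sub: "of_nat f * y \<in> N" if "N \<in> over J f" "y \<in> J" for N y
    using subs_mult_subset[OF J(1) _ f that(2)] that(1) by (simp add: over_def)
  have "inj_on \<theta> (over J f)"
  proof (rule inj_onI)
    have *: "N1 \<subseteq> N2" if N: "N1 \<in> over J f" "N2 \<in> over J f" and eq: "\<theta> N1 = \<theta> N2" for N1 N2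
    proof
      fix n assume n: "n \<in> N1"
      have s: "add_subgroup N1" "add_subgroup N2" "N1 \<subseteq> J" using N by (auto simp: over_def subs_def)
      then obtain x y where xy: "x \<in> \<O>" "y \<in> J" "n = \<alpha> * x + of_nat f * y" using \<alpha>(2) n by blast
      then have "\<alpha> * x = n - of_nat f * y" by simp
      then have "\<alpha> * x \<in> N1" using n sub[OF N(1) xy(2)] s(1) by (simp add: add_subgroup_diff)
      then have "x \<in> \<theta> N2" using eq xy(1) by (auto simp: \<theta>_def)
      then show "n \<in> N2" using xy sub[OF N(2) xy(2)] s(2) by (simp add: \<theta>_def add_subgroup_add)
    qed
    fix N1 N2 assume "N1 \<in> over J f" "N2 \<in> over J f" "\<theta> N1 = \<theta> N2"
    then show "N1 = N2" using *[of N1 N2] *[of N2 N1] by auto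
  qed
  moreover have "\<theta> ` over J f = over \<O> f"
  proof (intro subset_antisym subsetI)
    fix M assume "M \<in> \<theta> ` over J f"
    then obtain N where N: "N \<in> over J f" "M = \<theta> N" by blast
    have s: "add_subgroup N" "N \<subseteq> J" "idx J N = f" "gen N = J" using N by (auto simp: over_def subs_def)
    have M: "add_subgroup M" "M \<subseteq> \<O>" "idx \<O> M = f"
      using s\<theta>[OF s(1)] idx\<theta>[OF s(1) sub[OF N(1)]] s(3) by (auto simp: N(2) \<theta>_def)
    obtain n1 n2 where n: "n1 \<in> N" "n2 \<in> N" "\<alpha> = n1 + \<tau> * n2" using \<alpha>(1) s(4) unfolding gen_def by blast
    obtain x1 y1 where 1: "x1 \<in> \<O>" "y1 \<in> J" "n1 = \<alpha> * x1 + of_nat f * y1" using \<alpha>(2) n s by blast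
    obtain x2 y2 where 2: "x2 \<in> \<O>" "y2 \<in> J" "n2 = \<alpha> * x2 + of_nat f * y2" using \<alpha>(2) n s by blast
    have "\<alpha> * x1 = n1 - of_nat f * y1" "\<alpha> * x2 = n2 - of_nat f * y2" using 1 2 by simp_all
    then have "\<alpha> * x1 \<in> N" "\<alpha> * x2 \<in> N"
      using add_subgroup_diff[OF s(1) n(1) sub[OF N(1) 1(2)]] add_subgroup_diff[OF s(1) n(2) sub[OF N(1) 2(2)]] by metis+
    then have xM: "x1 \<in> M" "x2 \<in> M" using 1(1) 2(1) by (simp_all add: N(2) \<theta>_def)
    \<comment> \<open>w is the defect in writing 1 as an element of \<open>gen M\<close>. Since
      \<alpha> w lies in f \<open>J\<close> and thus in \<open>N\<close>, the defect lies in
      \<open>M\<close> and can be absorbed.\<close>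
    define w where "w = 1 - x1 - \<tau> * x2"
    have "\<alpha> * w = \<alpha> - \<alpha> * x1 - \<tau> * (\<alpha> * x2)" by (simp add: w_def algebra_simps)
    also have "\<dots> = (n1 - \<alpha> * x1) + \<tau> * (n2 - \<alpha> * x2)" unfolding n(3) by (simp add: algebra_simps)
    also have "\<dots> = of_nat f * (y1 + \<tau> * y2)" unfolding 1(3) 2(3) by (simp add: algebra_simps)
    finally have "\<alpha> * w = of_nat f * (y1 + \<tau> * y2)" .
    moreover have "y1 + \<tau> * y2 \<in> J" using 1(2) 2(2) J(2) by (simp add: omod_def add_subgroup_add)
    ultimately have "\<alpha> * w \<in> N" using sub[OF N(1)] by metis
    moreover have "w \<in> \<O>" unfolding w_def using 1(1) 2(1) sO \<tau>_\<O> by (intro add_subgroup_diff one_\<O> \<O>_mult)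
    ultimately have "w \<in> M" by (simp add: N(2) \<theta>_def)
    then have "w + x1 + \<tau> * x2 \<in> gen M" using xM M(1) by (intro genI add_subgroup_add)
    then have "1 \<in> gen M" by (simp add: w_def)
    then show "M \<in> over \<O> f" using M gen_\<O> by (simp add: over_def subs_def)
  next
    fix M assume "M \<in> over \<O> f"
    then have M: "add_subgroup M" "M \<subseteq> \<O>" "idx \<O> M = f" "gen M = \<O>" "M \<in> subs \<O> f"
      by (auto simp: over_def subs_def)
    have fM: "of_nat f * x \<in> M" if "x \<in> \<O>" for x
      using subs_mult_subset[OF full_lattice_\<O> M(5) f that] .
    define N where "N = {\<alpha> * x + of_nat f * y | x y. x \<in> M \<and> y \<in> J}"
    have NI: "\<alpha> * x + of_nat f * y \<in> N" if "x \<in> M" "y \<in> J" for x y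
      using that unfolding N_def by blast
    have sN: "add_subgroup N" unfolding add_subgroup_def
    proof (intro conjI ballI)
      show "0 \<in> N" using NI[of 0 0] add_subgroup_zero[OF M(1)] add_subgroup_zero[OF sJ] by simp
      fix z w assume "z \<in> N" "w \<in> N"
      then obtain x y x' y' where *: "z = \<alpha> * x + of_nat f * y" "w = \<alpha> * x' + of_nat f * y'"
        "x \<in> M" "y \<in> J" "x' \<in> M" "y' \<in> J" unfolding N_def by blast
      have "z - w = \<alpha> * (x - x') + of_nat f * (y - y')" unfolding * by (simp add: algebra_simps)
      then show "z - w \<in> N" using * NI M(1) sJ by (metis add_subgroup_diff)
    qed
    have fN: "of_nat f * y \<in> N" if "y \<in> J" for y
      using NI[of 0 y] that add_subgroup_zero[OF M(1)] by simp
    have NJ: "N \<subseteq> J"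
      unfolding N_def using M(2) \<alpha>x sJ add_subgroup_int_mult[OF sJ, of _ "int f"] by (auto intro!: add_subgroup_add)
    let ?fJ = "(*) (of_nat f) ` J" and ?fO = "(*) (of_nat f) ` \<O>"
    \<comment> \<open>Injectivity of multiplication by \<alpha> modulo f. One inclusion is clear,
      and both sides have index f^2 in \<O>, so they coincide.\<close>
    have "\<theta> ?fJ = ?fO"
    proof -
      have sfJ: "add_subgroup ?fJ" and sfO: "add_subgroup ?fO" using sJ sO by (auto intro: add_subgroup_mult_image)
      have 1: "?fO \<subseteq> \<theta> ?fJ"
      proof
        fix z assume "z \<in> ?fO"
        then obtain x where x: "x \<in> \<O>" "z = of_nat f * x" by blast
        then have "\<alpha> * z = of_nat f * (\<alpha> * x)" by simp
        then show "z \<in> \<theta> ?fJ"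
          using x \<alpha>x[OF x(1)] add_subgroup_int_mult[OF sO x(1), of "int f"] by (auto simp: \<theta>_def)
      qed
      have "idx \<O> (\<theta> ?fJ) = f\<^sup>2" using idx\<theta>[OF sfJ] idx_of_nat_mult[OF J(1) f] by auto
      moreover have "idx \<O> ?fO = f\<^sup>2" using idx_of_nat_mult[OF full_lattice_\<O> f] .
      ultimately have "idx (\<theta> ?fJ) ?fO = 1"
        using idx_tower[OF sfO s\<theta>[OF sfJ] sO 1] f by (auto simp: \<theta>_def)
      then show ?thesis using idx_eq_1D[OF sfO s\<theta>[OF sfJ] 1] by simp
    qed
    then have ker: "x \<in> ?fO" if "x \<in> \<O>" "\<alpha> * x \<in> ?fJ" for x using that by (auto simp: \<theta>_def)
    have \<theta>N: "\<theta> N = M"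
    proof (intro subset_antisym subsetI)
      fix x assume "x \<in> M"
      then show "x \<in> \<theta> N" using NI[of x 0] M(2) add_subgroup_zero[OF sJ] by (auto simp: \<theta>_def)
    next
      fix x assume "x \<in> \<theta> N"
      then obtain m y where *: "x \<in> \<O>" "\<alpha> * x = \<alpha> * m + of_nat f * y" "m \<in> M" "y \<in> J"
        unfolding \<theta>_def N_def by blast
      then have "\<alpha> * (x - m) \<in> ?fJ" by (auto simp: algebra_simps)
      moreover have "x - m \<in> \<O>" using * M(2) sO by (auto intro: add_subgroup_diff)
      ultimately have "x - m \<in> M" using ker[of "x - m"] fM by auto
      then show "x \<in> M" using add_subgroup_add[OF M(1) _ *(3), of "x - m"] by simp
    qed
    have "gen N = J"
    proof
      show "gen N \<subseteq> J" using gen_subset[OF J(2) NJ] .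
      note oN = omod_gen[OF sN]
      have "\<alpha> * x \<in> gen N" if "x \<in> \<O>" for x
      proof -
        obtain x1 x2 where x: "x1 \<in> M" "x2 \<in> M" "x = x1 + \<tau> * x2"
          using \<open>x \<in> \<O>\<close> M(4) unfolding gen_def by blast
        have "\<alpha> * x1 \<in> N" "\<alpha> * x2 \<in> N" using NI[of x1 0] NI[of x2 0] x add_subgroup_zero[OF sJ] by auto
        then have "\<alpha> * x1 + \<tau> * (\<alpha> * x2) \<in> gen N" by (rule genI)
        then show ?thesis unfolding x(3) by (simp add: algebra_simps)
      qed
      moreover have "of_nat f * y \<in> gen N" if "y \<in> J" for y using fN[OF that] subset_gen[OF sN] by blast
      ultimately show "J \<subseteq> gen N" using \<alpha>(2) omod_add_subgroup[OF oN] by (metis add_subgroup_add subsetI)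
    qed
    moreover have "idx J N = f" using idx\<theta>[OF sN fN] \<theta>N M(3) by simp
    ultimately have "N \<in> over J f" using sN NJ by (simp add: over_def subs_def)
    then show "M \<in> \<theta> ` over J f" using \<theta>N by blast
  qed
  ultimately show ?thesis by (metis card_image)
qed

section \<open>Units, rotations and the size of the discriminant\<close>

definition \<U> :: "complex set" where
  "\<U> = {u \<in> \<O>. norm u = 1}"

definition rot :: "complex set" where
  "rot = {u \<in> \<K>. norm u = 1}"

lemma rot_nz: "u \<in> rot \<Longrightarrow> u \<noteq> 0"
  by (auto simp: rot_def)

lemma rot_1: "1 \<in> rot"
  using of_int_\<K>[of 1] by (auto simp: rot_def)

lemma rot_mult: "u \<in> rot \<Longrightarrow> v \<in> rot \<Longrightarrow> u * v \<in> rot"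
  by (simp add: rot_def \<K>_mult norm_mult)

lemma rot_divide: "u \<in> rot \<Longrightarrow> v \<in> rot \<Longrightarrow> u / v \<in> rot"
  by (simp add: rot_def \<K>_divide norm_divide)

lemma rot_inverse: "u \<in> rot \<Longrightarrow> inverse u \<in> rot"
  using rot_divide[OF rot_1] by (simp add: divide_inverse)

lemma rot_cnj: "u \<in> rot \<Longrightarrow> cnj u \<in> rot"
  by (simp add: rot_def \<K>_cnj)

lemma \<U>_subset_rot: "\<U> \<subseteq> rot"
  using \<O>_subset_\<K> by (auto simp: \<U>_def rot_def)

lemma \<U>_mult: "u \<in> \<U> \<Longrightarrow> v \<in> \<U> \<Longrightarrow> u * v \<in> \<U>"
  by (simp add: \<U>_def \<O>_mult norm_mult)

lemma \<U>_1: "1 \<in> \<U>" and \<U>_minus_1: "-1 \<in> \<U>"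
  using one_\<O> add_subgroup_minus[OF omod_add_subgroup[OF omod_\<O>] one_\<O>] by (auto simp: \<U>_def)

text \<open>In a basis of \<open>J\<close>, multiplication by z is an integer matrix, so z is a root
  of its characteristic polynomial, which is monic and integral; maximality finishes.\<close>

lemma int_root_in_\<O>:
  assumes J: "full_lattice J" and z: "z \<in> \<K>" and zJ: "(*) z ` J \<subseteq> J"
  shows "z \<in> \<O>"
proof -
  obtain j1 j2 where j: "J = zspan j1 j2" "Im (cnj j1 * j2) \<noteq> 0" using J full_lattice_def by blast
  have "z * j1 \<in> zspan j1 j2" "z * j2 \<in> zspan j1 j2" using zJ in_zspan unfolding j(1) by blast+
  then obtain p q r t where *: "z * j1 = of_int p * j1 + of_int q * j2" "z * j2 = of_int r * j1 + of_int t * j2"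
    unfolding zspan_def by blast
  have j1: "j1 \<noteq> 0" using j by auto
  have "z * (z * j1) = z * (of_int p * j1 + of_int q * j2)" using *(1) by simp
  also have "\<dots> = of_int p * (z * j1) + of_int q * (z * j2)" by (simp add: algebra_simps)
  also have "\<dots> = of_int p * (z * j1) + of_int q * (of_int r * j1) + of_int t * (of_int q * j2)"
    unfolding *(2) by (simp add: algebra_simps)
  also have "of_int q * j2 = z * j1 - of_int p * j1" using *(1) by simp
  finally have "(z * z) * j1 = (of_int (p + t) * z - of_int (p * t - q * r)) * j1"
    by (simp add: algebra_simps)
  then have "z * z = of_int (p + t) * z - of_int (p * t - q * r)" using j1 by simp
  then show ?thesis using maximal[OF z] by blast
qed

lemma stabilizer_\<U>:
  assumes "full_lattice J" "u \<in> rot" "(*) u ` J = J"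
  shows "u \<in> \<U>"
  using int_root_in_\<O>[OF assms(1), of u] assms(2,3) by (auto simp: rot_def \<U>_def)

lemma \<U>_inverse: "u \<in> \<U> \<Longrightarrow> inverse u \<in> \<U>"
proof -
  assume u: "u \<in> \<U>"
  then have u0: "u \<noteq> 0" by (auto simp: \<U>_def)
  obtain x y where xy: "u = of_int x * 1 + of_int y * \<tau>" 
  proof -
    have "u \<in> zspan 1 \<tau>" using u by (simp add: \<U>_def \<O>_eq[symmetric])
    then show ?thesis using that unfolding zspan_def by blast
  qed
  have "u * cnj u = 1" using u by (simp add: \<U>_def complex_norm_square[symmetric])
  then have "inverse u = cnj u" using u0 by (simp add: field_simps)
  also have "\<dots> = of_int x + of_int y * cnj \<tau>" by (simp add: xy)
  also have "cnj \<tau> = of_int b - \<tau>" using \<tau>_add_cnj by (simp add: eq_diff_eq add.commute)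
  also have "of_int x + of_int y * (of_int b - \<tau>) = of_int (x + y * b) * 1 + of_int (- y) * \<tau>"
    by (simp add: algebra_simps)
  finally have "inverse u \<in> \<O>" unfolding \<O>_eq by (simp only: zspanI)
  then show ?thesis using u by (simp add: \<U>_def norm_inverse)
qed

lemma \<U>_fixes:
  assumes J: "omod J" and u: "u \<in> \<U>"
  shows "(*) u ` J = J"
proof -
  have *: "(*) v ` J \<subseteq> J" if "v \<in> \<U>" for v
    using omod_mult[OF J] that by (auto simp: \<U>_def)
  have "(*) u ` (*) (inverse u) ` J \<subseteq> (*) u ` J" using *[OF \<U>_inverse[OF u]] by blast
  moreover have "u \<noteq> 0" using u by (auto simp: \<U>_def)
  ultimately have "J \<subseteq> (*) u ` J" by (simp add: mult_image_image)
  with *[OF u] show ?thesis by blast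
qed

text \<open>4 a c - b^2 is congruent to 0 or 3 modulo 4, so being positive it is at least 3.\<close>

lemma discriminant_int: "(2 * Im \<tau>)\<^sup>2 = of_int (4 * a * c - b\<^sup>2)" and discriminant_ge_3: "4 * a * c - b\<^sup>2 \<ge> 3"
proof -
  have 2: "2 * Re \<tau> = of_int b" using \<tau>_add_cnj by (auto simp: complex_eq_iff)
  have 3: "(Re \<tau>)\<^sup>2 + (Im \<tau>)\<^sup>2 = of_int (a * c)"
    using \<tau>_mult_cnj by (simp add: complex_eq_iff power2_eq_square)
  have "(2 * Im \<tau>)\<^sup>2 = 4 * ((Re \<tau>)\<^sup>2 + (Im \<tau>)\<^sup>2) - (2 * Re \<tau>)\<^sup>2"
    by (simp add: power2_eq_square algebra_simps)
  then show 1: "(2 * Im \<tau>)\<^sup>2 = of_int (4 * a * c - b\<^sup>2)"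
    unfolding 2 3 by simp
  have "real_of_int (4 * a * c - b\<^sup>2) > 0" unfolding 1[symmetric] using Im_\<tau> by simp
  then have pos: "4 * a * c - b\<^sup>2 > 0" by linarith
  have "(4 * a * c - b\<^sup>2) mod 4 = (- (b\<^sup>2) + 4 * (a * c)) mod 4" by (simp add: algebra_simps)
  also have "\<dots> = (- (b\<^sup>2)) mod 4" by (rule mod_mult_self2)
  finally have "(4 * a * c - b\<^sup>2) mod 4 = (- (b\<^sup>2)) mod 4" .
  moreover have "(- (b\<^sup>2)) mod 4 \<in> {0, 3}"
  proof (cases "even b")
    case True
    then obtain k where "b = 2 * k" by blast
    then have "- (b\<^sup>2) = 4 * (- k\<^sup>2)" by (simp add: power2_eq_square)
    then show ?thesis by (metis insertI1 mod_mult_self1_is_0)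
  next
    case False
    then obtain k where "b = 2 * k + 1" by (elim oddE)
    then have "- (b\<^sup>2) = 3 + 4 * (- k\<^sup>2 - k - 1)" by (simp add: power2_eq_square algebra_simps)
    then show ?thesis by (simp only: mod_mult_self2) simp
  qed
  ultimately have "(4 * a * c - b\<^sup>2) mod 4 = 0 \<or> (4 * a * c - b\<^sup>2) mod 4 = 3" by auto
  moreover have "n \<ge> 3" if "n mod 4 = 0 \<or> n mod 4 = 3" "n > 0" for n :: int
    using that by presburger
  ultimately show "4 * a * c - b\<^sup>2 \<ge> 3" using pos by metis
qed

text \<open>Half the square root of 3 exceeds 3/4. The rational bound is enough to keep the
  \<tau>-coordinate of a unit below 2 in absolute value, since 2 times 3/4 exceeds 1.\<close>

lemma Im_\<tau>_bound: "Im \<tau> > 1 / 2 * (3 / 2)"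
proof (rule ccontr)
  assume "\<not> ?thesis"
  then have "2 * Im \<tau> \<le> 3 / 2" by simp
  then have "(2 * Im \<tau>)\<^sup>2 \<le> (3 / 2)\<^sup>2" using Im_\<tau> by (intro power_mono) auto
  moreover have "(2 * Im \<tau>)\<^sup>2 \<ge> 3" unfolding discriminant_int using discriminant_ge_3 by linarith
  ultimately show False by (simp add: power2_eq_square)
qed

end

section \<open>Class sizes\<close>

text \<open>Turns the number of classes into a sum over sublattices, where the grouping by generated
  modules is available.\<close>

lemma card_quotient_weight:
  fixes w :: "'a \<Rightarrow> real"
  assumes R: "equiv X R" and fin: "finite X" and w: "\<And>x. x \<in> X \<Longrightarrow> (\<Sum>y\<in>R `` {x}. w y) = 1"
  shows "real (card (X // R)) = (\<Sum>x\<in>X. w x)"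
proof -
  have "(\<Sum>x\<in>X. w x) = sum w (\<Union>(X // R))" using Union_quotient[OF R] by simp
  also have "\<dots> = (\<Sum>C\<in>X // R. \<Sum>x\<in>C. w x)"
  proof (subst sum.Union_disjoint)
    show "\<forall>A\<in>X // R. finite A" using fin finite_equiv_class[OF fin equiv_type[OF R]] by blast
    show "\<forall>A\<in>X // R. \<forall>B\<in>X // R. A \<noteq> B \<longrightarrow> A \<inter> B = {}" using quotient_disj[OF R] by blast
  qed simp
  also have "\<dots> = (\<Sum>C\<in>X // R. 1)"
    by (rule sum.cong) (auto simp: quotient_def w)
  finally show ?thesis by simp
qed

context quad_order
begin

definition cls :: "complex set \<Rightarrow> nat \<Rightarrow> complex set \<Rightarrow> complex set set" where
  "cls A m M = {N \<in> subs A m. \<exists>u\<in>rot. (*) u ` M = N}"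

text \<open>A unit has real and imaginary part at most 1 in absolute value. Besides finiteness, the
  point is that a unit other than 1 and -1 has \<tau>-coefficient 1 or -1.\<close>

lemma norm_unit_coords:
  assumes "u \<in> \<U>"
  obtains x y :: int where "u = of_int x + of_int y * \<tau>" "\<bar>y\<bar> \<le> 1" "\<bar>x\<bar> \<le> 1 + \<bar>b\<bar>" "y = 0 \<Longrightarrow> u = 1 \<or> u = -1"
proof -
  have u: "u \<in> zspan 1 \<tau>" "norm u = 1" using assms by (simp_all add: \<U>_def flip: \<O>_eq)
  then obtain x y where xy: "u = of_int x + of_int y * \<tau>" unfolding zspan_def by auto
  have "\<bar>Im u\<bar> \<le> 1" "\<bar>Re u\<bar> \<le> 1" using abs_Im_le_cmod[of u] abs_Re_le_cmod[of u] u by auto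
  then have I: "\<bar>of_int y * Im \<tau>\<bar> \<le> 1" and R: "\<bar>of_int x + of_int y * Re \<tau>\<bar> \<le> 1" by (simp_all add: xy)
  have y: "\<bar>y\<bar> \<le> 1"
  proof (rule ccontr)
    assume "\<not> \<bar>y\<bar> \<le> 1"
    then have "\<bar>real_of_int y\<bar> \<ge> 2" by linarith
    then have "\<bar>real_of_int y\<bar> * Im \<tau> \<ge> 2 * (3 / 4)" using Im_\<tau>_bound by (intro mult_mono) auto
    then show False using I Im_\<tau> by (simp add: abs_mult)
  qed
  have re: "2 * Re \<tau> = of_int b" using \<tau>_add_cnj by (auto simp: complex_eq_iff)
  have "\<bar>real_of_int x\<bar> \<le> 1 + \<bar>of_int y * Re \<tau>\<bar>" using R by linarith
  also have "\<bar>of_int y * Re \<tau>\<bar> \<le> 1 * \<bar>of_int b\<bar>"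
    unfolding abs_mult using y re by (intro mult_mono) (auto simp: abs_le_iff)
  finally have x: "\<bar>x\<bar> \<le> 1 + \<bar>b\<bar>" by linarith
  have "u = 1 \<or> u = -1" if "y = 0"
  proof -
    have "norm (complex_of_int x) = 1" using u(2) that by (simp add: xy)
    then have "\<bar>real_of_int x\<bar> = 1" by simp
    then have "x = 1 \<or> x = -1" by linarith
    then show ?thesis using that by (auto simp: xy)
  qed
  then show ?thesis using that xy y x by blast
qed

lemma finite_\<U>: "finite \<U>"
proof (rule finite_subset)
  show "\<U> \<subseteq> (\<lambda>(x, y). of_int x + of_int y * \<tau>) ` ({- 1 - \<bar>b\<bar>..1 + \<bar>b\<bar>} \<times> {-1..1})"
  proof
    fix u assume "u \<in> \<U>"
    then obtain x y :: int where "u = of_int x + of_int y * \<tau>" "\<bar>y\<bar> \<le> 1" "\<bar>x\<bar> \<le> 1 + \<bar>b\<bar>"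
      by (rule norm_unit_coords)
    then show "u \<in> (\<lambda>(x, y). of_int x + of_int y * \<tau>) ` ({- 1 - \<bar>b\<bar>..1 + \<bar>b\<bar>} \<times> {-1..1})"
      by (intro image_eqI[of _ _ "(x, y)"]) auto
  qed
qed auto

text \<open>A unit other than \<open>\<plusminus>1\<close> generates \<open>\<O>\<close> as a ring.\<close>

lemma unit_stable_imp_omod:
  assumes M: "add_subgroup M" and u: "u \<in> \<U>" "u \<noteq> 1" "u \<noteq> -1" and uM: "(*) u ` M = M"
  shows "omod M"
proof -
  obtain x y :: int where xy: "u = of_int x + of_int y * \<tau>" "\<bar>y\<bar> \<le> 1" "y \<noteq> 0"
    using norm_unit_coords[OF u(1)] u(2,3) by metis
  then have "y = 1 \<or> y = -1" by linarith
  then have y2: "y * y = 1" by auto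
  have "\<tau> * m \<in> M" if "m \<in> M" for m
  proof -
    have "\<tau> * m = of_int (y * y) * (\<tau> * m)" unfolding y2 by simp
    also have "\<dots> = of_int y * (u * m - of_int x * m)" by (simp add: xy(1) algebra_simps)
    also have "\<dots> \<in> M" using that uM M by (intro add_subgroup_int_mult add_subgroup_diff) auto
    finally show ?thesis .
  qed
  then show ?thesis using M by (simp add: omod_def)
qed

lemma mult_minus_image: "add_subgroup M \<Longrightarrow> (*) (- u) ` M = (*) u ` (M :: complex set)"
proof -
  assume M: "add_subgroup M"
  have *: "(*) (- v) ` M \<subseteq> (*) v ` M" for v
    using add_subgroup_minus[OF M] by (auto simp: image_iff) (metis minus_mult_minus mult_minus_right)
  show ?thesis using *[of u] *[of "- u"] by simp
qed

text \<open>A unit stabilising \<open>M\<close> is 1 or -1 by \<open>unit_stable_imp_omod\<close>,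
  so each lattice of the orbit comes from exactly two units.\<close>

lemma card_unit_orbit:
  assumes M: "add_subgroup M" "\<not> omod M"
  shows "card ((\<lambda>\<eta>. (*) \<eta> ` M) ` \<U>) * 2 = card \<U>"
proof -
  let ?g = "\<lambda>\<eta>. (*) \<eta> ` M"
  have "card {\<eta> \<in> \<U>. ?g \<eta> = N} = 2" if N: "N \<in> ?g ` \<U>" for N
  proof -
    obtain \<epsilon> where \<epsilon>: "\<epsilon> \<in> \<U>" "N = ?g \<epsilon>" using N by blast
    have \<epsilon>0: "\<epsilon> \<noteq> 0" using \<epsilon> by (auto simp: \<U>_def)
    have "{\<eta> \<in> \<U>. ?g \<eta> = N} = {\<epsilon>, - \<epsilon>}"
    proof (intro subset_antisym subsetI)
      fix \<eta> assume "\<eta> \<in> {\<eta> \<in> \<U>. ?g \<eta> = N}"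
      then have \<eta>: "\<eta> \<in> \<U>" "?g \<eta> = ?g \<epsilon>" using \<epsilon> by auto
      then have "(*) (inverse \<epsilon>) ` ?g \<eta> = (*) (inverse \<epsilon>) ` ?g \<epsilon>" by simp
      then have "(*) (inverse \<epsilon> * \<eta>) ` M = M" using \<epsilon>0 by (simp add: mult_image_image)
      moreover have "inverse \<epsilon> * \<eta> \<in> \<U>" using \<eta> \<epsilon> by (intro \<U>_mult \<U>_inverse)
      ultimately have "inverse \<epsilon> * \<eta> = 1 \<or> inverse \<epsilon> * \<eta> = -1" using unit_stable_imp_omod[OF M(1)] M(2) by blast
      then show "\<eta> \<in> {\<epsilon>, - \<epsilon>}" using \<epsilon>0 by (auto simp: field_simps)
    next
      fix \<eta> assume "\<eta> \<in> {\<epsilon>, - \<epsilon>}"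
      then show "\<eta> \<in> {\<eta> \<in> \<U>. ?g \<eta> = N}"
        using \<epsilon> \<U>_mult[OF \<U>_minus_1 \<epsilon>(1)] mult_minus_image[OF M(1), of \<epsilon>]
        by (metis (mono_tags, lifting) insertE mem_Collect_eq mult_minus1 singletonD)
    qed
    moreover have "\<epsilon> \<noteq> - \<epsilon>" using \<epsilon>0 by (auto simp: complex_eq_iff)
    ultimately show ?thesis by simp
  qed
  then have "(\<Sum>N\<in>?g ` \<U>. \<Sum>\<eta> | \<eta> \<in> \<U> \<and> ?g \<eta> = N. 1) = (\<Sum>N\<in>?g ` \<U>. 2::nat)"
    by (intro sum.cong) simp_all
  moreover have "(\<Sum>N\<in>?g ` \<U>. \<Sum>\<eta> | \<eta> \<in> \<U> \<and> ?g \<eta> = N. 1) = (\<Sum>\<eta>\<in>\<U>. 1::nat)"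
    using finite_\<U> by (intro sum.group) auto
  ultimately show ?thesis by simp
qed

lemma over_1:
  assumes J: "omod J"
  shows "over J 1 = {J}"
proof (intro subset_antisym subsetI)
  fix M assume "M \<in> over J 1"
  then have "add_subgroup M" "M \<subseteq> J" "idx J M = 1" by (auto simp: over_def subs_def)
  then show "M \<in> {J}" using idx_eq_1D[OF _ omod_add_subgroup[OF J]] by blast
next
  fix M assume "M \<in> {J}"
  moreover have "J \<in> over J 1"
    unfolding over_def subs_def using omod_add_subgroup[OF J] idx_self gen_omod[OF J] by blast
  ultimately show "M \<in> over J 1" by blast
qed

lemma over_not_omod:
  assumes "M \<in> over J f" "f \<noteq> 1"
  shows "\<not> omod M"
proof
  assume "omod M"
  then have "M = J" using gen_omod[of M] assms(1) by (simp add: over_def)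
  moreover have "add_subgroup M" "idx J M = f" using assms(1) by (simp_all add: over_def subs_def)
  ultimately show False using idx_self[of M] assms(2) by simp
qed

text \<open>\<open>gen\<close> maps the class of \<open>M\<close> onto the class of
  \<open>J\<close>. Over K = v \<open>J\<close> lie exactly the lattices v \<eta> \<open>M\<close>
  with \<eta> a unit, because a rotation carrying \<open>J\<close> to K differs from v by an element
  stabilising \<open>J\<close>. Hence all fibres have the size of the unit orbit of
  \<open>M\<close>, which is 1 for f = 1 since then \<open>M\<close> = \<open>J\<close>.\<close>

lemma card_cls:
  assumes I: "full_lattice I" "omod I" and J: "J \<in> ideals I e" and M: "M \<in> over J f" and e: "e > 0" and f: "f > 0"
  shows "card (cls I (e * f) M) = card (cls I e J) * (if f = 1 then 1 else card \<U> div 2)"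
proof -
  have J': "add_subgroup J" "J \<subseteq> I" "idx I J = e" "omod J" using J by (auto simp: ideals_def subs_def)
  have M': "add_subgroup M" "M \<subseteq> J" "idx J M = f" "gen M = J" using M by (auto simp: over_def subs_def)
  note sI = omod_add_subgroup[OF I(2)]
  have fJ: "full_lattice J" using full_lattice_sub[OF I(1) _ e] J by (auto simp: ideals_def)
  define W where "W = (if f = 1 then 1 else card \<U> div 2)"
  have fin: "finite (cls I (e * f) M)" "finite (cls I e J)"
    using finite_subs[OF I(1)] e f by (auto simp: cls_def)
  have gen_cls: "gen N \<in> cls I e J" if Ncls: "N \<in> cls I (e * f) M" for N
  proof -
    obtain u where u: "u \<in> rot" "(*) u ` M = N" and N: "add_subgroup N" "N \<subseteq> I" "idx I N = e * f"
      using Ncls by (auto simp: cls_def subs_def)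
    have g: "gen N = (*) u ` J" using gen_mult[of u M] u M'(4) by simp
    have "gen N \<subseteq> I" using gen_subset[OF I(2) N(2)] .
    moreover have "idx I N = idx I (gen N) * idx (gen N) N"
      using idx_tower[OF N(1) omod_add_subgroup[OF omod_gen[OF N(1)]] sI subset_gen[OF N(1)] calculation] .
    moreover have "idx (gen N) N = f"
      using idx_mult_image[OF M'(1) rot_nz[OF u(1)], of J] M'(3) g u(2) by simp
    ultimately have "idx I (gen N) = e" using N(3) f by simp
    then show ?thesis
      using \<open>gen N \<subseteq> I\<close> u(1) g omod_add_subgroup[OF omod_gen[OF N(1)]] by (auto simp: cls_def subs_def)
  qed
  have fibre: "card {N \<in> cls I (e * f) M. gen N = K} = W" if K: "K \<in> cls I e J" for K
  proof -
    obtain v where v: "v \<in> rot" "(*) v ` J = K" using K by (auto simp: cls_def)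
    have K': "add_subgroup K" "K \<subseteq> I" "idx I K = e" using K by (auto simp: cls_def subs_def)
    have v0: "v \<noteq> 0" using rot_nz[OF v(1)] .
    have "{N \<in> cls I (e * f) M. gen N = K} = (`) ((*) v) ` (\<lambda>\<eta>. (*) \<eta> ` M) ` \<U>"
    proof (intro subset_antisym subsetI)
      fix N assume "N \<in> {N \<in> cls I (e * f) M. gen N = K}"
      then obtain u where u: "u \<in> rot" "(*) u ` M = N" "gen N = K" by (auto simp: cls_def)
      then have "(*) u ` J = (*) v ` J" using gen_mult[of u M] M'(4) v(2) by simp
      then have "(*) (inverse v) ` (*) u ` J = (*) (inverse v) ` (*) v ` J" by simp
      then have "(*) (inverse v * u) ` J = J" using v0 by (simp add: mult_image_image)
      then have "inverse v * u \<in> \<U>" using stabilizer_\<U>[OF fJ] u(1) v(1) by (simp add: rot_mult rot_inverse)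
      moreover have "v * (inverse v * u) = u" using v0 by (simp flip: mult.assoc)
      then have "N = (*) v ` (*) (inverse v * u) ` M" using u(2) by (metis mult_image_image)
      ultimately show "N \<in> (`) ((*) v) ` (\<lambda>\<eta>. (*) \<eta> ` M) ` \<U>" by blast
    next
      fix N assume "N \<in> (`) ((*) v) ` (\<lambda>\<eta>. (*) \<eta> ` M) ` \<U>"
      then obtain \<eta> where "\<eta> \<in> \<U>" "N = (*) v ` (*) \<eta> ` M" by blast
      then have \<eta>: "\<eta> \<in> \<U>" "N = (*) (v * \<eta>) ` M" by (simp_all only: mult_image_image)
      have KJ: "K = (*) (v * \<eta>) ` J"
        using \<U>_fixes[OF J'(4) \<eta>(1)] v(2) by (metis mult_image_image)
      have r: "v * \<eta> \<in> rot" using v(1) \<eta>(1) \<U>_subset_rot by (auto intro: rot_mult)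
      have N: "add_subgroup N" "N \<subseteq> K"
        unfolding \<eta>(2) KJ using M'(1,2) by (simp_all add: add_subgroup_mult_image image_mono)
      have "idx K N = f" unfolding KJ \<eta>(2) using idx_mult_image[OF M'(1) rot_nz[OF r]] M'(3) by simp
      then have "idx I N = e * f" using idx_tower[OF N(1) K'(1) sI N(2) K'(2)] K'(3) by simp
      moreover have "gen N = K" unfolding \<eta>(2) gen_mult M'(4) KJ ..
      ultimately show "N \<in> {N \<in> cls I (e * f) M. gen N = K}"
        using N K'(2) r \<eta>(2) unfolding cls_def subs_def by blast
    qed
    moreover have "inj_on ((`) ((*) v)) X" for X
      using v0 by (intro inj_onI) (simp add: mult_image_cancel)
    ultimately have "card {N \<in> cls I (e * f) M. gen N = K} = card ((\<lambda>\<eta>. (*) \<eta> ` M) ` \<U>)"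
      by (simp add: card_image)
    also have "\<dots> = W"
    proof (cases "f = 1")
      case True
      then have "M = J" using M over_1[OF J'(4)] by auto
      then have "(\<lambda>\<eta>. (*) \<eta> ` M) ` \<U> = {J}" using \<U>_fixes[OF J'(4)] \<U>_1 by auto
      then show ?thesis using True by (simp add: W_def)
    next
      case False
      then show ?thesis using card_unit_orbit[OF M'(1) over_not_omod[OF M False]] by (simp add: W_def)
    qed
    finally show ?thesis .
  qed
  have "(\<Sum>K\<in>cls I e J. \<Sum>N | N \<in> cls I (e * f) M \<and> gen N = K. 1) = (\<Sum>N\<in>cls I (e * f) M. 1::nat)"
    using fin gen_cls by (intro sum.group) auto
  moreover have "(\<Sum>K\<in>cls I e J. \<Sum>N | N \<in> cls I (e * f) M \<and> gen N = K. 1) = (\<Sum>K\<in>cls I e J. W)"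
    using fibre by (intro sum.cong) simp_all
  ultimately show ?thesis by (simp add: W_def)
qed

text \<open>For a weight depending only on \<open>gen M\<close>, \<open>card_cls\<close> and
  \<open>card_over\<close> make the inner sum over the sublattices of \<open>J\<close> depend on
  \<open>J\<close> and f separately, so the total is a convolution.\<close>

lemma class_weight_sum:
  fixes \<kappa> :: "complex set \<Rightarrow> real"
  assumes I: "full_lattice I" "omod I" "I \<subseteq> \<K>" and m: "m > 0"
  shows "(\<Sum>M\<in>subs I m. \<kappa> (gen M) / card (cls I m M)) =
    dconv (\<lambda>e. \<Sum>J\<in>ideals I e. \<kappa> J / card (cls I e J))
      (\<lambda>f. if f = 1 then 1 else real (card (over \<O> f)) / (card \<U> / 2)) m"
proof -
  \<comment> \<open>\<open>card_cls\<close> divides natural numbers; the division is exact because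
    the unit orbit has half as many elements as \<U>.\<close>
  have even: "real (card \<U> div 2) = card \<U> / 2" if "M \<in> over J f" "f \<noteq> 1" for M J f
  proof -
    have "even (card \<U>)"
      using card_unit_orbit[OF _ over_not_omod[OF that]] that(1)
      by (metis (no_types, lifting) dvd_triv_right mem_Collect_eq over_def subs_def)
    then show ?thesis by (simp add: real_of_nat_div)
  qed
  have "(\<Sum>M\<in>subs I m. \<kappa> (gen M) / card (cls I m M)) =
    (\<Sum>e | e dvd m. \<Sum>J\<in>ideals I e. \<Sum>M\<in>over J (m div e). \<kappa> (gen M) / card (cls I m M))"
    by (rule sum_subs_by_gen[OF I(1,2) m])
  also have "\<dots> = (\<Sum>e | e dvd m. \<Sum>J\<in>ideals I e. \<kappa> J / card (cls I e J) *
      (if m div e = 1 then 1 else real (card (over \<O> (m div e))) / (card \<U> / 2)))"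
  proof (intro sum.cong refl)
    fix e J assume e: "e \<in> {e. e dvd m}" and J: "J \<in> ideals I e"
    define f where "f = m div e"
    have ef: "m = e * f" "e > 0" "f > 0" using e m by (auto simp: f_def)
    have J': "omod J" "J \<subseteq> \<K>" "full_lattice J"
      using J I(3) full_lattice_sub[OF I(1) _ ef(2)] by (auto simp: ideals_def subs_def)
    have "(\<Sum>M\<in>over J f. \<kappa> (gen M) / card (cls I m M)) =
      (\<Sum>M\<in>over J f. \<kappa> J / card (cls I e J) / (if f = 1 then 1 else card \<U> / 2))"
    proof (rule sum.cong[OF refl])
      fix M assume M: "M \<in> over J f"
      have "gen M = J" using M by (simp add: over_def)
      then show "\<kappa> (gen M) / card (cls I m M) = \<kappa> J / card (cls I e J) / (if f = 1 then 1 else card \<U> / 2)"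
        using card_cls[OF I(1,2) J M ef(2,3)] even[OF M] ef(1) by simp
    qed
    also have "\<dots> = card (over J f) * (\<kappa> J / card (cls I e J) / (if f = 1 then 1 else card \<U> / 2))" by simp
    also have "card (over J f) = card (over \<O> f)" by (rule card_over[OF J'(3,1,2) ef(3)])
    also have "real (card (over \<O> f)) * (\<kappa> J / card (cls I e J) / (if f = 1 then 1 else card \<U> / 2))
      = \<kappa> J / card (cls I e J) * (if f = 1 then 1 else real (card (over \<O> f)) / (card \<U> / 2))"
      using over_1[OF omod_\<O>] by (auto simp: mult_ac)
    finally show "(\<Sum>M\<in>over J (m div e). \<kappa> (gen M) / card (cls I m M)) = \<kappa> J / card (cls I e J) *
      (if m div e = 1 then 1 else real (card (over \<O> (m div e))) / (card \<U> / 2))" unfolding f_def .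
  qed
  also have "\<dots> = dconv (\<lambda>e. \<Sum>J\<in>ideals I e. \<kappa> J / card (cls I e J))
      (\<lambda>f. if f = 1 then 1 else real (card (over \<O> f)) / (card \<U> / 2)) m"
    unfolding dconv_def sum_distrib_right ..
  finally show ?thesis .
qed

lemma sigma_convolution:
  assumes "m > 0"
  shows "dconv (\<lambda>e. card (ideals \<O> e)) (\<lambda>f. card (over \<O> f)) m = real (\<Sum>{d. d dvd m})"
proof -
  have "real (\<Sum>{d. d dvd m}) = (\<Sum>M\<in>subs \<O> m. 1)"
    using card_subs[OF full_lattice_\<O> assms] by simp
  also have "\<dots> = (\<Sum>e | e dvd m. \<Sum>J\<in>ideals \<O> e. \<Sum>M\<in>over J (m div e). 1)"
    by (rule sum_subs_by_gen[OF full_lattice_\<O> omod_\<O> assms])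
  also have "\<dots> = (\<Sum>e | e dvd m. \<Sum>J\<in>ideals \<O> e. real (card (over \<O> (m div e))))"
  proof (intro sum.cong refl)
    fix e J assume e: "e \<in> {e. e dvd m}" and J: "J \<in> ideals \<O> e"
    then have ef: "e > 0" "m div e > 0" using assms by (auto simp: dvd_pos_nat dvd_div_eq_0_iff intro!: Nat.gr0I)
    have "omod J" "J \<subseteq> \<K>" "full_lattice J"
      using J \<O>_subset_\<K> full_lattice_sub[OF full_lattice_\<O> _ ef(1)] by (auto simp: ideals_def subs_def)
    then show "(\<Sum>M\<in>over J (m div e). 1) = real (card (over \<O> (m div e)))" using card_over ef(2) by simp
  qed
  finally show ?thesis by (simp add: dconv_def)
qed

end

section \<open>Improper isometries and ambiguous lattices\<close>

text \<open>The generator is a positive element minimising floor(g / \<epsilon>), a natural number.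
  Since distinct elements are at least \<epsilon> apart, a smaller positive element would have a
  smaller floor.\<close>

lemma real_discrete_subgroup:
  fixes G :: "real set"
  assumes G: "add_subgroup G" and \<epsilon>: "\<epsilon> > 0" "\<And>g. g \<in> G \<Longrightarrow> g \<noteq> 0 \<Longrightarrow> \<bar>g\<bar> \<ge> \<epsilon>" and g0: "g0 \<in> G" "g0 \<noteq> 0"
  obtains g where "g > 0" "G = range (\<lambda>k::int. of_int k * g)"
proof -
  define n where "n = (LEAST n. \<exists>g\<in>G. g > 0 \<and> nat \<lfloor>g / \<epsilon>\<rfloor> = n)"
  have "\<bar>g0\<bar> \<in> G" using g0(1) add_subgroup_minus[OF G g0(1)] by (simp add: abs_if)
  then have ex: "\<exists>n. \<exists>g\<in>G. g > 0 \<and> nat \<lfloor>g / \<epsilon>\<rfloor> = n" using g0(2) by (metis zero_less_abs_iff)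
  obtain g where g: "g \<in> G" "g > 0" "nat \<lfloor>g / \<epsilon>\<rfloor> = n"
    using LeastI_ex[OF ex] unfolding n_def[symmetric] by blast
  have min: "n \<le> nat \<lfloor>h / \<epsilon>\<rfloor>" if "h \<in> G" "h > 0" for h
    unfolding n_def using that by (intro Least_le) blast
  have "h \<in> range (\<lambda>k::int. of_int k * g)" if h: "h \<in> G" for h
  proof -
    define r where "r = h - of_int \<lfloor>h / g\<rfloor> * g"
    have rG: "r \<in> G" unfolding r_def using h g(1) G by (intro add_subgroup_diff add_subgroup_int_mult)
    have r: "0 \<le> r" "r < g"
      using floor_divide_lower[OF g(2), of h] floor_divide_upper[OF g(2), of h]
      unfolding r_def by (simp_all add: distrib_right)
    have "r = 0"
    proof (rule ccontr)
      assume "r \<noteq> 0"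
      then have "\<epsilon> \<le> g - r" using \<epsilon>(2)[OF add_subgroup_diff[OF G g(1) rG]] r by simp
      then have "r / \<epsilon> \<le> g / \<epsilon> - 1" using \<epsilon>(1) by (simp add: field_simps)
      then have "\<lfloor>r / \<epsilon>\<rfloor> \<le> \<lfloor>g / \<epsilon>\<rfloor> - 1" by linarith
      moreover have "\<lfloor>r / \<epsilon>\<rfloor> \<ge> 0" using r(1) \<epsilon>(1) by simp
      ultimately show False using min[OF rG] \<open>r \<noteq> 0\<close> r(1) g(3) by linarith
    qed
    then show ?thesis by (simp add: r_def)
  qed
  moreover have "of_int k * g \<in> G" for k using add_subgroup_int_mult[OF G g(1)] .
  ultimately show ?thesis using that[OF g(2)] by blast
qed

text \<open>The right-hand convolution is the number of ordered factorisations of m into three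
  factors, so its series is zeta(s)^3 and converges for Re s > 1. A divisor \<alpha> of N m^2 is
  encoded by g = gcd(\<alpha>, m) and \<alpha> / g; the latter is coprime to m / g and therefore
  divides N g.\<close>

lemma card_divisors_mult_square:
  assumes N: "N > 0" and m: "m > (0::nat)"
  shows "real (card {\<alpha>. \<alpha> dvd N * m\<^sup>2}) \<le> real (card {d. d dvd N}) * dconv (dconv (\<lambda>_. 1) (\<lambda>_. 1)) (\<lambda>_. 1) m"
proof -
  have fin: "finite {d. d dvd n}" if "n > 0" for n :: nat using that by simp
  have mult: "card {d. d dvd x * y} \<le> card {d. d dvd x} * card {d. d dvd y}" if "x > 0" "y > 0" for x y :: nat
  proof -
    have "{d. d dvd x * y} \<subseteq> (\<lambda>(d, e). d * e) ` ({d. d dvd x} \<times> {d. d dvd y})"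
    proof
      fix d assume "d \<in> {d. d dvd x * y}"
      then obtain p q where "d = p * q" "p dvd x" "q dvd y" using division_decomp[of d x y] by blast
      then show "d \<in> (\<lambda>(d, e). d * e) ` ({d. d dvd x} \<times> {d. d dvd y})" by auto
    qed
    then have "card {d. d dvd x * y} \<le> card ({d. d dvd x} \<times> {d. d dvd y})"
      using that by (intro surj_card_le) auto
    then show ?thesis by (simp add: card_cartesian_product)
  qed
  let ?f = "\<lambda>\<alpha>. (gcd \<alpha> m, \<alpha> div gcd \<alpha> m)"
  have "card {\<alpha>. \<alpha> dvd N * m\<^sup>2} \<le> card (SIGMA g:{g. g dvd m}. {\<beta>. \<beta> dvd N * g})"
  proof (rule card_inj_on_le[where f = ?f])
    show "inj_on ?f {\<alpha>. \<alpha> dvd N * m\<^sup>2}"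
      by (rule inj_onI) (metis dvd_div_mult_self gcd_dvd1 prod.inject)
    show "?f ` {\<alpha>. \<alpha> dvd N * m\<^sup>2} \<subseteq> (SIGMA g:{g. g dvd m}. {\<beta>. \<beta> dvd N * g})"
    proof (rule image_subsetI)
      fix \<alpha> assume "\<alpha> \<in> {\<alpha>. \<alpha> dvd N * m\<^sup>2}"
      then have \<alpha>: "\<alpha> dvd N * m\<^sup>2" by simp
      define g where "g = gcd \<alpha> m"
      have g: "g dvd m" "g dvd \<alpha>" "g > 0" using m by (auto simp: g_def)
      define m' where "m' = m div g"
      have m': "m = g * m'" using g by (simp add: m'_def)
      obtain \<beta> where \<beta>: "\<alpha> = g * \<beta>" using g(2) by blast
      have "coprime (\<alpha> div g) (m div g)" unfolding g_def using m by (intro div_gcd_coprime) simp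
      then have cop: "coprime \<beta> m'" using g(3) by (simp add: \<beta> m'_def)
      have "g * \<beta> dvd g * (N * g * m' * m')" using \<alpha> unfolding \<beta> m' power2_eq_square by (simp add: mult_ac)
      then have "\<beta> dvd N * g * m' * m'" using g(3) by simp
      then have "\<beta> dvd N * g" using cop by (simp add: coprime_dvd_mult_left_iff)
      moreover have "\<alpha> div g = \<beta>" using \<beta> g(3) by simp
      ultimately show "?f \<alpha> \<in> (SIGMA g:{g. g dvd m}. {\<beta>. \<beta> dvd N * g})"
        unfolding g_def[symmetric] using g(1) by simp
    qed
    show "finite (SIGMA g:{g. g dvd m}. {\<beta>. \<beta> dvd N * g})"
      using m N by (intro finite_SigmaI) (auto simp: dvd_pos_nat)
  qed
  also have "\<dots> = (\<Sum>g | g dvd m. card {\<beta>. \<beta> dvd N * g})"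
    using m N by (intro card_SigmaI) (auto simp: dvd_pos_nat)
  also have "\<dots> \<le> (\<Sum>g | g dvd m. card {d. d dvd N} * card {d. d dvd g})"
    using m N by (intro sum_mono mult) (auto simp: dvd_pos_nat)
  finally have "real (card {\<alpha>. \<alpha> dvd N * m\<^sup>2}) \<le> real (\<Sum>g | g dvd m. card {d. d dvd N} * card {d. d dvd g})"
    by (rule of_nat_mono)
  then show ?thesis by (simp add: dconv_def sum_distrib_left)
qed

context quad_order
begin

lemma norm_\<A>: "x \<in> \<A> \<Longrightarrow> \<exists>k::int. (norm x)\<^sup>2 = of_int (a * k)"
proof -
  assume "x \<in> \<A>"
  then obtain s t where x: "x = of_int s * of_int a + of_int t * \<tau>" unfolding \<A>_eq zspan_def by blast
  have "complex_of_real ((norm x)\<^sup>2) = x * cnj x" by (rule complex_norm_square)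
  also have "\<dots> = of_int (s * s * a * a) + of_int (s * t * a) * (\<tau> + cnj \<tau>) + of_int (t * t) * (\<tau> * cnj \<tau>)"
    by (simp add: x algebra_simps)
  also have "\<dots> = of_int (a * (s * s * a + s * t * b + t * t * c))"
    unfolding \<tau>_add_cnj \<tau>_mult_cnj by (simp add: algebra_simps)
  finally have "complex_of_real ((norm x)\<^sup>2) = complex_of_real (of_int (a * (s * s * a + s * t * b + t * t * c)))"
    by (simp only: of_real_of_int_eq)
  then show ?thesis using of_real_eq_iff by blast
qed

lemma cls_eq: "M \<in> subs A m \<Longrightarrow> N \<in> cls A m M \<Longrightarrow> cls A m N = cls A m M"
proof -
  assume M: "M \<in> subs A m" and "N \<in> cls A m M"
  then obtain u where u: "u \<in> rot" "(*) u ` M = N" by (auto simp: cls_def)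
  have M': "(*) (inverse u) ` N = M" using rot_nz[OF u(1)] u(2)[symmetric] by (simp add: mult_image_image)
  have "X \<in> cls A m N \<longleftrightarrow> X \<in> cls A m M" for X
  proof
    assume "X \<in> cls A m N"
    then obtain v where v: "v \<in> rot" "(*) v ` N = X" "X \<in> subs A m" by (auto simp: cls_def)
    then have "(*) (v * u) ` M = X" using u(2) by (metis mult_image_image)
    then show "X \<in> cls A m M" using v u(1) rot_mult[of v u] unfolding cls_def by blast
  next
    assume "X \<in> cls A m M"
    then obtain v where v: "v \<in> rot" "(*) v ` M = X" "X \<in> subs A m" by (auto simp: cls_def)
    then have "(*) (v * inverse u) ` N = X" using M' by (metis mult_image_image)
    then show "X \<in> cls A m N" using v u(1) rot_mult[of v "inverse u"] rot_inverse unfolding cls_def by blast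
  qed
  then show ?thesis by blast
qed

lemma cls_self: "M \<in> subs A m \<Longrightarrow> M \<in> cls A m M"
  unfolding cls_def using rot_1 by force

lemma finite_cls: "full_lattice A \<Longrightarrow> m > 0 \<Longrightarrow> finite (cls A m M)"
  unfolding cls_def using finite_subs by simp

lemma card_cls_pos: "full_lattice A \<Longrightarrow> m > 0 \<Longrightarrow> M \<in> subs A m \<Longrightarrow> card (cls A m M) > 0"
  using finite_cls cls_self by (metis card_gt_0_iff empty_iff)

lemma cls_weight:
  assumes A: "full_lattice A" and m: "m > 0" and M: "M \<in> subs A m"
  shows "(\<Sum>N\<in>cls A m M. x / card (cls A m N)) = (x :: real)"
proof -
  have "(\<Sum>N\<in>cls A m M. x / card (cls A m N)) = (\<Sum>N\<in>cls A m M. x / card (cls A m M))"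
    by (rule sum.cong) (simp_all add: cls_eq[OF M])
  then show ?thesis using card_cls_pos[OF assms] by simp
qed

definition rot_rel :: "complex set \<Rightarrow> nat \<Rightarrow> (complex set \<times> complex set) set" where
  "rot_rel A m = {(M, N). M \<in> subs A m \<and> N \<in> subs A m \<and> (\<exists>u\<in>rot. (*) u ` M = N)}"

definition orth_rel :: "complex set \<Rightarrow> nat \<Rightarrow> (complex set \<times> complex set) set" where
  "orth_rel A m = {(M, N). M \<in> subs A m \<and> N \<in> subs A m \<and>
     (\<exists>u\<in>rot. (*) u ` M = N \<or> (*) u ` cnj ` M = N)}"

text \<open>Tells whether the orthogonal class of \<open>M\<close> within \<open>A\<close> contains
  improper images of \<open>M\<close> at all.\<close>

definition embeds_cnj :: "complex set \<Rightarrow> complex set \<Rightarrow> bool" where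
  "embeds_cnj A M \<longleftrightarrow> (\<exists>u\<in>rot. (*) u ` cnj ` M \<subseteq> A \<and> idx A ((*) u ` cnj ` M) = idx A M)"

text \<open>Equivalently, some improper image of \<open>M\<close> is also a proper image, so that
  proper and improper images form the same class.\<close>

definition ambiguous :: "complex set \<Rightarrow> bool" where
  "ambiguous M \<longleftrightarrow> (\<exists>u\<in>rot. (*) u ` cnj ` M = M)"

lemma ambiguousI: "u \<in> rot \<Longrightarrow> (*) u ` cnj ` M = M \<Longrightarrow> ambiguous M"
  unfolding ambiguous_def by blast

lemma refl_refl: "(*) u ` cnj ` (*) v ` cnj ` M = (*) (u * cnj v) ` M"
  by (simp add: image_image mult.assoc)

lemma refl_mult: "(*) u ` cnj ` (*) v ` M = (*) (u * cnj v) ` cnj ` M"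
  by (simp add: image_image mult.assoc)

lemma add_subgroup_cnj: "add_subgroup M \<Longrightarrow> add_subgroup (cnj ` M)"
  by (rule add_subgroup_image) simp_all

lemma equiv_rot_rel: "equiv (subs A m) (rot_rel A m)"
proof (rule equivI)
  show "rot_rel A m \<subseteq> subs A m \<times> subs A m" by (auto simp: rot_rel_def)
  show "refl_on (subs A m) (rot_rel A m)"
    unfolding refl_on_def rot_rel_def using rot_1 by (force intro: bexI[of _ 1])
  show "sym (rot_rel A m)"
  proof (rule symI)
    fix M N assume "(M, N) \<in> rot_rel A m"
    then obtain u where u: "u \<in> rot" "(*) u ` M = N" "M \<in> subs A m" "N \<in> subs A m" by (auto simp: rot_rel_def)
    have "(*) (inverse u) ` N = M" using rot_nz[OF u(1)] u(2)[symmetric] by (simp add: mult_image_image)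
    then show "(N, M) \<in> rot_rel A m" using u rot_inverse unfolding rot_rel_def by blast
  qed
  show "trans (rot_rel A m)"
  proof (rule transI)
    fix M N P assume "(M, N) \<in> rot_rel A m" "(N, P) \<in> rot_rel A m"
    then obtain u v where *: "u \<in> rot" "v \<in> rot" "(*) u ` M = N" "(*) v ` N = P" "M \<in> subs A m" "P \<in> subs A m"
      by (auto simp: rot_rel_def)
    then have "(*) (v * u) ` M = P" by (metis mult_image_image)
    then show "(M, P) \<in> rot_rel A m" using * rot_mult unfolding rot_rel_def by blast
  qed
qed

lemma equiv_orth_rel: "equiv (subs A m) (orth_rel A m)"
proof (rule equivI)
  show "orth_rel A m \<subseteq> subs A m \<times> subs A m" by (auto simp: orth_rel_def)
  show "refl_on (subs A m) (orth_rel A m)"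
    unfolding refl_on_def orth_rel_def using rot_1 by (force intro: bexI[of _ 1])
  show "sym (orth_rel A m)"
  proof (rule symI)
    fix M N assume "(M, N) \<in> orth_rel A m"
    then obtain u where u: "u \<in> rot" "(*) u ` M = N \<or> (*) u ` cnj ` M = N" "M \<in> subs A m" "N \<in> subs A m"
      by (auto simp: orth_rel_def)
    have u1: "u * cnj u = 1" using u(1) complex_norm_square[of u] by (simp add: rot_def)
    have "(*) (inverse u) ` N = M \<or> (*) u ` cnj ` N = M"
    proof (rule disjE[OF u(2)])
      assume "(*) u ` M = N"
      from this[symmetric] have "(*) (inverse u) ` N = M"
        using rot_nz[OF u(1)] by (simp add: mult_image_image)
      then show ?thesis ..
    next
      assume "(*) u ` cnj ` M = N"
      then have "(*) u ` cnj ` N = M" using refl_refl[of u u M] u1 by simp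
      then show ?thesis ..
    qed
    then show "(N, M) \<in> orth_rel A m" using u rot_inverse unfolding orth_rel_def by blast
  qed
  show "trans (orth_rel A m)"
  proof (rule transI)
    fix M N P assume "(M, N) \<in> orth_rel A m" "(N, P) \<in> orth_rel A m"
    then obtain u v where *: "u \<in> rot" "v \<in> rot" "(*) u ` M = N \<or> (*) u ` cnj ` M = N"
      "(*) v ` N = P \<or> (*) v ` cnj ` N = P" "M \<in> subs A m" "P \<in> subs A m"
      by (auto simp: orth_rel_def)
    have "(*) (v * u) ` M = P \<or> (*) (v * u) ` cnj ` M = P \<or> (*) (v * cnj u) ` cnj ` M = P \<or> (*) (v * cnj u) ` M = P"
      using *(3,4) by (metis mult_image_image refl_mult refl_refl)
    moreover have "v * u \<in> rot" "v * cnj u \<in> rot" using *(1,2) by (auto intro: rot_mult rot_cnj)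
    ultimately show "(M, P) \<in> orth_rel A m" using *(5,6) unfolding orth_rel_def by blast
  qed
qed

lemma card_rot_classes:
  assumes A: "full_lattice A" and m: "m > 0"
  shows "real (card (subs A m // rot_rel A m)) = (\<Sum>M\<in>subs A m. 1 / card (cls A m M))"
proof (rule card_quotient_weight[OF equiv_rot_rel finite_subs[OF A m]])
  fix M assume M: "M \<in> subs A m"
  have "rot_rel A m `` {M} = cls A m M" using M by (auto simp: rot_rel_def cls_def)
  then show "(\<Sum>N\<in>rot_rel A m `` {M}. 1 / real (card (cls A m N))) = 1"
    using cls_weight[OF A m M, of 1] by simp
qed

lemma embeds_cnj_iff:
  assumes "M \<in> subs A m"
  shows "embeds_cnj A M \<longleftrightarrow> (\<exists>u\<in>rot. (*) u ` cnj ` M \<in> subs A m)"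
  using assms unfolding embeds_cnj_def subs_def by (auto intro!: add_subgroup_mult_image add_subgroup_cnj)

lemma embeds_cnj_cls:
  assumes M: "M \<in> subs A m" and N: "N \<in> cls A m M"
  shows "embeds_cnj A N \<longleftrightarrow> embeds_cnj A M"
proof -
  have *: "embeds_cnj A N" if M: "M \<in> subs A m" and N: "N \<in> cls A m M" and e: "embeds_cnj A M" for M N
  proof -
    obtain u where u: "u \<in> rot" "(*) u ` M = N" "N \<in> subs A m" using N by (auto simp: cls_def)
    obtain v where v: "v \<in> rot" "(*) v ` cnj ` M \<in> subs A m" using e embeds_cnj_iff[OF M] by blast
    have "u * cnj u = 1" using u(1) complex_norm_square[of u] by (simp add: rot_def)
    then have "(*) (v * u) ` cnj ` N = (*) v ` cnj ` M"
      unfolding u(2)[symmetric] refl_mult by (simp add: mult.assoc)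
    then show ?thesis using embeds_cnj_iff[OF u(3)] u(1) v rot_mult by metis
  qed
  have "N \<in> subs A m" "M \<in> cls A m N"
    using N cls_eq[OF M N] cls_self[OF M] by (auto simp: cls_def)
  then show ?thesis using * M N by blast
qed

lemma ambiguous_cls:
  assumes M: "M \<in> subs A m" and N: "N \<in> cls A m M"
  shows "ambiguous N \<longleftrightarrow> ambiguous M"
proof -
  have *: "ambiguous N" if N: "N \<in> cls A m M" and e: "ambiguous M" for M N
  proof -
    obtain u where u: "u \<in> rot" "(*) u ` M = N" using N by (auto simp: cls_def)
    obtain v where v: "v \<in> rot" "(*) v ` cnj ` M = M" using e by (auto simp: ambiguous_def)
    have "u * cnj u = 1" using u(1) complex_norm_square[of u] by (simp add: rot_def)
    then have "(*) (u * v * u) ` cnj ` N = (*) (u * v) ` cnj ` M"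
      unfolding u(2)[symmetric] refl_mult by (simp add: mult.assoc)
    also have "\<dots> = N" using u v by (metis mult_image_image)
    finally have e: "(*) (u * v * u) ` cnj ` N = N" .
    show ?thesis by (rule ambiguousI[OF rot_mult[OF rot_mult[OF u(1) v(1)] u(1)] e])
  qed
  have "M \<in> cls A m N" using cls_eq[OF M N] cls_self[OF M] by auto
  then show ?thesis using * N by blast
qed

text \<open>An orthogonal class is a single rotation class if no improper image fits into
  \<open>A\<close> (weight 1) or if \<open>M\<close> is ambiguous (weight 1 - 1/2 + 1/2). Otherwise
  it consists of two rotation classes, each of total weight 1/2.\<close>

lemma card_orth_classes:
  assumes A: "full_lattice A" and m: "m > 0"
  shows "real (card (subs A m // orth_rel A m)) = (\<Sum>M\<in>subs A m.
    (1 - of_bool (embeds_cnj A M) / 2 + of_bool (ambiguous M) / 2) / card (cls A m M))"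
proof (rule card_quotient_weight[OF equiv_orth_rel finite_subs[OF A m]])
  fix M assume M: "M \<in> subs A m"
  define w where "w N = (1 - of_bool (embeds_cnj A N) / 2 + of_bool (ambiguous N) / 2 :: real)" for N
  \<comment> \<open>The improper images of \<open>M\<close>: either none, or a single rotation
    class, that of any one of them.\<close>
  define C where "C = {N \<in> subs A m. \<exists>u\<in>rot. (*) u ` cnj ` M = N}"
  have R: "orth_rel A m `` {M} = cls A m M \<union> C" using M by (auto simp: orth_rel_def cls_def C_def)
  have weight: "(\<Sum>N\<in>cls A m X. w N / card (cls A m N)) = w X" if X: "X \<in> subs A m" for X
  proof -
    have "(\<Sum>N\<in>cls A m X. w N / card (cls A m N)) = (\<Sum>N\<in>cls A m X. w X / card (cls A m N))"
      by (rule sum.cong) (simp_all add: w_def embeds_cnj_cls[OF X] ambiguous_cls[OF X])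
    then show ?thesis using cls_weight[OF A m X] by simp
  qed
  have "(\<Sum>N\<in>orth_rel A m `` {M}. w N / card (cls A m N)) = 1"
  proof (cases "embeds_cnj A M")
    case False
    then have "C = {}" unfolding C_def using embeds_cnj_iff[OF M] by blast
    moreover have "\<not> ambiguous M" using False embeds_cnj_iff[OF M] M unfolding ambiguous_def by metis
    ultimately show ?thesis using weight[OF M] False by (simp add: R w_def)
  next
    case True
    then obtain u where u: "u \<in> rot" "(*) u ` cnj ` M \<in> subs A m" using embeds_cnj_iff[OF M] by blast
    define N0 where "N0 = (*) u ` cnj ` M"
    have N0: "N0 \<in> subs A m" using u by (simp add: N0_def)
    have u1: "u * cnj u = 1" using u(1) complex_norm_square[of u] by (simp add: rot_def)
    have M_N0: "(*) u ` cnj ` N0 = M" unfolding N0_def refl_refl u1 by simp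
    have CN0: "C = cls A m N0"
    proof (intro set_eqI iffI)
      fix X assume "X \<in> C"
      then obtain v where v: "v \<in> rot" "(*) v ` cnj ` M = X" "X \<in> subs A m" by (auto simp: C_def)
      have "(*) (v * cnj u) ` N0 = X" using refl_refl[of v u N0] v(2) unfolding M_N0 by simp
      moreover have "v * cnj u \<in> rot" using v(1) u(1) by (intro rot_mult rot_cnj)
      ultimately show "X \<in> cls A m N0" using v(3) unfolding cls_def by blast
    next
      fix X assume "X \<in> cls A m N0"
      then obtain v where v: "v \<in> rot" "(*) v ` N0 = X" "X \<in> subs A m" by (auto simp: cls_def)
      have "(*) (v * u) ` cnj ` M = X" using v(2) unfolding N0_def by (simp only: mult_image_image)
      moreover have "v * u \<in> rot" using v(1) u(1) by (rule rot_mult)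
      ultimately show "X \<in> C" using v(3) unfolding C_def by blast
    qed
    show ?thesis
    proof (cases "ambiguous M")
      case amb: True
      then obtain v where v: "v \<in> rot" "(*) v ` cnj ` M = M" by (auto simp: ambiguous_def)
      then have "M \<in> cls A m N0" using CN0 M unfolding C_def by blast
      then have "C = cls A m M" using CN0 cls_eq[OF N0] by simp
      then show ?thesis using weight[OF M] True amb by (simp add: R w_def)
    next
      case amb: False
      have disj: "cls A m M \<inter> C = {}"
      proof (rule ccontr)
        assume "cls A m M \<inter> C \<noteq> {}"
        then obtain X where X: "X \<in> cls A m M" "X \<in> C" by blast
        obtain v1 where v1: "v1 \<in> rot" "(*) v1 ` M = X" using X(1) unfolding cls_def by blast
        obtain v2 where v2: "v2 \<in> rot" "(*) v2 ` cnj ` M = X" using X(2) unfolding C_def by blast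
        note v = v1(1) v2(1) trans[OF v1(2) v2(2)[symmetric]]
        have "(*) (inverse v1) ` (*) v1 ` M = (*) (inverse v1) ` (*) v2 ` cnj ` M" by (simp only: v(3))
        then have e: "(*) (inverse v1 * v2) ` cnj ` M = M" using rot_nz[OF v(1)] by (simp add: mult_image_image)
        have "ambiguous M" by (rule ambiguousI[OF rot_mult[OF rot_inverse[OF v(1)] v(2)] e])
        then show False using amb by simp
      qed
      have "(*) u ` cnj ` N0 \<in> subs A m" unfolding M_N0 by (rule M)
      then have "embeds_cnj A N0" using embeds_cnj_iff[OF N0] u(1) by blast
      moreover have "\<not> ambiguous N0"
      proof
        assume "ambiguous N0"
        then obtain v where v: "v \<in> rot" "(*) v ` cnj ` N0 = N0" unfolding ambiguous_def by blast
        have "(*) (v * cnj u) ` M = N0" using refl_refl[of v u M] v(2) unfolding N0_def by simp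
        moreover have "v * cnj u \<in> rot" using v(1) u(1) by (intro rot_mult rot_cnj)
        ultimately have "N0 \<in> cls A m M" using N0 unfolding cls_def by blast
        then show False using disj cls_self[OF N0] CN0 by blast
      qed
      ultimately have "w N0 = 1 / 2" "w M = 1 / 2" using True amb by (simp_all add: w_def)
      then show ?thesis
        unfolding R CN0 using disj finite_cls[OF A m] weight[OF M] weight[OF N0] CN0
        by (subst sum.union_disjoint) simp_all
    qed
  qed
  then show "(\<Sum>N\<in>orth_rel A m `` {M}.
    (1 - of_bool (embeds_cnj A N) / 2 + of_bool (ambiguous N) / 2) / real (card (cls A m N))) = 1"
    by (simp add: w_def)
qed

lemma gen_cnj:
  assumes "add_subgroup M"
  shows "gen (cnj ` M) = cnj ` gen M"
proof -
  have ct: "cnj \<tau> = of_int b - \<tau>" using \<tau>_add_cnj by (simp add: eq_diff_eq add.commute)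
  have *: "cnj (x + of_int b * y + \<tau> * (- y)) = cnj x + \<tau> * cnj y" for x y
    by (simp add: ct algebra_simps)
  have **: "cnj (x + \<tau> * y) = cnj (x + of_int b * y) + \<tau> * cnj (- y)" for x y
    by (simp add: ct algebra_simps)
  show ?thesis
  proof (intro subset_antisym subsetI)
    fix z assume "z \<in> gen (cnj ` M)"
    then obtain x y where z: "z = cnj x + \<tau> * cnj y" "x \<in> M" "y \<in> M" unfolding gen_def by blast
    have "x + of_int b * y + \<tau> * (- y) \<in> gen M"
      using z assms by (intro genI add_subgroup_add add_subgroup_int_mult add_subgroup_minus)
    then show "z \<in> cnj ` gen M" unfolding z(1) *[symmetric] by (rule imageI)
  next
    fix z assume "z \<in> cnj ` gen M"
    then obtain x y where z: "z = cnj (x + \<tau> * y)" "x \<in> M" "y \<in> M" unfolding gen_def by blast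
    show "z \<in> gen (cnj ` M)" unfolding z(1) **
      using z assms by (intro genI imageI add_subgroup_add add_subgroup_int_mult add_subgroup_minus)
  qed
qed

text \<open>As \<open>A\<close> is an \<O>-module, it contains an improper image of \<open>M\<close>
  as soon as it contains the corresponding image of \<open>M\<close> + \<tau> \<open>M\<close>, and
  indices are compatible by \<open>idx_tower\<close>. This makes the weight of the non-ambiguous
  part admissible in \<open>class_weight_sum\<close>.\<close>

lemma embeds_cnj_gen:
  assumes A: "omod A" and M: "M \<in> subs A m" and m: "m > 0"
  shows "embeds_cnj A M \<longleftrightarrow> embeds_cnj A (gen M)"
proof -
  note sA = omod_add_subgroup[OF A]
  have M': "add_subgroup M" "M \<subseteq> A" "idx A M = m" using M by (auto simp: subs_def)
  note g = omod_add_subgroup[OF omod_gen[OF M'(1)]] subset_gen[OF M'(1)] gen_subset[OF A M'(2)]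
  have m_eq: "m = idx A (gen M) * idx (gen M) M" using idx_tower[OF M'(1) g(1) sA g(2,3)] M'(3) by simp
  have sub: "(*) u ` cnj ` M \<subseteq> A \<longleftrightarrow> (*) u ` cnj ` gen M \<subseteq> A" for u
  proof
    assume "(*) u ` cnj ` M \<subseteq> A"
    then have "gen ((*) u ` cnj ` M) \<subseteq> A" by (rule gen_subset[OF A])
    then show "(*) u ` cnj ` gen M \<subseteq> A" by (simp only: gen_mult gen_cnj[OF M'(1)])
  qed (use g(2) in blast)
  have "idx A ((*) u ` cnj ` M) = m \<longleftrightarrow> idx A ((*) u ` cnj ` gen M) = idx A (gen M)"
    if u: "u \<in> rot" and s: "(*) u ` cnj ` gen M \<subseteq> A" for u
  proof -
    have "idx ((*) u ` cnj ` gen M) ((*) u ` cnj ` M) = idx (cnj ` gen M) (cnj ` M)"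
      by (rule idx_mult_image[OF add_subgroup_cnj[OF M'(1)] rot_nz[OF u]])
    also have "\<dots> = idx (gen M) M"
      by (rule idx_image[OF M'(1)]) (auto simp: inj_on_def)
    finally have "idx A ((*) u ` cnj ` M) = idx A ((*) u ` cnj ` gen M) * idx (gen M) M"
      using idx_tower[of "(*) u ` cnj ` M" "(*) u ` cnj ` gen M" A] M'(1) g s sA
      by (simp add: add_subgroup_mult_image add_subgroup_cnj image_mono)
    then show ?thesis using m_eq m by auto
  qed
  then show ?thesis unfolding embeds_cnj_def M'(3) sub by blast
qed

text \<open>After a rotation \<open>M\<close> is stable under complex conjugation, hence rectangular
  (t = 0) or rhombic (t = 1) over the real axis. Its real period determines \<alpha>; the index then
  fixes the imaginary period, so t and \<alpha> describe \<open>M\<close> up to rotation.\<close>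

lemma ambiguous_shape:
  assumes M: "M \<in> subs \<A> m" and m: "m > 0" and amb: "ambiguous M"
  obtains \<rho> and t \<alpha> :: int where "\<rho> \<in> M" "\<alpha> > 0" "(norm \<rho>)\<^sup>2 = of_int (a * \<alpha>)" "t \<in> {0, 1}"
    "\<alpha> dvd (4 * a * c - b\<^sup>2) * (int m)\<^sup>2"
    "M = zspan \<rho> (\<rho> * Complex (of_int t / 2) (m * Im \<tau> / of_int \<alpha>))"
proof -
  have M': "add_subgroup M" "M \<subseteq> \<A>" "idx \<A> M = m" using M by (auto simp: subs_def)
  obtain u where u: "u \<in> rot" "(*) u ` cnj ` M = M" using amb ambiguous_def by blast
  \<comment> \<open>Rotating by the inverse of a square root of u turns the reflection fixing
    \<open>M\<close> into plain conjugation. The root need not lie in \<K>, so \<open>P\<close> may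
    leave the field.\<close>
  define w where "w = csqrt u"
  have w2: "w * w = u" unfolding w_def by (metis power2_csqrt power2_eq_square)
  have "norm w * norm w = 1" using u(1) w2 by (simp add: rot_def flip: norm_mult)
  then have nw: "norm w = 1" by (metis abs_1 abs_norm_cancel real_sqrt_mult_self real_sqrt_abs2 real_sqrt_one)
  have w1: "w * cnj w = 1" using nw complex_norm_square[of w] by simp
  define P where "P = (*) (cnj w) ` M"
  have wP: "M = (*) w ` P" unfolding P_def mult_image_image w1 by simp
  have cP: "cnj z \<in> P" if zP: "z \<in> P" for z
  proof -
    obtain x where x: "x \<in> M" "z = cnj w * x" using zP unfolding P_def by blast
    have "u * cnj x \<in> M" using u(2) x(1) by blast
    then have "cnj w * (u * cnj x) \<in> P" unfolding P_def by blast
    moreover have "cnj w * (u * cnj x) = (w * cnj w) * w * cnj x" unfolding w2[symmetric] by simp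
    ultimately show ?thesis unfolding w1 x(2) by simp
  qed
  have sP: "add_subgroup P" unfolding P_def using M'(1) by (rule add_subgroup_mult_image)
  \<comment> \<open>Squared lengths in \<A> are integers, so nonzero vectors have length at least 1.
    This supplies the gaps for \<open>G1\<close> and \<open>G2\<close>.\<close>
  have nP: "norm z \<ge> 1" if z: "z \<in> P" "z \<noteq> 0" for z
  proof -
    obtain x where x: "x \<in> M" "z = cnj w * x" using z unfolding P_def by blast
    obtain k :: int where k: "(norm x)\<^sup>2 = of_int (a * k)" using norm_\<A> x(1) M'(2) by blast
    have "norm z = norm x" using x nw by (simp add: norm_mult)
    moreover have "a * k > 0" using k x z(2) by (metis mult_zero_right norm_eq_zero of_int_0_less_iff zero_less_power2)
    then have "1 \<le> a * k" by linarith
    then have "(norm x)\<^sup>2 \<ge> 1\<^sup>2" unfolding k by (metis of_int_1 of_int_le_iff one_power2)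
    ultimately show ?thesis using power2_le_imp_le[of 1 "norm x"] by simp
  qed
  obtain \<gamma> \<delta> where \<gamma>\<delta>: "P = zspan \<gamma> \<delta>" "Im (cnj \<gamma> * \<delta>) \<noteq> 0"
  proof -
    obtain \<gamma> \<delta> where *: "M = zspan \<gamma> \<delta>" "Im (cnj \<gamma> * \<delta>) \<noteq> 0"
      using full_lattice_sub[OF full_lattice_\<A> M m] full_lattice_def by blast
    have "cnj (cnj w * \<gamma>) * (cnj w * \<delta>) = (w * cnj w) * (cnj \<gamma> * \<delta>)" by simp
    then have "cnj (cnj w * \<gamma>) * (cnj w * \<delta>) = cnj \<gamma> * \<delta>" unfolding w1 by (simp only: mult_1)
    then have "Im (cnj (cnj w * \<gamma>) * (cnj w * \<delta>)) \<noteq> 0" using *(2) by (simp only: not_False_eq_True)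
    then show ?thesis using that[of "cnj w * \<gamma>" "cnj w * \<delta>"] unfolding P_def *(1) image_mult_zspan by blast
  qed
  have \<gamma>P: "\<gamma> \<in> P" "\<delta> \<in> P" unfolding \<gamma>\<delta>(1) by (rule in_zspan)+
  define G1 where "G1 = {r. of_real r \<in> P}"
  define G2 where "G2 = Im ` P"
  have tr: "2 * Re z \<in> G1" if "z \<in> P" for z
    using add_subgroup_add[OF sP that cP[OF that]] by (simp add: G1_def complex_add_cnj)
  obtain p where p: "p > 0" "G1 = range (\<lambda>k::int. of_int k * p)"
  proof (rule real_discrete_subgroup[of G1 1])
    show "add_subgroup G1" using sP unfolding G1_def add_subgroup_def by simp
    show "1 \<le> \<bar>g\<bar>" if "g \<in> G1" "g \<noteq> 0" for g using nP[of "of_real g"] that by (simp add: G1_def)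
    have "Re \<gamma> \<noteq> 0 \<or> Re \<delta> \<noteq> 0" using \<gamma>\<delta>(2) by auto
    then show "(if Re \<gamma> \<noteq> 0 then 2 * Re \<gamma> else 2 * Re \<delta>) \<noteq> 0" by auto
    show "(if Re \<gamma> \<noteq> 0 then 2 * Re \<gamma> else 2 * Re \<delta>) \<in> G1" using tr \<gamma>P by auto
  qed auto
  obtain q where q: "q > 0" "G2 = range (\<lambda>k::int. of_int k * q)"
  proof (rule real_discrete_subgroup[of G2 "1 / 2"])
    show "add_subgroup G2" unfolding G2_def using sP by (rule add_subgroup_image) simp
    \<comment> \<open>The purely imaginary number z - cnj z = 2 i Im z lies in \<open>P\<close>,
      which costs a factor 2 in the gap.\<close>
    show "1 / 2 \<le> \<bar>g\<bar>" if g: "g \<in> G2" "g \<noteq> 0" for g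
    proof -
      obtain z where z: "z \<in> P" "g = Im z" using g(1) by (auto simp: G2_def)
      have "z - cnj z \<in> P" "z - cnj z \<noteq> 0"
        using add_subgroup_diff[OF sP z(1) cP[OF z(1)]] z(2) g(2) by (auto simp: complex_eq_iff)
      then have "1 \<le> norm (z - cnj z)" by (rule nP)
      then show ?thesis by (simp add: complex_diff_cnj z(2) norm_mult)
    qed
    have "Im \<gamma> \<noteq> 0 \<or> Im \<delta> \<noteq> 0" using \<gamma>\<delta>(2) by auto
    then show "(if Im \<gamma> \<noteq> 0 then Im \<gamma> else Im \<delta>) \<noteq> 0" by auto
    show "(if Im \<gamma> \<noteq> 0 then Im \<gamma> else Im \<delta>) \<in> G2" using \<gamma>P by (auto simp: G2_def)
  qed auto
  have "of_int 1 * q \<in> G2" unfolding q(2) by (rule rangeI)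
  then obtain z0 where z0: "z0 \<in> P" "Im z0 = q" by (auto simp: G2_def)
  have "of_int 1 * p \<in> G1" unfolding p(2) by (rule rangeI)
  then have pP: "of_real p \<in> P" by (simp add: G1_def)
  obtain k :: int where k: "2 * Re z0 = of_int k * p" using tr[OF z0(1)] unfolding p(2) by (rule rangeE)
  \<comment> \<open>Twice the real part of z0 is k periods; subtracting whole periods leaves only
    the parity of k.\<close>
  define t where "t = k mod 2"
  have "k mod 2 = 0 \<or> k mod 2 = 1" by presburger
  then have t: "t \<in> {0, 1}" by (simp add: t_def)
  define z1 where "z1 = z0 - of_int (k div 2) * of_real p"
  have z1P: "z1 \<in> P" unfolding z1_def using z0(1) pP sP by (intro add_subgroup_diff add_subgroup_int_mult)
  have "real_of_int k = 2 * of_int (k div 2) + of_int t"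
  proof -
    have "k = 2 * (k div 2) + t" unfolding t_def by (rule mult_div_mod_eq[symmetric])
    from arg_cong[OF this, of real_of_int] show ?thesis
      by (simp only: of_int_add of_int_mult of_int_numeral)
  qed
  then have "2 * Re z1 = of_int t * p" using k by (simp add: z1_def algebra_simps)
  then have z1: "z1 = of_real p * Complex (of_int t / 2) (q / p)"
    using z0(2) p(1) by (simp add: complex_eq_iff z1_def algebra_simps)
  have P_eq: "P = zspan (of_real p) z1"
  proof
    show "zspan (of_real p) z1 \<subseteq> P" by (rule zspan_subset[OF sP pP z1P])
    show "P \<subseteq> zspan (of_real p) z1"
    proof
      fix z assume z: "z \<in> P"
      then obtain n :: int where n: "Im z = of_int n * q" using q(2) by (auto simp: G2_def)
      have zz: "z - of_int n * z1 \<in> P" using z z1P sP by (intro add_subgroup_diff add_subgroup_int_mult)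
      have "Im (z - of_int n * z1) = 0" using n z0(2) by (simp add: z1_def)
      then have "z - of_int n * z1 = of_real (Re (z - of_int n * z1))" by (simp add: complex_eq_iff)
      then have "Re (z - of_int n * z1) \<in> G1" using zz by (simp add: G1_def)
      then obtain l :: int where "Re (z - of_int n * z1) = of_int l * p" using p(2) by blast
      then have "z = of_int l * of_real p + of_int n * z1"
        using \<open>z - of_int n * z1 = _\<close> by (simp add: algebra_simps)
      then show "z \<in> zspan (of_real p) z1" by (simp only: zspanI)
    qed
  qed
  define \<rho> where "\<rho> = w * of_real p"
  have M_eq: "M = zspan \<rho> (w * z1)" unfolding wP P_eq image_mult_zspan \<rho>_def ..
  have \<rho>M: "\<rho> \<in> M" "w * z1 \<in> M" unfolding M_eq by (rule in_zspan)+
  have n\<rho>: "norm \<rho> = p" using nw p(1) by (simp add: \<rho>_def norm_mult)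
  obtain \<alpha> :: int where \<alpha>: "p\<^sup>2 = of_int (a * \<alpha>)" using norm_\<A>[of \<rho>] \<rho>M(1) M'(2) n\<rho> by auto
  have "real_of_int (a * \<alpha>) > 0" unfolding \<alpha>[symmetric] using p(1) by simp
  then have \<alpha>0: "\<alpha> > 0" using a_pos by (metis of_int_0_less_iff zero_less_mult_pos)
  obtain \<beta> :: int where \<beta>: "(norm (w * z1))\<^sup>2 = of_int (a * \<beta>)" using norm_\<A>[of "w * z1"] \<rho>M(2) M'(2) by auto
  have "cnj \<rho> * (w * z1) = (w * cnj w) * (of_real p * z1)" by (simp add: \<rho>_def)
  then have "cnj \<rho> * (w * z1) = of_real p * z1" unfolding w1 by (simp only: mult_1)
  then have "Im (cnj \<rho> * (w * z1)) = Im (of_real p * z1)" by (rule arg_cong)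
  also have "\<dots> = p * q" using z0(2) by (simp add: z1_def)
  finally have "Im (cnj \<rho> * (w * z1)) = p * q" .
  \<comment> \<open>Comparing covolumes turns the index m into a value for the product of the two
    periods.\<close>
  moreover have "\<bar>Im (cnj \<rho> * (w * z1))\<bar> = m * \<bar>Im (cnj (of_int a) * \<tau>)\<bar>"
    using covolume_idx[of "of_int a" \<tau> \<rho> "w * z1"] M' m Im_\<tau> a_pos unfolding M_eq \<A>_eq by simp
  ultimately have pq: "p * q = m * (of_int a * Im \<tau>)" using p(1) q(1) Im_\<tau> a_pos by (simp add: abs_mult)
  have "of_int a * (q * of_int \<alpha>) = of_int (a * \<alpha>) * q" by simp
  also have "\<dots> = p * (p * q)" unfolding \<alpha>[symmetric] by (simp add: power2_eq_square)
  also have "\<dots> = of_int a * (m * Im \<tau> * p)" unfolding pq by simp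
  finally have "of_int a * (q * of_int \<alpha>) = of_int a * (m * Im \<tau> * p)" .
  then have q\<alpha>: "q * of_int \<alpha> = m * Im \<tau> * p" using a_pos by simp
  then have qp: "q / p = m * Im \<tau> / of_int \<alpha>" using p(1) \<alpha>0 by (simp add: field_simps)
  \<comment> \<open>The norm of the second generator is an integer multiple a \<beta> of a. Clearing
    denominators gives (4 a c - b^2) m^2 = \<alpha> (4 \<beta> - t^2 \<alpha>).\<close>
  have "\<alpha> dvd (4 * a * c - b\<^sup>2) * (int m)\<^sup>2"
  proof -
    have "(norm (w * z1))\<^sup>2 = (of_int t * p / 2)\<^sup>2 + q\<^sup>2"
      unfolding norm_mult nw using p(1) unfolding z1 by (simp add: cmod_power2 mult.commute)
    then have "4 * of_int (a * \<beta>) * of_int \<alpha> * of_int \<alpha> = (of_int t)\<^sup>2 * p\<^sup>2 * of_int \<alpha> * of_int \<alpha> + 4 * (q * of_int \<alpha>)\<^sup>2"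
      unfolding \<beta> by (simp add: power2_eq_square field_simps)
    also have "4 * (q * of_int \<alpha>)\<^sup>2 = (2 * Im \<tau>)\<^sup>2 * m\<^sup>2 * p\<^sup>2"
      unfolding q\<alpha> by (simp add: power2_eq_square)
    finally have "real_of_int (4 * (a * \<beta>) * \<alpha> * \<alpha>) = of_int (t\<^sup>2 * (a * \<alpha>) * \<alpha> * \<alpha> + (4 * a * c - b\<^sup>2) * (int m)\<^sup>2 * (a * \<alpha>))"
      unfolding discriminant_int \<alpha> by simp
    then have "4 * (a * \<beta>) * \<alpha> * \<alpha> = t\<^sup>2 * (a * \<alpha>) * \<alpha> * \<alpha> + (4 * a * c - b\<^sup>2) * (int m)\<^sup>2 * (a * \<alpha>)"
      using of_int_eq_iff by blast
    then have "(a * \<alpha>) * ((4 * a * c - b\<^sup>2) * (int m)\<^sup>2) = (a * \<alpha>) * (\<alpha> * (4 * \<beta> - t\<^sup>2 * \<alpha>))"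
      by (simp add: algebra_simps)
    then have "(4 * a * c - b\<^sup>2) * (int m)\<^sup>2 = \<alpha> * (4 * \<beta> - t\<^sup>2 * \<alpha>)" using a_pos \<alpha>0 by simp
    then show ?thesis by simp
  qed
  moreover have "M = zspan \<rho> (\<rho> * Complex (of_int t / 2) (m * Im \<tau> / of_int \<alpha>))"
    unfolding M_eq \<rho>_def z1 qp by (simp add: mult.assoc)
  ultimately show ?thesis using that[OF \<rho>M(1) \<alpha>0 _ t] n\<rho> \<alpha> by simp
qed

text \<open>Lattices with the same pair (t, \<alpha>) differ by the quotient of their generators
  \<rho>, which lies in \<K> and has absolute value 1. So each pair accounts for at most one
  rotation class, of weight 1/2, and the two values of t cancel this factor.\<close>

lemma ambiguous_weight_le:
  assumes m: "m > 0"
  shows "(\<Sum>M\<in>subs \<A> m. (of_bool (ambiguous M) / 2) / card (cls \<A> m M))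
    \<le> real (card {\<alpha>. \<alpha> dvd nat (4 * a * c - b\<^sup>2) * m\<^sup>2})"
proof -
  define N where "N = nat (4 * a * c - b\<^sup>2)"
  have N: "N > 0" "int N = 4 * a * c - b\<^sup>2" using discriminant_ge_3 by (auto simp: N_def)
  define D where "D = {\<alpha>. \<alpha> dvd N * m\<^sup>2}"
  have fD: "finite D" using N(1) m by (simp add: D_def)
  let ?X = "{M \<in> subs \<A> m. ambiguous M}"
  let ?T = "{0, 1 :: int} \<times> D"
  define S where "S M = (\<lambda>(t, \<alpha>). \<exists>\<rho>\<in>M. (norm \<rho>)\<^sup>2 = of_int a * real \<alpha> \<and>
     M = zspan \<rho> (\<rho> * Complex (of_int t / 2) (m * Im \<tau> / real \<alpha>)))" for M
  have ex: "\<exists>x\<in>?T. S M x" if M: "M \<in> ?X" for M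
  proof -
    obtain \<rho> and t \<alpha> :: int where *: "\<rho> \<in> M" "\<alpha> > 0" "(norm \<rho>)\<^sup>2 = of_int (a * \<alpha>)" "t \<in> {0, 1}"
      "\<alpha> dvd (4 * a * c - b\<^sup>2) * (int m)\<^sup>2"
      "M = zspan \<rho> (\<rho> * Complex (of_int t / 2) (m * Im \<tau> / of_int \<alpha>))"
    proof -
      have "M \<in> subs \<A> m" "ambiguous M" using M by simp_all
      from ambiguous_shape[OF this(1) m this(2)] show ?thesis using that by blast
    qed
    have "int (nat \<alpha>) dvd int (N * m\<^sup>2)" using * N(2) by simp
    then have "nat \<alpha> \<in> D" unfolding D_def by (simp only: of_nat_dvd_iff mem_Collect_eq)
    then have "(t, nat \<alpha>) \<in> ?T" using *(4) by blast
    moreover have "real (nat \<alpha>) = of_int \<alpha>" using *(2) by simp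
    then have "S M (t, nat \<alpha>)" unfolding S_def using *(1,3,6) by auto
    ultimately show ?thesis by blast
  qed
  define \<kappa> where "\<kappa> M = (SOME x. x \<in> ?T \<and> S M x)" for M
  have \<kappa>: "\<kappa> M \<in> ?T \<and> S M (\<kappa> M)" if "M \<in> ?X" for M
    unfolding \<kappa>_def using ex[OF that] by (intro someI_ex[of "\<lambda>x. x \<in> ?T \<and> S M x"]) blast
  have same: "M2 \<in> cls \<A> m M1" if M: "M1 \<in> ?X" "M2 \<in> ?X" and eq: "\<kappa> M1 = \<kappa> M2" for M1 M2
  proof -
    obtain t \<alpha> where x: "\<kappa> M1 = (t, \<alpha>)" by (cases "\<kappa> M1")
    have "S M1 (t, \<alpha>)" "S M2 (t, \<alpha>)" "\<alpha> \<in> D" using \<kappa> M eq x by fastforce+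
    then obtain \<rho>1 \<rho>2 where \<rho>: "\<rho>1 \<in> M1" "\<rho>2 \<in> M2" "(norm \<rho>1)\<^sup>2 = of_int a * real \<alpha>" "(norm \<rho>2)\<^sup>2 = of_int a * real \<alpha>"
      "M1 = zspan \<rho>1 (\<rho>1 * Complex (of_int t / 2) (m * Im \<tau> / real \<alpha>))"
      "M2 = zspan \<rho>2 (\<rho>2 * Complex (of_int t / 2) (m * Im \<tau> / real \<alpha>))" unfolding S_def by auto
    have "\<alpha> > 0" using \<open>\<alpha> \<in> D\<close> N(1) m by (auto simp: D_def intro!: Nat.gr0I)
    then have nz: "\<rho>1 \<noteq> 0" "\<rho>2 \<noteq> 0" using \<rho>(3,4) a_pos by auto
    have "norm \<rho>1 = norm \<rho>2" using \<rho>(3,4) by (metis norm_ge_zero power2_eq_imp_eq)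
    moreover have "\<rho>1 \<in> \<K>" "\<rho>2 \<in> \<K>" using \<rho>(1,2) M \<A>_subset_\<K> by (auto simp: subs_def)
    ultimately have "\<rho>2 / \<rho>1 \<in> rot" using nz by (simp add: rot_def \<K>_divide norm_divide)
    moreover have "(*) (\<rho>2 / \<rho>1) ` M1 = M2" unfolding \<rho>(5,6) image_mult_zspan using nz by simp
    ultimately show ?thesis using M unfolding cls_def by blast
  qed
  have fX: "finite ?X" using finite_subs[OF full_lattice_\<A> m] by simp
  have "(\<Sum>M\<in>subs \<A> m. (of_bool (ambiguous M) / 2) / card (cls \<A> m M)) = (\<Sum>M\<in>?X. 1 / 2 / card (cls \<A> m M))"
    using finite_subs[OF full_lattice_\<A> m] by (intro sum.mono_neutral_cong_right) auto
  also have "\<dots> = (\<Sum>x\<in>?T. \<Sum>M | M \<in> ?X \<and> \<kappa> M = x. 1 / 2 / card (cls \<A> m M))"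
  proof (rule sum.group[symmetric, OF fX])
    show "finite ?T" using fD by simp
    show "\<kappa> ` ?X \<subseteq> ?T" using \<kappa> by blast
  qed
  also have "\<dots> \<le> (\<Sum>x\<in>?T. 1 / 2)"
  proof (rule sum_mono)
    fix x
    show "(\<Sum>M | M \<in> ?X \<and> \<kappa> M = x. 1 / 2 / real (card (cls \<A> m M))) \<le> 1 / 2"
    proof (cases "\<exists>M0. M0 \<in> ?X \<and> \<kappa> M0 = x")
      case True
      then obtain M0 where M0: "M0 \<in> ?X" "\<kappa> M0 = x" by blast
      have "(\<Sum>M | M \<in> ?X \<and> \<kappa> M = x. 1 / 2 / real (card (cls \<A> m M))) \<le> (\<Sum>M\<in>cls \<A> m M0. 1 / 2 / real (card (cls \<A> m M)))"
        using same[OF M0(1)] M0(2) finite_cls[OF full_lattice_\<A> m] by (intro sum_mono2) auto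
      also have "\<dots> = 1 / 2" using M0(1) by (intro cls_weight[OF full_lattice_\<A> m]) simp
      finally show ?thesis .
    next
      case False
      then have "{M. M \<in> ?X \<and> \<kappa> M = x} = {}" by blast
      then show ?thesis by (simp only: sum.empty)
    qed
  qed
  also have "\<dots> = real (card D)" by (simp add: card_cartesian_product)
  finally show ?thesis by (simp add: D_def N_def)
qed

end

section \<open>Counting ideals\<close>

definition int_weight :: "real \<Rightarrow> int \<Rightarrow> real" where
  "int_weight x u = max 1 \<bar>of_int u\<bar> powr (- x)"

lemma sum_int_weight_le:
  assumes "x > 1"
  shows "(\<Sum>u\<in>{- int n..int n}. int_weight x u) \<le> 1 + 2 * (\<Sum>k. real (Suc k) powr (- x))"
proof -
  have s: "summable (\<lambda>k. real (Suc k) powr (- x))"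
    using dsummable_one[OF assms] by (simp add: dsummable_def)
  have "(\<Sum>u\<in>{- int n..int n}. int_weight x u) = 1 + 2 * (\<Sum>k<n. real (Suc k) powr (- x))"
  proof (induction n)
    case (Suc n)
    have "{- int (Suc n)..int (Suc n)} = insert (- int (Suc n)) (insert (int (Suc n)) {- int n..int n})" by auto
    then show ?case using Suc by (simp add: int_weight_def add.commute)
  qed (simp add: int_weight_def)
  also have "(\<Sum>k<n. real (Suc k) powr (- x)) \<le> (\<Sum>k. real (Suc k) powr (- x))"
    by (rule sum_le_suminf[OF s]) auto
  finally show ?thesis by simp
qed

text \<open>Cramer's rule bounds both coordinates by a multiple of the norm. Multiplying the two
  bounds gives a product form, so that a sum over the lattice is dominated by a product of two sums
  over the integers; \<open>max 1\<close> covers a vanishing coordinate.\<close>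

lemma lattice_norm_lower_bound:
  assumes "Im (cnj \<alpha> * \<beta>) \<noteq> 0"
  obtains \<kappa> where "\<kappa> > 0" "\<And>u v :: int. (u, v) \<noteq> (0, 0) \<Longrightarrow>
    \<kappa> * (max 1 \<bar>of_int u\<bar> * max 1 \<bar>of_int v\<bar>) \<le> (norm (of_int u * \<alpha> + of_int v * \<beta>))\<^sup>2"
proof -
  define \<delta> where "\<delta> = \<bar>Im (cnj \<alpha> * \<beta>)\<bar>"
  define s where "s = norm \<alpha> + norm \<beta>"
  have \<delta>: "\<delta> > 0" using assms by (simp add: \<delta>_def)
  have "\<alpha> \<noteq> 0" using assms by auto
  then have s: "s > 0" by (simp add: s_def add_pos_nonneg)
  show ?thesis
  proof (rule that[of "(\<delta> / s)\<^sup>2"])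
    show "(\<delta> / s)\<^sup>2 > 0" using \<delta> s by simp
    fix u v :: int assume uv: "(u, v) \<noteq> (0, 0)"
    define z where "z = of_int u * \<alpha> + of_int v * \<beta>"
    have "of_int v * Im (cnj \<alpha> * \<beta>) = Im (cnj \<alpha> * z)" "of_int u * Im (cnj \<alpha> * \<beta>) = - Im (cnj \<beta> * z)"
      by (simp_all add: z_def algebra_simps)
    then have "\<bar>of_int v\<bar> * \<delta> = \<bar>Im (cnj \<alpha> * z)\<bar>" "\<bar>of_int u\<bar> * \<delta> = \<bar>Im (cnj \<beta> * z)\<bar>"
      unfolding \<delta>_def by (metis abs_mult, metis abs_minus_cancel abs_mult)
    then have "\<bar>of_int v\<bar> * \<delta> \<le> norm \<alpha> * norm z" "\<bar>of_int u\<bar> * \<delta> \<le> norm \<beta> * norm z"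
      using abs_Im_le_cmod[of "cnj \<alpha> * z"] abs_Im_le_cmod[of "cnj \<beta> * z"] by (simp_all add: norm_mult)
    moreover have "norm \<alpha> * norm z \<le> s * norm z" "norm \<beta> * norm z \<le> s * norm z"
      by (simp_all add: s_def mult_right_mono)
    ultimately have "\<bar>of_int v\<bar> * \<delta> \<le> s * norm z" "\<bar>of_int u\<bar> * \<delta> \<le> s * norm z" by linarith+
    then have b: "\<bar>of_int v\<bar> * (\<delta> / s) \<le> norm z" "\<bar>of_int u\<bar> * (\<delta> / s) \<le> norm z"
      using s by (simp_all add: field_simps)
    have "max 1 \<bar>real_of_int u\<bar> \<le> max \<bar>of_int u\<bar> \<bar>of_int v\<bar>" "max 1 \<bar>real_of_int v\<bar> \<le> max \<bar>of_int u\<bar> \<bar>of_int v\<bar>"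
      using uv by (auto simp: max_def)
    moreover have "max \<bar>real_of_int u\<bar> \<bar>of_int v\<bar> * (\<delta> / s) \<le> norm z" using b by (simp add: max_def)
    moreover have "0 \<le> \<delta> / s" using \<delta> s by simp
    ultimately have "max 1 \<bar>of_int u\<bar> * (\<delta> / s) \<le> norm z" "max 1 \<bar>of_int v\<bar> * (\<delta> / s) \<le> norm z"
      by (meson mult_right_mono order_trans)+
    then have "(max 1 \<bar>of_int u\<bar> * (\<delta> / s)) * (max 1 \<bar>of_int v\<bar> * (\<delta> / s)) \<le> norm z * norm z"
      using \<delta> s by (intro mult_mono) auto
    then show "(\<delta> / s)\<^sup>2 * (max 1 \<bar>of_int u\<bar> * max 1 \<bar>of_int v\<bar>) \<le> (norm z)\<^sup>2"
      by (simp add: power2_eq_square mult_ac)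
  qed
qed

text \<open>Convergence of the Epstein zeta function for x > 1, as a uniform bound for finite
  partial sums.\<close>

lemma lattice_norm_sum_bounded:
  assumes L: "full_lattice L" and x: "x > 1"
  obtains B where "B \<ge> 0" "\<And>F. finite F \<Longrightarrow> F \<subseteq> L - {0} \<Longrightarrow> (\<Sum>z\<in>F. (norm z)\<^sup>2 powr (- x)) \<le> B"
proof -
  obtain \<alpha> \<beta> where L': "L = zspan \<alpha> \<beta>" "Im (cnj \<alpha> * \<beta>) \<noteq> 0" using L full_lattice_def by blast
  obtain \<kappa> where \<kappa>: "\<kappa> > 0" "\<And>u v :: int. (u, v) \<noteq> (0, 0) \<Longrightarrow>
    \<kappa> * (max 1 \<bar>of_int u\<bar> * max 1 \<bar>of_int v\<bar>) \<le> (norm (of_int u * \<alpha> + of_int v * \<beta>))\<^sup>2"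
    using lattice_norm_lower_bound[OF L'(2)] by blast
  define Z where "Z = 1 + 2 * (\<Sum>k. real (Suc k) powr (- x))"
  have w0: "int_weight x u \<ge> 0" for u by (simp add: int_weight_def)
  have term_le: "(norm (of_int u * \<alpha> + of_int v * \<beta>))\<^sup>2 powr (- x) \<le> \<kappa> powr (- x) * (int_weight x u * int_weight x v)"
    if "(u, v) \<noteq> (0, 0)" for u v :: int
  proof -
    have "(norm (of_int u * \<alpha> + of_int v * \<beta>))\<^sup>2 powr (- x) \<le> (\<kappa> * (max 1 \<bar>of_int u\<bar> * max 1 \<bar>of_int v\<bar>)) powr (- x)"
      using \<kappa>(1) \<kappa>(2)[OF that] x by (intro powr_mono2') (auto intro!: mult_pos_pos)
    also have "\<dots> = \<kappa> powr (- x) * (int_weight x u * int_weight x v)"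
      using \<kappa>(1) by (simp add: powr_mult int_weight_def)
    finally show ?thesis .
  qed
  show ?thesis
  proof (rule that[of "\<kappa> powr (- x) * (Z * Z)"])
    show "0 \<le> \<kappa> powr (- x) * (Z * Z)" by simp
    fix F assume F: "finite F" "F \<subseteq> L - {0}"
    define e where "e = (\<lambda>(u::int, v::int). of_int u * \<alpha> + of_int v * \<beta>)"
    have inj: "inj e" unfolding inj_def e_def using int_coords_unique[OF L'(2)] by auto
    have "F \<subseteq> range e"
      using F(2) unfolding L'(1) zspan_def e_def by (force simp: image_iff)
    then obtain T where T: "finite T" "F = e ` T" using F(1) finite_subset_image by (metis subset_UNIV)
    have T0: "(0, 0) \<notin> T" using F(2) T(2) by (auto simp: e_def)
    obtain n where n: "T \<subseteq> {- int n..int n} \<times> {- int n..int n}"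
    proof -
      have "finite ((\<lambda>(u, v). max \<bar>u\<bar> \<bar>v\<bar>) ` T)" using T(1) by simp
      then obtain M where M: "\<And>p. p \<in> T \<Longrightarrow> (\<lambda>(u, v). max \<bar>u\<bar> \<bar>v\<bar>) p \<le> M"
        by (meson finite_has_maximal2 imageI Max_ge)
      have "T \<subseteq> {- int (nat M)..int (nat M)} \<times> {- int (nat M)..int (nat M)}"
      proof
        fix p assume p: "p \<in> T"
        obtain u v where uv: "p = (u, v)" by (cases p)
        have "\<bar>u\<bar> \<le> M" "\<bar>v\<bar> \<le> M" using M[OF p] by (simp_all add: uv)
        then show "p \<in> {- int (nat M)..int (nat M)} \<times> {- int (nat M)..int (nat M)}" by (auto simp: uv abs_le_iff)
      qed
      then show ?thesis using that by blast
    qed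
    let ?B = "{- int n..int n}"
    have Z: "sum (int_weight x) ?B \<le> Z" unfolding Z_def by (rule sum_int_weight_le[OF x])
    have "(\<Sum>z\<in>F. (norm z)\<^sup>2 powr (- x)) = (\<Sum>p\<in>T. (norm (e p))\<^sup>2 powr (- x))"
      unfolding T(2) by (rule sum.reindex[unfolded o_def]) (rule inj_on_subset[OF inj], simp)
    also have "\<dots> \<le> (\<Sum>p\<in>T. \<kappa> powr (- x) * (int_weight x (fst p) * int_weight x (snd p)))"
    proof (rule sum_mono)
      fix p assume "p \<in> T"
      then show "(norm (e p))\<^sup>2 powr (- x) \<le> \<kappa> powr (- x) * (int_weight x (fst p) * int_weight x (snd p))"
        using term_le[of "fst p" "snd p"] T0 by (cases p) (auto simp: e_def)
    qed
    also have "\<dots> \<le> (\<Sum>p\<in>?B \<times> ?B. \<kappa> powr (- x) * (int_weight x (fst p) * int_weight x (snd p)))"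
      using n w0 by (intro sum_mono2) auto
    also have "\<dots> = \<kappa> powr (- x) * (sum (int_weight x) ?B * sum (int_weight x) ?B)"
    proof -
      have "(\<Sum>p\<in>B \<times> B. f (fst p) * f (snd p)) = sum f B * sum f B" for f :: "int \<Rightarrow> real" and B
        by (simp add: sum_product sum.cartesian_product case_prod_unfold)
      then show ?thesis unfolding sum_distrib_left[symmetric] by simp
    qed
    also have "\<dots> \<le> \<kappa> powr (- x) * (Z * Z)"
    proof -
      have "0 \<le> sum (int_weight x) ?B" using w0 by (rule sum_nonneg)
      then show ?thesis using Z by (intro mult_left_mono mult_mono) auto
    qed
    finally show "(\<Sum>z\<in>F. (norm z)\<^sup>2 powr (- x)) \<le> \<kappa> powr (- x) * (Z * Z)" .
  qed
qed

context quad_order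
begin

text \<open>A pigeonhole substitute for Minkowski's theorem: with s the integer part of sqrt e, the
  (s + 1)^2 points with coordinates from 0 to s outnumber the e cosets of \<open>J\<close>, and the
  difference of two points in one coset is short.\<close>

lemma small_element:
  assumes I: "I = zspan j1 j2" "Im (cnj j1 * j2) \<noteq> 0" and J: "J \<in> subs I e" and e: "e > 0"
  obtains \<alpha> where "\<alpha> \<in> J" "\<alpha> \<noteq> 0" "(norm \<alpha>)\<^sup>2 \<le> (norm j1 + norm j2)\<^sup>2 * e"
proof -
  define s where "s = nat \<lfloor>sqrt e\<rfloor>"
  have s: "real s \<le> sqrt e" "sqrt e < real s + 1" unfolding s_def by (simp_all add: floor_less_iff)
  have "real e = sqrt e * sqrt e" by simp
  also have "\<dots> < (real s + 1) * (real s + 1)" using s by (intro mult_strict_mono) auto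
  finally have "real e < real ((s + 1) * (s + 1))" by (simp add: algebra_simps)
  then have es: "e < (s + 1) * (s + 1)" by (simp only: of_nat_less_iff)
  have sJ: "add_subgroup J" "J \<subseteq> I" "idx I J = e" using J by (auto simp: subs_def)
  define g where "g = (\<lambda>(x::nat, y::nat). of_int (int x) * j1 + of_int (int y) * j2)"
  let ?B = "{0..s} \<times> {0..s}"
  have gI: "g p \<in> I" for p unfolding g_def I(1) by (cases p) (simp only: split zspanI)
  have "\<not> inj_on (\<lambda>p. (+) (g p) ` J) ?B"
  proof
    assume "inj_on (\<lambda>p. (+) (g p) ` J) ?B"
    then have "card ?B \<le> card ((\<lambda>x. (+) x ` J) ` I)"
      using idx_pos_imp_finite[of I J] sJ(3) e gI by (intro card_inj_on_le) auto
    then show False using es sJ(3) by (simp add: idx_def card_cartesian_product)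
  qed
  then obtain p p' where p: "p \<in> ?B" "p' \<in> ?B" "p \<noteq> p'" "(+) (g p) ` J = (+) (g p') ` J"
    unfolding inj_on_def by blast
  obtain x y x' y' where xy: "p = (x, y)" "p' = (x', y')" by (cases p; cases p')
  define \<alpha> where "\<alpha> = g p - g p'"
  have "\<alpha> \<in> J" unfolding \<alpha>_def using p(4) coset_eq_iff[OF sJ(1)] by blast
  have \<alpha>: "\<alpha> = of_int (int x - int x') * j1 + of_int (int y - int y') * j2"
    unfolding \<alpha>_def g_def xy by (simp add: algebra_simps)
  have "\<alpha> \<noteq> 0"
  proof
    assume "\<alpha> = 0"
    then have "g p = g p'" by (simp add: \<alpha>_def)
    then show False using int_coords_unique[OF I(2), of "int x" "int y" "int x'" "int y'"] p(3) by (simp add: g_def xy)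
  qed
  have "norm \<alpha> \<le> real s * norm j1 + real s * norm j2"
    unfolding \<alpha>
  proof (rule order_trans[OF norm_triangle_ineq], unfold norm_mult norm_of_int, intro add_mono mult_right_mono)
    show "\<bar>real_of_int (int x - int x')\<bar> \<le> real s" "\<bar>real_of_int (int y - int y')\<bar> \<le> real s"
      using p(1,2) by (auto simp: xy)
  qed auto
  also have "\<dots> = (norm j1 + norm j2) * real s" by (simp add: algebra_simps)
  also have "\<dots> \<le> (norm j1 + norm j2) * sqrt e" using s(1) by (intro mult_left_mono) auto
  finally have "(norm \<alpha>)\<^sup>2 \<le> ((norm j1 + norm j2) * sqrt e)\<^sup>2" by (intro power_mono) auto
  then show ?thesis using that[OF \<open>\<alpha> \<in> J\<close> \<open>\<alpha> \<noteq> 0\<close>] by (simp add: power_mult_distrib)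
qed

text \<open>Dividing an ideal by a short element gives an overmodule of \<open>\<O>\<close> of bounded index.\<close>

lemma bounded_overmodule:
  assumes J: "J = zspan \<gamma> \<delta>" "Im (cnj \<gamma> * \<delta>) \<noteq> 0" "omod J" and \<alpha>: "\<alpha> \<in> J" "\<alpha> \<noteq> 0"
    and bound: "Im \<tau> * (norm \<alpha>)\<^sup>2 \<le> n * \<bar>Im (cnj \<gamma> * \<delta>)\<bar>"
  shows "add_subgroup ((*) (inverse \<alpha>) ` J) \<and> \<O> \<subseteq> (*) (inverse \<alpha>) ` J \<and> (*) (of_nat (fact n)) ` (*) (inverse \<alpha>) ` J \<subseteq> \<O>"
proof -
  define X where "X = (*) (inverse \<alpha>) ` J"
  have sX: "add_subgroup X" unfolding X_def using omod_add_subgroup[OF J(3)] by (rule add_subgroup_mult_image)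
  have X: "X = zspan (inverse \<alpha> * \<gamma>) (inverse \<alpha> * \<delta>)" unfolding X_def J(1) image_mult_zspan ..
  define \<gamma>' \<delta>' where "\<gamma>' = inverse \<alpha> * \<gamma>" and "\<delta>' = inverse \<alpha> * \<delta>"
  have X': "X = zspan \<gamma>' \<delta>'" using X by (simp add: \<gamma>'_def \<delta>'_def)
  have OX: "\<O> \<subseteq> X"
  proof
    fix z assume "z \<in> \<O>"
    then have "z * \<alpha> \<in> J" using omod_mult[OF J(3)] \<alpha>(1) by blast
    then have "inverse \<alpha> * (z * \<alpha>) \<in> X" unfolding X_def by blast
    moreover have "inverse \<alpha> * (z * \<alpha>) = z" using \<alpha>(2) by (simp add: field_simps)
    ultimately show "z \<in> X" by simp
  qed
  have "1 \<in> X" "\<tau> \<in> X" using OX one_\<O> \<tau>_\<O> by auto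
  then obtain p q r t where c: "1 = of_int p * \<gamma>' + of_int q * \<delta>'" "\<tau> = of_int r * \<gamma>' + of_int t * \<delta>'"
    unfolding X' zspan_def by blast
  \<comment> \<open>k is the determinant expressing 1, \<tau> in the basis of \<open>X\<close>. The
    covolume bound gives |k| at most n, so k divides n factorial, and k \<open>X\<close> lies in
    \<O> by inverting the matrix.\<close>
  define k where "k = p * t - q * r"
  have "Im (cnj 1 * \<tau>) = of_int k * Im (cnj \<gamma>' * \<delta>')"
    using Im_cnj_mult_combination[of p \<gamma>' q \<delta>' r t] unfolding k_def c[symmetric] .
  then have k: "Im \<tau> = of_int k * Im (cnj \<gamma>' * \<delta>')" by simp
  have "cnj \<gamma>' * \<delta>' = (cnj \<gamma> * \<delta>) / (\<alpha> * cnj \<alpha>)" unfolding \<gamma>'_def \<delta>'_def by (simp add: field_simps)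
  also have "\<alpha> * cnj \<alpha> = of_real ((norm \<alpha>)\<^sup>2)" by (rule complex_norm_square[symmetric])
  finally have "Im (cnj \<gamma>' * \<delta>') = Im (cnj \<gamma> * \<delta>) / (norm \<alpha>)\<^sup>2" by (simp only: Im_divide_of_real)
  then have "Im \<tau> * (norm \<alpha>)\<^sup>2 = of_int k * Im (cnj \<gamma> * \<delta>)" using k \<alpha>(2) by simp
  then have "\<bar>of_int k\<bar> * \<bar>Im (cnj \<gamma> * \<delta>)\<bar> \<le> n * \<bar>Im (cnj \<gamma> * \<delta>)\<bar>"
    using bound Im_\<tau> by (metis abs_mult abs_of_nonneg mult_nonneg_nonneg zero_le_power2 less_imp_le)
  then have "\<bar>real_of_int k\<bar> \<le> n" using J(2) by simp
  then have kn: "nat \<bar>k\<bar> \<le> n" by linarith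
  have "k \<noteq> 0" using k Im_\<tau> by auto
  then have "nat \<bar>k\<bar> dvd fact n" using kn by (intro dvd_fact) auto
  then have "k dvd int (fact n)" by (metis abs_dvd_iff int_nat_eq abs_ge_zero of_nat_dvd_iff)
  then obtain l where l: "int (fact n) = k * l" by blast
  have "of_int k * \<gamma>' = of_int t * 1 - of_int q * \<tau>" "of_int k * \<delta>' = of_int p * \<tau> - of_int r * 1"
    unfolding k_def by (subst c(1), subst c(2), simp add: algebra_simps)+
  moreover have "of_int t * 1 - of_int q * \<tau> \<in> \<O>" "of_int p * \<tau> - of_int r * 1 \<in> \<O>"
    by (intro add_subgroup_diff add_subgroup_int_mult omod_add_subgroup[OF omod_\<O>] one_\<O> \<tau>_\<O>)+
  ultimately have kO: "of_int k * \<gamma>' \<in> \<O>" "of_int k * \<delta>' \<in> \<O>" by auto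
  have "(*) (of_nat (fact n)) ` X \<subseteq> \<O>"
  proof
    fix z assume "z \<in> (*) (of_nat (fact n)) ` X"
    then obtain u v where "z = of_int (int (fact n)) * (of_int u * \<gamma>' + of_int v * \<delta>')"
      unfolding X' zspan_def by auto
    then have "z = of_int (l * u) * (of_int k * \<gamma>') + of_int (l * v) * (of_int k * \<delta>')"
      unfolding l by (simp add: algebra_simps)
    also have "\<dots> \<in> \<O>"
      by (rule add_subgroup_add[OF omod_add_subgroup[OF omod_\<O>] add_subgroup_int_mult[OF omod_add_subgroup[OF omod_\<O>] kO(1)]
            add_subgroup_int_mult[OF omod_add_subgroup[OF omod_\<O>] kO(2)]])
    finally show "z \<in> \<O>" .
  qed
  then show ?thesis using sX OX unfolding X_def by blast
qed

text \<open>n times such a lattice lies between n \<O> and \<O>, so its index in \<O> divides n^2,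
  and there are finitely many sublattices of each index.\<close>

lemma finite_overmodules:
  assumes n: "n > 0"
  shows "finite {X. add_subgroup X \<and> \<O> \<subseteq> X \<and> (*) (of_nat n) ` X \<subseteq> \<O>}" (is "finite ?F")
proof (rule finite_imageD)
  have sO: "add_subgroup \<O>" by (rule omod_add_subgroup[OF omod_\<O>])
  show "inj_on ((`) ((*) (of_nat n))) ?F"
    using n by (intro inj_onI) (simp add: mult_image_cancel)
  show "finite ((`) ((*) (of_nat n)) ` ?F)"
  proof (rule finite_subset)
    show "(`) ((*) (of_nat n)) ` ?F \<subseteq> (\<Union>d\<in>{1..n\<^sup>2}. subs \<O> d)"
    proof clarify
      fix X assume X: "add_subgroup X" "\<O> \<subseteq> X" "(*) (of_nat n) ` X \<subseteq> \<O>"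
      let ?Y = "(*) (of_nat n) ` X"
      have "n\<^sup>2 = idx \<O> ((*) (of_nat n) ` \<O>)" using idx_of_nat_mult[OF full_lattice_\<O> n] by simp
      also have "\<dots> = idx \<O> ?Y * idx ?Y ((*) (of_nat n) ` \<O>)"
        using X sO by (intro idx_tower) (auto intro: add_subgroup_mult_image)
      finally have "idx \<O> ?Y dvd n\<^sup>2" by simp
      then have "idx \<O> ?Y \<in> {1..n\<^sup>2}" using n by (auto intro: dvd_imp_le dest: dvd_pos_nat intro!: Suc_leI)
      then show "?Y \<in> (\<Union>d\<in>{1..n\<^sup>2}. subs \<O> d)" using X by (auto simp: subs_def add_subgroup_mult_image)
    qed
    show "finite (\<Union>d\<in>{1..n\<^sup>2}. subs \<O> d)" using finite_subs[OF full_lattice_\<O>] by auto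
  qed
qed

text \<open>An ideal \<open>J\<close> is recovered from a short element \<alpha> and the overmodule
  \<open>J\<close> / \<alpha>, which is one of finitely many. Since |\<alpha>|^2 is at most a
  constant times the index, the sum of index^(-x) is bounded by a multiple of the sum of |z|^(-2x)
  over the lattice.\<close>

lemma dsummable_card_ideals:
  assumes I: "full_lattice I" and x: "x > 1"
  shows "dsummable (\<lambda>e. real (card (ideals I e))) x"
proof -
  obtain j1 j2 where j: "I = zspan j1 j2" "Im (cnj j1 * j2) \<noteq> 0" using I full_lattice_def by blast
  define \<delta> where "\<delta> = \<bar>Im (cnj j1 * j2)\<bar>"
  define C where "C = (norm j1 + norm j2)\<^sup>2"
  have "j1 \<noteq> 0" using j by auto
  then have "norm j1 + norm j2 > 0" by (simp add: add_pos_nonneg)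
  then have C: "C > 0" by (simp add: C_def)
  have \<delta>: "\<delta> > 0" using j by (simp add: \<delta>_def)
  \<comment> \<open>Chosen so that Im \<tau> |\<alpha>|^2 is at most n times the covolume e \<delta>
    of an ideal of index e, as \<open>bounded_overmodule\<close> asks.\<close>
  define n where "n = nat \<lceil>Im \<tau> * C / \<delta>\<rceil>"
  have n: "Im \<tau> * C \<le> n * \<delta>"
  proof -
    have "Im \<tau> * C / \<delta> \<le> n" unfolding n_def by linarith
    then show ?thesis using \<delta> by (simp add: field_simps)
  qed
  define Fin where "Fin = {X. add_subgroup X \<and> \<O> \<subseteq> X \<and> (*) (of_nat (fact n)) ` X \<subseteq> \<O>}"
  have fFin: "finite Fin" unfolding Fin_def by (rule finite_overmodules) simp
  obtain B where B: "B \<ge> 0" "\<And>F. finite F \<Longrightarrow> F \<subseteq> I - {0} \<Longrightarrow> (\<Sum>z\<in>F. (norm z)\<^sup>2 powr (- x)) \<le> B"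
    using lattice_norm_sum_bounded[OF I x] by blast
  have ex: "\<exists>\<alpha>\<in>J. \<alpha> \<noteq> 0 \<and> (norm \<alpha>)\<^sup>2 \<le> C * e \<and> (*) (inverse \<alpha>) ` J \<in> Fin"
    if J: "J \<in> ideals I e" and e: "e > 0" for J e
  proof -
    have J': "J \<in> subs I e" "omod J" using J by (auto simp: ideals_def)
    obtain \<alpha> where \<alpha>: "\<alpha> \<in> J" "\<alpha> \<noteq> 0" "(norm \<alpha>)\<^sup>2 \<le> C * e"
      using small_element[OF j J'(1) e] unfolding C_def by blast
    have s: "add_subgroup J" "J \<subseteq> zspan j1 j2" "idx (zspan j1 j2) J = e" using J'(1) by (auto simp: subs_def j)
    obtain \<gamma>' \<delta>' where b: "J = zspan \<gamma>' \<delta>'" "\<bar>Im (cnj \<gamma>' * \<delta>')\<bar> = e * \<delta>"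
      using add_subgroup_basis[OF j(2) s(1,2)] s(3) e unfolding \<delta>_def by metis
    have "Im \<tau> * (norm \<alpha>)\<^sup>2 \<le> Im \<tau> * (C * e)" using \<alpha>(3) Im_\<tau> by simp
    also have "\<dots> = (Im \<tau> * C) * e" by simp
    also have "\<dots> \<le> n * \<delta> * e" using n by (rule mult_right_mono) simp
    finally have "Im \<tau> * (norm \<alpha>)\<^sup>2 \<le> n * \<bar>Im (cnj \<gamma>' * \<delta>')\<bar>" unfolding b(2) by (simp add: mult_ac)
    moreover have "Im (cnj \<gamma>' * \<delta>') \<noteq> 0" using b(2) \<delta> e by auto
    ultimately have "(*) (inverse \<alpha>) ` J \<in> Fin"
      unfolding Fin_def using bounded_overmodule[OF b(1) _ J'(2) \<alpha>(1,2)] by blast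
    then show ?thesis using \<alpha> by blast
  qed
  define \<alpha> where "\<alpha> J = (SOME \<alpha>. \<alpha> \<in> J \<and> \<alpha> \<noteq> 0 \<and> (norm \<alpha>)\<^sup>2 \<le> C * idx I J \<and> (*) (inverse \<alpha>) ` J \<in> Fin)" for J
  have \<alpha>: "\<alpha> J \<in> J \<and> \<alpha> J \<noteq> 0 \<and> (norm (\<alpha> J))\<^sup>2 \<le> C * idx I J \<and> (*) (inverse (\<alpha> J)) ` J \<in> Fin"
    if "J \<in> ideals I e" "e > 0" for J e
  proof -
    have "idx I J = e" using that by (simp add: ideals_def subs_def)
    then show ?thesis unfolding \<alpha>_def using ex[OF that]
      by (intro someI_ex[of "\<lambda>\<alpha>. \<alpha> \<in> J \<and> \<alpha> \<noteq> 0 \<and> (norm \<alpha>)\<^sup>2 \<le> C * idx I J \<and> (*) (inverse \<alpha>) ` J \<in> Fin"]) auto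
  qed
  show ?thesis
  proof (rule bounded_imp_dsummable)
    fix N
    define Js where "Js = (\<Union>k<N. ideals I (Suc k))"
    have fids: "finite (ideals I (Suc k))" for k
      using finite_subs[OF I, of "Suc k"] by (simp add: ideals_def)
    have fJs: "finite Js" unfolding Js_def using fids by simp
    define h where "h J = (\<alpha> J, (*) (inverse (\<alpha> J)) ` J)" for J
    have \<alpha>': "\<alpha> J \<in> J \<and> \<alpha> J \<noteq> 0 \<and> (norm (\<alpha> J))\<^sup>2 \<le> C * idx I J \<and> (*) (inverse (\<alpha> J)) ` J \<in> Fin \<and> J \<subseteq> I"
      if J: "J \<in> Js" for J
    proof -
      obtain k where "J \<in> ideals I (Suc k)" using J unfolding Js_def by blast
      then show ?thesis using \<alpha>[of J "Suc k"] by (auto simp: ideals_def subs_def)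
    qed
    have inj: "inj_on h Js"
    proof (rule inj_onI)
      fix J1 J2 assume J: "J1 \<in> Js" "J2 \<in> Js" and "h J1 = h J2"
      then have "\<alpha> J1 = \<alpha> J2" "(*) (inverse (\<alpha> J1)) ` J1 = (*) (inverse (\<alpha> J1)) ` J2"
        unfolding h_def prod.inject by metis+
      moreover have "inverse (\<alpha> J1) \<noteq> 0" using \<alpha>'[OF J(1)] by simp
      ultimately show "J1 = J2" by (simp add: mult_image_cancel)
    qed
    have hsub: "h ` Js \<subseteq> \<alpha> ` Js \<times> Fin" using \<alpha>' by (auto simp: h_def)
    have "(\<Sum>k<N. real (card (ideals I (Suc k))) * real (Suc k) powr (- x)) = (\<Sum>k<N. \<Sum>J\<in>ideals I (Suc k). real (idx I J) powr (- x))"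
      by (intro sum.cong refl) (simp add: ideals_def subs_def)
    also have "\<dots> = (\<Sum>J\<in>Js. real (idx I J) powr (- x))"
      unfolding Js_def using fids by (intro sum.UNION_disjoint[symmetric]) (auto simp: ideals_def subs_def)
    also have "\<dots> \<le> (\<Sum>J\<in>Js. C powr x * (norm (\<alpha> J))\<^sup>2 powr (- x))"
    proof (rule sum_mono)
      fix J assume "J \<in> Js"
      note a = \<alpha>'[OF this]
      then have "(norm (\<alpha> J))\<^sup>2 / C \<le> idx I J" using C by (simp add: field_simps)
      then have "real (idx I J) powr (- x) \<le> ((norm (\<alpha> J))\<^sup>2 / C) powr (- x)"
        using a C x by (intro powr_mono2') auto
      also have "\<dots> = C powr x * (norm (\<alpha> J))\<^sup>2 powr (- x)"
        using C by (subst powr_divide) (simp_all add: powr_minus divide_inverse mult.commute)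
      finally show "real (idx I J) powr (- x) \<le> C powr x * (norm (\<alpha> J))\<^sup>2 powr (- x)" .
    qed
    also have "\<dots> = (\<Sum>p\<in>h ` Js. C powr x * (norm (fst p))\<^sup>2 powr (- x))"
      by (subst sum.reindex[OF inj]) (simp add: h_def)
    also have "\<dots> \<le> (\<Sum>p\<in>\<alpha> ` Js \<times> Fin. C powr x * (norm (fst p))\<^sup>2 powr (- x))"
      using hsub fJs fFin by (intro sum_mono2) auto
    also have "\<dots> = C powr x * real (card Fin) * (\<Sum>z\<in>\<alpha> ` Js. (norm z)\<^sup>2 powr (- x))"
    proof -
      have *: "(\<Sum>p\<in>A \<times> Fin. f (fst p)) = (\<Sum>z\<in>A. \<Sum>X\<in>Fin. f z)" for f :: "complex \<Rightarrow> real" and A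
        unfolding sum.cartesian_product by (simp add: case_prod_unfold)
      show ?thesis
        unfolding *[of "\<lambda>z. C powr x * (norm z)\<^sup>2 powr (- x)"] by (simp add: sum_distrib_left mult_ac)
    qed
    also have "\<dots> \<le> C powr x * real (card Fin) * B"
      using fJs \<alpha>' by (intro mult_left_mono B(2)) auto
    finally show "(\<Sum>k<N. real (card (ideals I (Suc k))) * real (Suc k) powr (- x)) \<le> C powr x * real (card Fin) * B" .
  qed simp
qed

end

section \<open>The zeta functions of an ideal\<close>

context quad_order
begin

lemma subs_1: "add_subgroup A \<Longrightarrow> subs A 1 = {A}"
proof (intro subset_antisym subsetI)
  assume A: "add_subgroup A"
  fix M assume "M \<in> subs A 1"
  then have "add_subgroup M" "M \<subseteq> A" "idx A M = 1" by (simp_all add: subs_def)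
  then show "M \<in> {A}" using idx_eq_1D[OF _ A] by blast
qed (simp add: subs_def idx_self)

lemma ideals_1: "omod A \<Longrightarrow> ideals A 1 = {A}"
  using subs_1[OF omod_add_subgroup, of A] by (auto simp: ideals_def)

text \<open>Common source of both zeta functions: \<kappa> is 1 for proper classes, and 1 or 1/2 for
  orthogonal classes, with h absorbing the ambiguous ones. The bounds on \<kappa> give positivity at
  1 and domination by the number of ideals.\<close>

lemma weighted_classes_dirichlet_series:
  fixes \<kappa> :: "complex set \<Rightarrow> real" and coeff :: "nat \<Rightarrow> nat"
  assumes \<kappa>: "\<And>J. 0 < \<kappa> J" "\<And>J. \<kappa> J \<le> 1"
    and h: "\<And>x. x > 1 \<Longrightarrow> dsummable h x"
    and coeff: "\<And>m. m > 0 \<Longrightarrow> real (coeff m) = (\<Sum>M\<in>subs \<A> m. \<kappa> (gen M) / card (cls \<A> m M)) + h m"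
  shows "(\<exists>F. meromorphic_continuation coeff {s. 1 < Re s} F \<and> simple_pole F 2) \<and> abscissa_of_convergence coeff = 2"
proof (rule dirichlet_series_simple_pole)
  let ?\<gamma> = "\<lambda>e. \<Sum>J\<in>ideals \<A> e. \<kappa> J / card (cls \<A> e J)"
  show "real (card \<U>) / 2 > 0" using finite_\<U> \<U>_1 by (auto simp: card_gt_0_iff)
  show \<gamma>0: "?\<gamma> n \<ge> 0" for n using \<kappa>(1) by (intro sum_nonneg) (simp add: less_imp_le)
  have "card (cls \<A> 1 \<A>) > 0"
    using subs_1[OF omod_add_subgroup[OF omod_\<A>]] by (intro card_cls_pos full_lattice_\<A>) simp_all
  then show "?\<gamma> 1 > 0" using \<kappa>(1) unfolding ideals_1[OF omod_\<A>] by simp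
  show "dsummable ?\<gamma> x" if x: "x > 1" for x
  proof (rule dsummable_mono[OF dsummable_card_ideals[OF full_lattice_\<A> x]])
    fix n :: nat assume n: "n > 0"
    have "?\<gamma> n \<le> (\<Sum>J\<in>ideals \<A> n. 1)"
    proof (rule sum_mono)
      fix J assume "J \<in> ideals \<A> n"
      then have "card (cls \<A> n J) > 0" using n by (intro card_cls_pos full_lattice_\<A>) (auto simp: ideals_def)
      then have "real (card (cls \<A> n J)) \<ge> 1" by linarith
      then show "\<kappa> J / card (cls \<A> n J) \<le> 1" using \<kappa>[of J] by (simp add: field_simps)
    qed
    then show "\<bar>?\<gamma> n\<bar> \<le> \<bar>real (card (ideals \<A> n))\<bar>" using \<gamma>0[of n] by simp
  qed simp
  show "real (card (ideals \<O> n)) \<ge> 0" "real (card (over \<O> n)) \<ge> 0" for n by simp_all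
  show "real (card (ideals \<O> 1)) = 1" unfolding ideals_1[OF omod_\<O>] by simp
  show "dsummable (\<lambda>n. real (card (ideals \<O> n))) x" if "x > 1" for x
    using dsummable_card_ideals[OF full_lattice_\<O> that] .
  show "dconv (\<lambda>n. real (card (ideals \<O> n))) (\<lambda>n. real (card (over \<O> n))) n = real (\<Sum>{d. d dvd n})" if "n > 0" for n
    using sigma_convolution[OF that] .
  show "dsummable h x" if "x > 1" for x using h[OF that] .
  show "real (coeff n) = dconv ?\<gamma> (\<lambda>f. if f = 1 then 1 else real (card (over \<O> f)) / (real (card \<U>) / 2)) n + h n"
    if "n > 0" for n
    using coeff[OF that] class_weight_sum[OF full_lattice_\<A> omod_\<A> \<A>_subset_\<K> that, of \<kappa>] by simp
qed

lemma rot_classes_dirichlet_series: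
  fixes coeff :: "nat \<Rightarrow> nat"
  assumes "\<And>m. m > 0 \<Longrightarrow> coeff m = card (subs \<A> m // rot_rel \<A> m)"
  shows "(\<exists>F. meromorphic_continuation coeff {s. 1 < Re s} F \<and> simple_pole F 2) \<and> abscissa_of_convergence coeff = 2"
proof (rule weighted_classes_dirichlet_series[where \<kappa> = "\<lambda>_. 1" and h = "\<lambda>_. 0"])
  show "dsummable (\<lambda>_. 0) x" for x by (simp add: dsummable_def)
  show "real (coeff m) = (\<Sum>M\<in>subs \<A> m. 1 / card (cls \<A> m M)) + 0" if "m > 0" for m
    using assms[OF that] card_rot_classes[OF full_lattice_\<A> that] by simp
qed simp_all

lemma orth_classes_dirichlet_series:
  fixes coeff :: "nat \<Rightarrow> nat"
  assumes coeff: "\<And>m. m > 0 \<Longrightarrow> coeff m = card (subs \<A> m // orth_rel \<A> m)"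
  shows "(\<exists>F. meromorphic_continuation coeff {s. 1 < Re s} F \<and> simple_pole F 2) \<and> abscissa_of_convergence coeff = 2"
proof (rule weighted_classes_dirichlet_series)
  define h where "h m = (\<Sum>M\<in>subs \<A> m. (of_bool (ambiguous M) / 2) / card (cls \<A> m M))" for m
  show "0 < 1 - of_bool (embeds_cnj \<A> J) / (2 :: real)" "1 - of_bool (embeds_cnj \<A> J) / 2 \<le> (1 :: real)" for J
    by simp_all
  define N where "N = nat (4 * a * c - b\<^sup>2)"
  have N: "N > 0" using discriminant_ge_3 by (simp add: N_def)
  show "dsummable h x" if x: "x > 1" for x
  proof (rule dsummable_mono)
    show "dsummable (\<lambda>m. real (card {d. d dvd N}) * dconv (dconv (\<lambda>_. 1) (\<lambda>_. 1)) (\<lambda>_. 1) m) x"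
      by (intro dsummable_cmult dsummable_dconv dsummable_one x)
    fix m :: nat assume m: "m > 0"
    have "0 \<le> h m" unfolding h_def by (intro sum_nonneg) simp
    moreover have "h m \<le> real (card {d. d dvd N}) * dconv (dconv (\<lambda>_. 1) (\<lambda>_. 1)) (\<lambda>_. 1) m"
      using ambiguous_weight_le[OF m] card_divisors_mult_square[OF N m] unfolding h_def N_def by linarith
    ultimately show "\<bar>h m\<bar> \<le> \<bar>real (card {d. d dvd N}) * dconv (dconv (\<lambda>_. 1) (\<lambda>_. 1)) (\<lambda>_. 1) m\<bar>"
      by linarith
  qed simp
  fix m :: nat assume m: "m > 0"
  have "real (coeff m) = (\<Sum>M\<in>subs \<A> m. (1 - of_bool (embeds_cnj \<A> M) / 2 + of_bool (ambiguous M) / 2) / card (cls \<A> m M))"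
    using coeff[OF m] card_orth_classes[OF full_lattice_\<A> m] by simp
  also have "\<dots> = (\<Sum>M\<in>subs \<A> m. (1 - of_bool (embeds_cnj \<A> M) / 2) / card (cls \<A> m M)) + h m"
    unfolding h_def sum.distrib[symmetric] add_divide_distrib ..
  also have "(\<Sum>M\<in>subs \<A> m. (1 - of_bool (embeds_cnj \<A> M) / 2) / card (cls \<A> m M)) =
      (\<Sum>M\<in>subs \<A> m. (1 - of_bool (embeds_cnj \<A> (gen M)) / 2) / card (cls \<A> m M))"
    by (rule sum.cong[OF refl]) (simp only: embeds_cnj_gen[OF omod_\<A> _ m])
  finally show "real (coeff m) = (\<Sum>M\<in>subs \<A> m. (1 - of_bool (embeds_cnj \<A> (gen M)) / 2) / card (cls \<A> m M)) + h m" .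
qed

end

section \<open>The maximal order from the field discriminant\<close>

lemma algebraic_int_quadratic:
  fixes z :: complex
  assumes "z * z = of_int t * z - of_int n"
  shows "algebraic_int z"
proof (rule algebraic_int.intros)
  let ?p = "[:of_int n, - of_int t, 1:] :: complex poly"
  show "lead_coeff ?p = 1" by simp
  show "\<forall>i. coeff ?p i \<in> \<int>" by (auto simp: coeff_pCons split: nat.splits)
  show "poly ?p z = 0" using assms by (simp add: algebra_simps)
qed

lemma of_rat_eq_of_real_of_rat: "(of_rat r :: complex) = of_real (of_rat r)"
  by (cases r) (simp add: of_rat_rat)

text \<open>The order with basis \<open>1, \<tau>\<close> has the discriminant of the field, hence it is the maximal order.\<close>

lemma maximal_order:
  fixes a b c :: int
  assumes pos: "4 * a * c - b\<^sup>2 > 0"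
    and \<tau>: "\<tau> = Complex (of_int b / 2) (sqrt (of_int (4 * a * c - b\<^sup>2)) / 2)"
    and disc: "imag_quadratic_discriminant (of_int (b\<^sup>2 - 4 * a * c))"
    and z: "z = x + y * \<tau>" "x \<in> \<rat>" "y \<in> \<rat>" "z * z = of_int t * z - of_int n"
  shows "z \<in> zspan 1 \<tau>"
proof -
  obtain K l w1 w2 where l: "l < 0" and K: "K = {of_rat a + of_rat b * csqrt (of_int l) | a b. True}"
    and bij: "bij_betw (\<lambda>(a::int, b::int). of_int a * w1 + of_int b * w2) UNIV (ring_of_integers K)"
    and D: "of_rat (of_int (b\<^sup>2 - 4 * a * c)) = (w1 * cnj w2 - w2 * cnj w1)\<^sup>2"
    using disc unfolding imag_quadratic_discriminant_def imag_quadratic_field_def field_discriminant_def integral_basis_def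
    by auto
  define \<sigma> where "\<sigma> = sqrt (- of_int l)"
  have \<sigma>: "\<sigma> > 0" using l by (simp add: \<sigma>_def)
  have "csqrt (of_int l) = csqrt (of_real (of_int l))" by simp
  also have "\<dots> = \<i> * of_real \<sigma>" using l unfolding \<sigma>_def by (subst csqrt_of_real') (auto simp: complex_eq_iff)
  finally have K': "K = {of_rat a + of_rat b * (\<i> * of_real \<sigma>) | a b. True}" unfolding K by simp
  have mem: "of_int p * w1 + of_int q * w2 \<in> ring_of_integers K" for p q
    using bij_betwE[OF bij] by fastforce
  have ring: "ring_of_integers K \<subseteq> zspan w1 w2"
  proof
    fix s assume "s \<in> ring_of_integers K"
    then have "s \<in> range (\<lambda>(a, b). of_int a * w1 + of_int b * w2)"
      using bij_betw_imp_surj_on[OF bij] by simp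
    then show "s \<in> zspan w1 w2" by (auto intro: zspanI)
  qed
  have "w1 \<in> K" "w2 \<in> K" using mem[of 1 0] mem[of 0 1] by (simp_all add: ring_of_integers_def)
  then obtain x1 y1 x2 y2 where w: "w1 = of_rat x1 + of_rat y1 * (\<i> * of_real \<sigma>)"
    "w2 = of_rat x2 + of_rat y2 * (\<i> * of_real \<sigma>)" unfolding K' by blast
  define \<Delta> where "\<Delta> = real_of_int (4 * a * c - b\<^sup>2)"
  have \<Delta>: "\<Delta> > 0" unfolding \<Delta>_def of_int_0_less_iff by (rule pos)
  define I where "I = Im (cnj w1 * w2)"
  have "w1 * cnj w2 - w2 * cnj w1 = of_real (- 2 * I) * \<i>"
    unfolding I_def by (simp add: complex_eq_iff algebra_simps)
  then have e1: "(w1 * cnj w2 - w2 * cnj w1)\<^sup>2 = of_real (- 4 * I\<^sup>2)"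
    by (simp add: power_mult_distrib)
  have e2: "of_rat (of_int (b\<^sup>2 - 4 * a * c)) = complex_of_real (- \<Delta>)"
    unfolding \<Delta>_def of_rat_of_int_eq by simp
  have "complex_of_real (- \<Delta>) = of_real (- 4 * I\<^sup>2)" using D unfolding e1 e2 .
  then have "- \<Delta> = - 4 * I\<^sup>2" by (simp only: of_real_eq_iff)
  then have Dw: "\<Delta> = 4 * I\<^sup>2" by simp
  define d where "d = x1 * y2 - y1 * x2"
  define r where "r = \<bar>d\<bar>"
  have I: "I = of_rat d * \<sigma>"
    unfolding I_def d_def w of_rat_eq_of_real_of_rat by (simp add: of_rat_diff of_rat_mult algebra_simps)
  have "(of_rat r :: real)\<^sup>2 = (of_rat d)\<^sup>2" unfolding r_def by (simp add: abs_if of_rat_minus)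
  then have "\<Delta> = (2 * of_rat r * \<sigma>)\<^sup>2"
    unfolding Dw I by (simp add: power_mult_distrib)
  moreover have "2 * of_rat r * \<sigma> \<ge> 0" using \<sigma> by (simp add: r_def)
  \<comment> \<open>r is rational, so sqrt \<Delta> is a rational multiple of \<sigma> and \<tau>
    lies in the given field.\<close>
  ultimately have sq: "sqrt \<Delta> = 2 * of_rat r * \<sigma>" by (simp add: real_sqrt_unique)
  have \<tau>K: "\<tau> = of_rat (of_int b / 2) + of_rat r * (\<i> * of_real \<sigma>)"
    unfolding \<tau> \<Delta>_def[symmetric] sq of_rat_eq_of_real_of_rat by (simp add: complex_eq_iff of_rat_divide)
  have Im\<tau>: "4 * (Im \<tau>)\<^sup>2 = \<Delta>" using \<Delta> unfolding \<tau> \<Delta>_def by (simp add: power_divide)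
  have "\<tau> * \<tau> = of_int b * \<tau> - of_int (a * c)"
  proof -
    have re: "real_of_int b = 2 * Re \<tau>" by (simp add: \<tau>)
    have "4 * (Im \<tau>)\<^sup>2 = 4 * (of_int a * of_int c) - (real_of_int b)\<^sup>2" using Im\<tau> by (simp add: \<Delta>_def)
    then have ac: "real_of_int a * real_of_int c = Re \<tau> * Re \<tau> + Im \<tau> * Im \<tau>"
      unfolding re by (simp add: power2_eq_square)
    show ?thesis by (simp add: complex_eq_iff re ac)
  qed
  then have "algebraic_int \<tau>" by (rule algebraic_int_quadratic)
  moreover have "\<tau> \<in> K" unfolding K' using \<tau>K by blast
  ultimately have "\<tau> \<in> ring_of_integers K" by (simp add: ring_of_integers_def)
  then obtain r' t' where tau: "\<tau> = of_int r' * w1 + of_int t' * w2" using ring unfolding zspan_def by blast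
  have "algebraic_int (1 :: complex)" using algebraic_int_quadratic[of 1 1 0] by simp
  moreover have "(1 :: complex) = of_rat 1 + of_rat 0 * (\<i> * of_real \<sigma>)" by simp
  then have "1 \<in> K" unfolding K' by blast
  ultimately have "1 \<in> ring_of_integers K" by (simp add: ring_of_integers_def)
  then obtain p q where one: "1 = of_int p * w1 + of_int q * w2" using ring unfolding zspan_def by blast
  \<comment> \<open>The determinant expressing 1, \<tau> in the integral basis. Both bases have the
    same discriminant, so k^2 = 1 and the matrix is invertible over the integers.\<close>
  define k where "k = p * t' - q * r'"
  have "Im (cnj 1 * \<tau>) = of_int k * I"
    unfolding I_def using Im_cnj_mult_combination[of p w1 q w2 r' t'] unfolding k_def one[symmetric] tau[symmetric] .
  then have "\<Delta> = (of_int k)\<^sup>2 * \<Delta>" using Im\<tau> Dw by (simp add: power_mult_distrib)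
  then have "(real_of_int k)\<^sup>2 = 1" using \<Delta> by simp
  then have kk: "k * k = 1" by (metis of_int_1 of_int_eq_iff of_int_mult power2_eq_square)
  have "of_int k * w1 = of_int t' * (of_int p * w1 + of_int q * w2) + of_int (- q) * (of_int r' * w1 + of_int t' * w2)"
    "of_int k * w2 = of_int (- r') * (of_int p * w1 + of_int q * w2) + of_int p * (of_int r' * w1 + of_int t' * w2)"
    by (simp_all add: k_def algebra_simps)
  then have kw: "of_int k * w1 = of_int t' * 1 + of_int (- q) * \<tau>" "of_int k * w2 = of_int (- r') * 1 + of_int p * \<tau>"
    unfolding one[symmetric] tau[symmetric] .
  have w_in: "w1 \<in> zspan 1 \<tau>" "w2 \<in> zspan 1 \<tau>"
  proof -
    have e: "w = of_int k * (of_int k * w)" for w :: complex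
      using kk by (metis mult.assoc mult_1 of_int_1 of_int_mult)
    have "of_int k * (of_int k * w1) \<in> zspan 1 \<tau>" "of_int k * (of_int k * w2) \<in> zspan 1 \<tau>"
      unfolding kw by (intro add_subgroup_int_mult[OF add_subgroup_zspan] zspanI)+
    then show "w1 \<in> zspan 1 \<tau>" "w2 \<in> zspan 1 \<tau>" using e by metis+
  qed
  have "z \<in> K"
  proof -
    obtain x' y' where xy: "x = of_rat x'" "y = of_rat y'" using z(2,3) by (auto elim!: Rats_cases)
    have "z = of_rat (x' + y' * (of_int b / 2)) + of_rat (y' * r) * (\<i> * of_real \<sigma>)"
    proof -
      have "of_rat x' + of_rat y' * (of_rat u + of_rat r * v) = of_rat (x' + y' * u) + of_rat (y' * r) * v"
        for u and v :: complex
        by (simp add: of_rat_add of_rat_mult algebra_simps)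
      then show ?thesis unfolding z(1) xy by (subst \<tau>K)
    qed
    then show ?thesis unfolding K' by blast
  qed
  then have "z \<in> ring_of_integers K" using algebraic_int_quadratic[OF z(4)] by (simp add: ring_of_integers_def)
  then show ?thesis using ring zspan_subset[OF add_subgroup_zspan w_in] by blast
qed

lemma det_on_doubleton:
  fixes A :: "'b \<Rightarrow> 'b \<Rightarrow> 'a::comm_ring_1"
  assumes "x \<noteq> y"
  shows "det_on {x, y} A = A x x * A y y - A x y * A y x"
proof -
  have "{p. p permutes {x, y}} = {id, Transposition.transpose x y}"
    by (auto simp: permutes_doubleton_iff)
  moreover have "id \<noteq> Transposition.transpose x y" using assms by (metis id_apply transpose_apply_first)
  ultimately show ?thesis
    using assms unfolding det_on_def by (simp add: sign_swap_id)
qed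

lemma card_quotient_transfer:
  assumes F: "bij_betw F X Y"
    and PQ: "\<And>x y. x \<in> X \<Longrightarrow> y \<in> X \<Longrightarrow> P x y \<longleftrightarrow> Q (F x) (F y)"
  shows "card (X // {(x, y). x \<in> X \<and> y \<in> X \<and> P x y}) = card (Y // {(x, y). x \<in> Y \<and> y \<in> Y \<and> Q x y})"
    (is "card (X // ?R) = card (Y // ?S)")
proof -
  have Y: "Y = F ` X" using F by (simp add: bij_betw_def)
  have inj: "inj_on F X" using F by (simp add: bij_betw_def)
  have cls: "?S `` {F x} = F ` (?R `` {x})" if "x \<in> X" for x
    using that PQ unfolding Y by auto
  have "Y // ?S = (`) F ` (X // ?R)"
  proof -
    have "Y // ?S = (\<lambda>x. ?S `` {F x}) ` X" unfolding quotient_def Y by auto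
    also have "\<dots> = (\<lambda>x. F ` (?R `` {x})) ` X" using cls by (intro image_cong) auto
    also have "\<dots> = (`) F ` (X // ?R)" unfolding quotient_def by auto
    finally show ?thesis .
  qed
  moreover have "inj_on ((`) F) (X // ?R)"
    by (rule inj_on_subset[OF inj_on_image_Pow[OF inj]]) (auto simp: quotient_def)
  ultimately show ?thesis by (simp add: card_image)
qed

section \<open>Transfer to quadratic spaces\<close>

lemma Im_cnj_mult_combination_rat:
  "Im (cnj (of_rat p * \<alpha> + of_rat q * \<beta>) * (of_rat r * \<alpha> + of_rat t * \<beta>))
     = of_rat (p * t - q * r) * Im (cnj \<alpha> * \<beta>)"
  unfolding of_rat_eq_of_real_of_rat by (simp add: of_rat_diff of_rat_mult algebra_simps)

context posdef_quadratic_space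
begin

lemma B_add_right: "B x (y + z) = B x y + B x z"
  using B_add[of y z x] by (simp add: B_sym)

lemma B_scale_right: "B x (scale k y) = k * B x y"
  using B_scale[of k y x] by (simp add: B_sym)

lemma int_spanI: "(\<Sum>b\<in>S. scale (of_int (k b)) b) \<in> int_span S"
  unfolding int_span_def by blast

lemma add_subgroup_int_span:
  assumes "finite S"
  shows "add_subgroup (int_span S)"
  unfolding add_subgroup_def
proof (intro conjI ballI)
  show "0 \<in> int_span S" unfolding int_span_def by (auto intro!: exI[of _ "\<lambda>_. 0"])
  fix x y assume "x \<in> int_span S" "y \<in> int_span S"
  then obtain k l :: "'v \<Rightarrow> int" where kl: "x = (\<Sum>b\<in>S. scale (of_int (k b)) b)" "y = (\<Sum>b\<in>S. scale (of_int (l b)) b)"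
    unfolding int_span_def by blast
  have "x - y = (\<Sum>b\<in>S. scale (of_int (k b - l b)) b)"
    unfolding kl by (simp add: sum_subtractf[symmetric] scale_left_diff_distrib)
  then show "x - y \<in> int_span S" by (simp only: int_spanI)
qed

lemma int_span_doubleton:
  assumes "x \<noteq> y"
  shows "int_span {x, y} = {scale (of_int k) x + scale (of_int l) y | k l. True}"
proof (intro subset_antisym subsetI)
  fix v assume "v \<in> int_span {x, y}"
  then show "v \<in> {scale (of_int k) x + scale (of_int l) y | k l. True}"
    using assms unfolding int_span_def by auto
next
  fix v assume "v \<in> {scale (of_int k) x + scale (of_int l) y | k l. True}"
  then obtain k l where v: "v = scale (of_int k) x + scale (of_int l) y" by blast
  have "v = (\<Sum>b\<in>{x, y}. scale (of_int (if b = x then k else l)) b)" using assms v by simp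
  then show "v \<in> int_span {x, y}" by (simp only: int_spanI)
qed

lemma basis_doubleton_representation:
  assumes S: "basis_of_space {x, y}" "x \<noteq> y"
  shows "v = scale (representation {x, y} v x) x + scale (representation {x, y} v y) y"
  using sum_representation_eq[of "{x, y}" v "{x, y}"] S by (simp add: basis_of_space_def)

end

text \<open>The space is identified with the field of \<open>\<tau>\<close> in such a way that \<open>B\<close> becomes a multiple of
  \<open>Re (z * cnj w)\<close>; the factor \<open>a\<close> makes \<open>L\<close> an ideal of the maximal order.\<close>

locale binary_lattice = posdef_quadratic_space scale B
  for scale :: "rat \<Rightarrow> 'v::ab_group_add \<Rightarrow> 'v" and B :: "'v \<Rightarrow> 'v \<Rightarrow> rat" +
  fixes L :: "'v set" and e1 e2 :: 'v and a b c :: int and \<tau> :: complex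
  assumes basis: "basis_of_space {e1, e2}" "e1 \<noteq> e2" and L_eq: "L = int_span {e1, e2}"
    and B_values: "B e1 e1 = of_int a" "2 * B e1 e2 = of_int b" "B e2 e2 = of_int c"
    and integral: "\<And>x. x \<in> L \<Longrightarrow> B x x \<in> \<int>"
    and discriminant_pos: "4 * a * c - b\<^sup>2 > 0"
    and \<tau>_def: "\<tau> = Complex (of_int b / 2) (sqrt (of_int (4 * a * c - b\<^sup>2)) / 2)"
    and fundamental: "imag_quadratic_discriminant (of_int (b\<^sup>2 - 4 * a * c))"
begin

lemma a_pos: "a > 0"
proof -
  have "e1 \<noteq> 0" using basis(1) dependent_zero[of "{e1, e2}"] by (auto simp: basis_of_space_def)
  then show ?thesis using B_pos[of e1] B_values(1) by simp
qed

lemma Im_\<tau>_square: "4 * (Im \<tau>)\<^sup>2 = of_int (4 * a * c - b\<^sup>2)"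
proof -
  have "real_of_int (4 * a * c - b\<^sup>2) \<ge> 0" using discriminant_pos by linarith
  then show ?thesis unfolding \<tau>_def by (simp add: power_divide del: of_int_diff)
qed

lemma Re_\<tau>: "2 * Re \<tau> = of_int b"
  by (simp add: \<tau>_def)

lemma norm_\<tau>: "Re \<tau> * Re \<tau> + Im \<tau> * Im \<tau> = of_int a * of_int c"
proof -
  have "4 * (Im \<tau>)\<^sup>2 = 4 * (of_int a * of_int c) - (2 * Re \<tau>)\<^sup>2" unfolding Im_\<tau>_square Re_\<tau> by simp
  then show ?thesis by (simp add: power2_eq_square)
qed

lemma quad_order: "quad_order a b c \<tau> {x + y * \<tau> | x y. x \<in> \<rat> \<and> y \<in> \<rat>} (zspan 1 \<tau>) (zspan (of_int a) \<tau>)"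
proof
  show "a > 0" by (rule a_pos)
  have "real_of_int (4 * a * c - b\<^sup>2) > 0" using discriminant_pos by (simp only: of_int_0_less_iff)
  then show "Im \<tau> > 0" unfolding \<tau>_def by (simp del: of_int_diff)
  show "\<tau> + cnj \<tau> = of_int b" using Re_\<tau> by (simp add: complex_eq_iff)
  show "\<tau> * cnj \<tau> = of_int (a * c)" using norm_\<tau> by (simp add: complex_eq_iff)
  fix z t n assume "z \<in> {x + y * \<tau> | x y. x \<in> \<rat> \<and> y \<in> \<rat>}" "z * z = of_int t * z - of_int n"
  then show "z \<in> zspan 1 \<tau>" using maximal_order[OF discriminant_pos \<tau>_def fundamental] by blast
qed (rule refl)+

sublocale Q: quad_order a b c \<tau> "{x + y * \<tau> | x y. x \<in> \<rat> \<and> y \<in> \<rat>}" "zspan 1 \<tau>" "zspan (of_int a) \<tau>"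
  by (rule quad_order)

abbreviation "\<A> \<equiv> zspan (of_int a) \<tau>"

abbreviation "\<K> \<equiv> {x + y * \<tau> | x y. x \<in> \<rat> \<and> y \<in> \<rat>}"

definition \<phi> :: "'v \<Rightarrow> complex" where
  "\<phi> v = of_rat (representation {e1, e2} v e1) * of_int a + of_rat (representation {e1, e2} v e2) * \<tau>"

lemma indep: "independent {e1, e2}" and span: "span {e1, e2} = UNIV"
  using basis(1) by (simp_all add: basis_of_space_def)

lemma coords: "v = scale (representation {e1, e2} v e1) e1 + scale (representation {e1, e2} v e2) e2"
  by (rule basis_doubleton_representation[OF basis])

lemma \<phi>_add: "\<phi> (v + w) = \<phi> v + \<phi> w"
  using representation_add[OF indep] span by (simp add: \<phi>_def of_rat_add algebra_simps)

lemma \<phi>_scale: "\<phi> (scale k v) = of_rat k * \<phi> v"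
  using representation_scale[OF indep] span by (simp add: \<phi>_def of_rat_mult algebra_simps)

lemma \<phi>_diff: "\<phi> (v - w) = \<phi> v - \<phi> w"
  using representation_diff[OF indep] span by (simp add: \<phi>_def of_rat_diff algebra_simps)

lemma \<phi>_e1: "\<phi> e1 = of_int a" and \<phi>_e2: "\<phi> e2 = \<tau>"
  using representation_basis[OF indep] basis(2) by (simp_all add: \<phi>_def)

lemma \<phi>_inj: "inj \<phi>"
proof (rule injI)
  fix v w assume "\<phi> v = \<phi> w"
  moreover have "Im (cnj (of_int a) * \<tau>) \<noteq> 0" using a_pos Q.Im_\<tau> by simp
  ultimately have "of_rat (representation {e1, e2} v e1) = (of_rat (representation {e1, e2} w e1) :: real) \<and>
      of_rat (representation {e1, e2} v e2) = (of_rat (representation {e1, e2} w e2) :: real)"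
    unfolding \<phi>_def of_rat_eq_of_real_of_rat by (intro real_coords_unique)
  then show "v = w" using coords[of v] coords[of w] by simp
qed

lemma range_\<phi>: "range \<phi> = \<K>"
proof (intro subset_antisym subsetI)
  fix z assume "z \<in> range \<phi>"
  then obtain v where "z = \<phi> v" by blast
  show "z \<in> \<K>" unfolding \<open>z = \<phi> v\<close> \<phi>_def by (rule Q.\<K>I) simp_all
next
  fix z assume "z \<in> \<K>"
  then obtain x y where z: "z = of_rat x + of_rat y * \<tau>" by (auto elim!: Rats_cases)
  have "of_int a * (of_rat x / of_int a :: complex) = of_rat x" using a_pos by simp
  then have "\<phi> (scale (x / of_int a) e1 + scale y e2) = z"
    by (simp add: \<phi>_add \<phi>_scale \<phi>_e1 \<phi>_e2 z of_rat_divide mult.commute)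
  then show "z \<in> range \<phi>" by blast
qed

text \<open>The norm of s a + t \<tau> is a times a s^2 + b s t + c t^2; this is the polarised
  form.\<close>

lemma B_\<phi>: "of_int a * of_rat (B v w) = Re (\<phi> v * cnj (\<phi> w))"
proof -
  define x y x' y' where "x = representation {e1, e2} v e1" and "y = representation {e1, e2} v e2"
    and "x' = representation {e1, e2} w e1" and "y' = representation {e1, e2} w e2"
  have v: "v = scale x e1 + scale y e2" and w: "w = scale x' e1 + scale y' e2"
    unfolding x_def y_def x'_def y'_def by (rule coords)+
  have "2 * B v w = 2 * (x * x' * of_int a + y * y' * of_int c) + (x * y' + y * x') * of_int b"
    unfolding v w B_add B_add_right B_scale B_scale_right B_values(1,3) B_values(2)[symmetric] B_sym[of e2 e1]
    by (simp add: algebra_simps)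
  then have "of_rat (2 * B v w) = (of_rat (2 * (x * x' * of_int a + y * y' * of_int c) + (x * y' + y * x') * of_int b) :: real)"
    by simp
  then have "of_int a * (2 * of_rat (B v w)) = of_int a * (2 * (of_rat x * of_rat x' * of_int a + of_rat y * of_rat y' * real_of_int c) + (of_rat x * of_rat y' + of_rat y * of_rat x') * of_int b)"
    by (simp add: of_rat_add of_rat_mult)
  also have "\<dots> = 2 * (of_rat x * of_rat x' * of_int a * of_int a + of_rat y * of_rat y' * (of_int a * of_int c)
      + of_int a * (of_rat x * of_rat y' + of_rat y * of_rat x') * Re \<tau>)"
    unfolding Re_\<tau>[symmetric] by (simp add: algebra_simps)
  also have "\<dots> = 2 * Re (\<phi> v * cnj (\<phi> w))"
    unfolding norm_\<tau>[symmetric] \<phi>_def x_def[symmetric] y_def[symmetric] x'_def[symmetric] y'_def[symmetric]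
      of_rat_eq_of_real_of_rat
    by (simp add: algebra_simps)
  finally show ?thesis by simp
qed

lemma B_eq_iff: "B v w = B v' w' \<longleftrightarrow> Re (\<phi> v * cnj (\<phi> w)) = Re (\<phi> v' * cnj (\<phi> w'))"
  unfolding B_\<phi>[symmetric] using a_pos by simp

lemma \<phi>_L: "\<phi> ` L = \<A>"
proof -
  have "\<phi> (scale (of_int k) e1 + scale (of_int l) e2) = of_int k * of_int a + of_int l * \<tau>" for k l
    by (simp add: \<phi>_add \<phi>_scale \<phi>_e1 \<phi>_e2)
  then show ?thesis
    unfolding L_eq int_span_doubleton[OF basis(2)] zspan_def image_def by (auto; metis)
qed

text \<open>A subgroup of finite index automatically has a basis of two vectors, independent over
  the rationals, and inherits integral values from \<open>L\<close>, so it is a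
  \<open>lattice\<close>.\<close>

lemma bij_betw_sublattices:
  assumes m: "m > 0"
  shows "bij_betw ((`) \<phi>) (sublattices L m) (subs \<A> m)"
  unfolding bij_betw_def
proof
  show "inj_on ((`) \<phi>) (sublattices L m)"
    by (rule inj_onI) (simp add: inj_image_eq_iff[OF \<phi>_inj])
  have index: "idx \<A> (\<phi> ` M) = lattice_index L M" if "add_subgroup M" for M
    using idx_image[OF that \<phi>_diff \<phi>_inj, of L] unfolding \<phi>_L by (simp add: idx_def lattice_index_def)
  show "(`) \<phi> ` sublattices L m = subs \<A> m"
  proof (intro subset_antisym subsetI)
    fix N assume "N \<in> (`) \<phi> ` sublattices L m"
    then obtain M where M: "N = \<phi> ` M" "lattice M" "M \<subseteq> L" "lattice_index L M = m"
      by (auto simp: sublattices_def)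
    obtain S where "basis_of_space S" "M = int_span S" using M(2) lattice_def by blast
    then have s: "add_subgroup M" using add_subgroup_int_span by (simp add: basis_of_space_def)
    then show "N \<in> subs \<A> m"
      using M index[OF s] add_subgroup_image[OF s \<phi>_diff] \<phi>_L by (auto simp: subs_def)
  next
    fix N assume N: "N \<in> subs \<A> m"
    then obtain \<alpha> \<beta> where ab: "N = zspan \<alpha> \<beta>" "Im (cnj \<alpha> * \<beta>) \<noteq> 0"
      using full_lattice_sub[OF Q.full_lattice_\<A> N m] full_lattice_def by blast
    have "\<alpha> \<in> \<A>" "\<beta> \<in> \<A>" using N in_zspan unfolding ab(1) by (auto simp: subs_def)
    then obtain v1 v2 where v: "\<alpha> = \<phi> v1" "\<beta> = \<phi> v2" unfolding \<phi>_L[symmetric] by blast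
    have "v1 \<noteq> v2"
    proof
      assume "v1 = v2"
      then have "\<alpha> = \<beta>" by (simp add: v)
      then show False using ab(2) by simp
    qed
    have ind: "independent {v1, v2}"
    proof (rule independent_if_scalars_zero)
      fix f x assume "(\<Sum>x\<in>{v1, v2}. scale (f x) x) = 0" and x: "x \<in> {v1, v2}"
      then have "\<phi> (scale (f v1) v1 + scale (f v2) v2) = \<phi> 0" using \<open>v1 \<noteq> v2\<close> by simp
      moreover have "\<phi> 0 = 0" using \<phi>_diff[of 0 0] by simp
      ultimately have "of_real (of_rat (f v1)) * \<alpha> + of_real (of_rat (f v2)) * \<beta> = of_real 0 * \<alpha> + of_real 0 * \<beta>"
        by (simp add: \<phi>_add \<phi>_scale v of_rat_eq_of_real_of_rat)
      then have "of_rat (f v1) = (0 :: real) \<and> of_rat (f v2) = (0 :: real)" by (rule real_coords_unique[OF ab(2)])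
      then show "f x = 0" using x by auto
    qed simp
    interpret fd: finite_dimensional_vector_space scale "{e1, e2}"
      by standard (simp_all add: indep span)
    have "card {v1, v2} = 2" "dim UNIV = 2"
      using \<open>v1 \<noteq> v2\<close> basis(2) dim_eq_card[of "{e1, e2}" UNIV] indep span by simp_all
    then have sp: "span {v1, v2} = UNIV"
      using fd.card_ge_dim_independent[OF subset_UNIV ind] by auto
    define M where "M = int_span {v1, v2}"
    have NM: "N = \<phi> ` M"
    proof -
      have "\<phi> (scale (of_int k) v1 + scale (of_int l) v2) = of_int k * \<alpha> + of_int l * \<beta>" for k l
        by (simp add: \<phi>_add \<phi>_scale v)
      then show ?thesis
        unfolding M_def int_span_doubleton[OF \<open>v1 \<noteq> v2\<close>] ab(1) zspan_def image_def by (auto; metis)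
    qed
    have M_sub: "M \<subseteq> L"
      using N unfolding NM \<phi>_L[symmetric] subs_def by (simp add: inj_image_subset_iff[OF \<phi>_inj])
    have sM: "add_subgroup M" unfolding M_def by (rule add_subgroup_int_span) simp
    have "basis_of_space {v1, v2}" using ind sp by (simp add: basis_of_space_def)
    then have "lattice M" using integral M_sub unfolding lattice_def M_def by blast
    moreover have "lattice_index L M = m" using index[OF sM] N unfolding NM by (simp add: subs_def)
    ultimately have "M \<in> sublattices L m" using M_sub by (simp add: sublattices_def)
    then show "N \<in> (`) \<phi> ` sublattices L m" unfolding NM by blast
  qed
qed

text \<open>The determinant in any basis is the factor by which signed areas change. This evaluates
  \<open>endo_det\<close> without knowing the basis chosen in its definition.\<close>

lemma endo_det_\<phi>:
  assumes f: "Vector_Spaces.linear scale scale f" and k: "\<And>v w. Im (cnj (\<phi> (f v)) * \<phi> (f w)) = k * Im (cnj (\<phi> v) * \<phi> w)"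
  shows "of_rat (endo_det f) = k"
proof -
  define S where "S = (SOME S. basis_of_space S)"
  have S: "basis_of_space S" unfolding S_def using basis(1) by (rule someI)
  have "card S = card {e1, e2}"
    using dim_eq_card[of S UNIV] dim_eq_card[of "{e1, e2}" UNIV] S basis(1) by (simp add: basis_of_space_def)
  then have "card S = 2" using basis(2) by simp
  then obtain s1 s2 where s: "S = {s1, s2}" "s1 \<noteq> s2" by (metis card_2_iff)
  let ?R = "representation {s1, s2}"
  have rep: "\<phi> v = of_rat (?R v s1) * \<phi> s1 + of_rat (?R v s2) * \<phi> s2" for v
    using basis_doubleton_representation[of s1 s2 v] S s \<phi>_add \<phi>_scale by metis
  have det: "endo_det f = ?R (f s1) s1 * ?R (f s2) s2 - ?R (f s1) s2 * ?R (f s2) s1"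
    unfolding endo_det_def S_def[symmetric] Let_def s(1) by (rule det_on_doubleton[OF s(2)])
  have "Im (cnj (\<phi> e1) * \<phi> e2) = of_rat (?R e1 s1 * ?R e2 s2 - ?R e1 s2 * ?R e2 s1) * Im (cnj (\<phi> s1) * \<phi> s2)"
    by (subst rep[of e1], subst rep[of e2]) (rule Im_cnj_mult_combination_rat)
  moreover have "Im (cnj (\<phi> e1) * \<phi> e2) \<noteq> 0" using a_pos Q.Im_\<tau> by (simp add: \<phi>_e1 \<phi>_e2)
  ultimately have nz: "Im (cnj (\<phi> s1) * \<phi> s2) \<noteq> 0" by auto
  have "k * Im (cnj (\<phi> s1) * \<phi> s2) = Im (cnj (\<phi> (f s1)) * \<phi> (f s2))" using k by simp
  also have "\<dots> = of_rat (endo_det f) * Im (cnj (\<phi> s1) * \<phi> s2)"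
    unfolding det by (subst rep[of "f s1"], subst rep[of "f s2"]) (rule Im_cnj_mult_combination_rat)
  finally show ?thesis using nz by simp
qed

lemma isometry_from_rot:
  assumes u: "u \<in> Q.rot" and g: "g = id \<or> g = cnj"
  obtains f where "f \<in> orthogonal_group" "\<And>v. \<phi> (f v) = u * g (\<phi> v)"
proof -
  have u1: "u * cnj u = 1" using u complex_norm_square[of u] by (simp add: Q.rot_def)
  have gg: "g (g z) = z" "g (x + y) = g x + g y" "Re (g x * cnj (g y)) = Re (x * cnj y)" "g (of_rat r) = of_rat r"
    "g (x * y) = g x * g y" for x y z r
    using g by (auto simp: of_rat_eq_of_real_of_rat)
  have gK: "g z \<in> \<K>" if "z \<in> \<K>" for z using g that Q.\<K>_cnj[OF that] by (elim disjE) (simp_all only: id_apply)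
  have uK: "u \<in> \<K>" using u by (simp add: Q.rot_def)
  define f where "f v = inv \<phi> (u * g (\<phi> v))" for v
  have f: "\<phi> (f v) = u * g (\<phi> v)" for v
  proof -
    have "\<phi> v \<in> \<K>" using range_\<phi> by blast
    then have "u * g (\<phi> v) \<in> range \<phi>" unfolding range_\<phi> by (intro Q.\<K>_mult uK gK)
    then show ?thesis unfolding f_def by (rule f_inv_into_f)
  qed
  have "Vector_Spaces.linear scale scale f"
    unfolding Vector_Spaces.linear_iff
  proof (intro conjI allI)
    fix x y k
    have "\<phi> (f (x + y)) = \<phi> (f x + f y)" "\<phi> (f (scale k x)) = \<phi> (scale k (f x))"
      by (simp_all add: f \<phi>_add \<phi>_scale gg algebra_simps)
    then show "f (x + y) = f x + f y" "f (scale k x) = scale k (f x)" using \<phi>_inj by (auto dest: injD)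
  qed (rule vector_space_axioms)+
  moreover have "bij f"
  proof (rule bijI)
    show "inj f"
    proof (rule injI)
      fix x y assume "f x = f y"
      then have "u * g (\<phi> x) = u * g (\<phi> y)" using f by metis
      then have "g (g (\<phi> x)) = g (g (\<phi> y))" using Q.rot_nz[OF u] by simp
      then show "x = y" unfolding gg(1) using \<phi>_inj by (auto dest: injD)
    qed
    show "surj f"
    proof (rule surjI)
      fix w
      have "\<phi> w \<in> \<K>" using range_\<phi> by blast
      then have "g (cnj u * \<phi> w) \<in> range \<phi>" unfolding range_\<phi> by (intro gK Q.\<K>_mult Q.\<K>_cnj uK)
      then have "\<phi> (inv \<phi> (g (cnj u * \<phi> w))) = g (cnj u * \<phi> w)" by (rule f_inv_into_f)
      then have "\<phi> (f (inv \<phi> (g (cnj u * \<phi> w)))) = (u * cnj u) * \<phi> w" by (simp add: f gg)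
      then show "f (inv \<phi> (g (cnj u * \<phi> w))) = w" unfolding u1 using \<phi>_inj by (auto dest: injD)
    qed
  qed
  moreover have "B (f x) (f y) = B x y" for x y
  proof -
    have "\<phi> (f x) * cnj (\<phi> (f y)) = (u * cnj u) * (g (\<phi> x) * cnj (g (\<phi> y)))" unfolding f by simp
    then have eq: "\<phi> (f x) * cnj (\<phi> (f y)) = g (\<phi> x) * cnj (g (\<phi> y))" unfolding u1 by (simp only: mult_1)
    show ?thesis unfolding B_eq_iff eq by (rule gg(3))
  qed
  ultimately have "f \<in> orthogonal_group" by (simp add: orthogonal_group_def)
  then show ?thesis using that f by blast
qed

text \<open>Dividing by the image u of 1 gives a map h fixing 1. It preserves Re and the norm, so
  each value is either kept or conjugated. As h is linear and fixes the real vector a, its value at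
  e2 decides for all vectors at once.\<close>

lemma isometry_cases:
  assumes f: "f \<in> orthogonal_group"
  obtains u where "u \<in> Q.rot" "(\<forall>v. \<phi> (f v) = u * \<phi> v) \<or> (\<forall>v. \<phi> (f v) = u * cnj (\<phi> v))"
proof -
  have lin: "f (x + y) = f x + f y" "f (scale k x) = scale k (f x)" for x y k
    using f by (auto simp: orthogonal_group_def Vector_Spaces.linear_iff)
  have iso: "Re (\<phi> (f v) * cnj (\<phi> (f w))) = Re (\<phi> v * cnj (\<phi> w))" for v w
    unfolding B_eq_iff[symmetric] using f by (simp add: orthogonal_group_def)
  have "1 \<in> range \<phi>" unfolding range_\<phi> using Q.of_int_\<K>[of 1] by simp
  then obtain v0 where v0: "\<phi> v0 = 1" by (metis rangeE)
  define u where "u = \<phi> (f v0)"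
  have "Re (u * cnj u) = 1" using iso[of v0 v0] by (simp add: u_def v0)
  then have "(norm u)\<^sup>2 = 1" by (simp only: complex_norm_square[symmetric] Re_complex_of_real)
  then have nu: "norm u = 1" by (metis norm_ge_zero one_power2 power2_eq_imp_eq zero_le_one)
  have u1: "u * cnj u = 1" using nu complex_norm_square[of u] by simp
  have "u \<in> range \<phi>" by (simp add: u_def)
  then have ur: "u \<in> Q.rot" unfolding range_\<phi> using nu by (simp add: Q.rot_def)
  define h where "h v = cnj u * \<phi> (f v)" for v
  have fh: "\<phi> (f v) = u * h v" for v
    using u1 by (simp add: h_def flip: mult.assoc)
  have Reh: "Re (h v) = Re (\<phi> v)" for v
    using iso[of v v0] by (simp add: h_def u_def[symmetric] v0 mult.commute)
  have "Im (h v) = Im (\<phi> v) \<or> Im (h v) = - Im (\<phi> v)" for v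
  proof -
    have "h v * cnj (h v) = (u * cnj u) * (\<phi> (f v) * cnj (\<phi> (f v)))" by (simp add: h_def)
    then have "Re (h v * cnj (h v)) = Re (\<phi> v * cnj (\<phi> v))" unfolding u1 using iso[of v v] by simp
    then have "(Im (h v))\<^sup>2 = (Im (\<phi> v))\<^sup>2" using Reh[of v] by (simp add: power2_eq_square)
    then show ?thesis by (simp add: power2_eq_iff)
  qed
  then have h: "h v = \<phi> v \<or> h v = cnj (\<phi> v)" for v
    using Reh by (simp add: complex_eq_iff)
  have h1: "h e1 = of_int a" using h[of e1] by (simp add: \<phi>_e1)
  have hv: "h v = of_rat (representation {e1, e2} v e1) * of_int a + of_rat (representation {e1, e2} v e2) * h e2" for v
  proof -
    have "h v = h (scale (representation {e1, e2} v e1) e1 + scale (representation {e1, e2} v e2) e2)"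
      using coords[of v] by simp
    also have "\<dots> = of_rat (representation {e1, e2} v e1) * h e1 + of_rat (representation {e1, e2} v e2) * h e2"
      by (simp add: h_def lin \<phi>_add \<phi>_scale algebra_simps)
    finally show ?thesis unfolding h1 .
  qed
  have "(\<forall>v. h v = \<phi> v) \<or> (\<forall>v. h v = cnj (\<phi> v))"
    using h[of e2]
  proof
    assume "h e2 = \<phi> e2"
    then have he2: "h e2 = \<tau>" by (simp only: \<phi>_e2)
    have "h v = \<phi> v" for v unfolding \<phi>_def by (subst hv) (simp only: he2)
    then show ?thesis by blast
  next
    assume "h e2 = cnj (\<phi> e2)"
    then have he2: "h e2 = cnj \<tau>" by (simp only: \<phi>_e2)
    have "h v = cnj (\<phi> v)" for v
      unfolding \<phi>_def by (subst hv) (simp add: he2 of_rat_eq_of_real_of_rat)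
    then show ?thesis by blast
  qed
  then show ?thesis using that[OF ur] fh by metis
qed

text \<open>Rotations preserve signed area and the isometries involving \<open>cnj\<close> reverse
  it, so \<open>endo_det\<close> separates the two kinds.\<close>

lemma special_orthogonal_iff:
  "(\<exists>f\<in>special_orthogonal_group. f ` M = N) \<longleftrightarrow> (\<exists>u\<in>Q.rot. (*) u ` \<phi> ` M = \<phi> ` N)"
proof
  assume "\<exists>f\<in>special_orthogonal_group. f ` M = N"
  then obtain f where f: "f \<in> orthogonal_group" "endo_det f = 1" "f ` M = N"
    by (auto simp: special_orthogonal_group_def)
  have lin: "Vector_Spaces.linear scale scale f" using f(1) by (simp add: orthogonal_group_def)
  obtain u where u: "u \<in> Q.rot" "(\<forall>v. \<phi> (f v) = u * \<phi> v) \<or> (\<forall>v. \<phi> (f v) = u * cnj (\<phi> v))"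
    using isometry_cases[OF f(1)] .
  have u1: "u * cnj u = 1" using u(1) complex_norm_square[of u] by (simp add: Q.rot_def)
  have "\<not> (\<forall>v. \<phi> (f v) = u * cnj (\<phi> v))"
  proof
    assume *: "\<forall>v. \<phi> (f v) = u * cnj (\<phi> v)"
    have "Im (cnj (\<phi> (f v)) * \<phi> (f w)) = (- 1) * Im (cnj (\<phi> v) * \<phi> w)" for v w
    proof -
      have "cnj (\<phi> (f v)) * \<phi> (f w) = (u * cnj u) * (\<phi> v * cnj (\<phi> w))" using * by simp
      then show ?thesis unfolding u1 by simp
    qed
    then have "of_rat (endo_det f) = (- 1 :: real)" by (rule endo_det_\<phi>[OF lin])
    then show False using f(2) by simp
  qed
  then have "\<phi> ` N = (*) u ` \<phi> ` M" using u(2) f(3) by (auto simp: image_image)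
  then show "\<exists>u\<in>Q.rot. (*) u ` \<phi> ` M = \<phi> ` N" using u(1) by blast
next
  assume "\<exists>u\<in>Q.rot. (*) u ` \<phi> ` M = \<phi> ` N"
  then obtain u where u: "u \<in> Q.rot" "(*) u ` \<phi> ` M = \<phi> ` N" by blast
  obtain f where f: "f \<in> orthogonal_group" "\<And>v. \<phi> (f v) = u * id (\<phi> v)"
    using isometry_from_rot[OF u(1), of id] by blast
  have u1: "u * cnj u = 1" using u(1) complex_norm_square[of u] by (simp add: Q.rot_def)
  have lin: "Vector_Spaces.linear scale scale f" using f(1) by (simp add: orthogonal_group_def)
  have "Im (cnj (\<phi> (f v)) * \<phi> (f w)) = 1 * Im (cnj (\<phi> v) * \<phi> w)" for v w
  proof -
    have "cnj (\<phi> (f v)) * \<phi> (f w) = (u * cnj u) * (cnj (\<phi> v) * \<phi> w)" using f(2) by simp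
    then show ?thesis unfolding u1 by simp
  qed
  then have "of_rat (endo_det f) = (1 :: real)" by (rule endo_det_\<phi>[OF lin])
  then have "f \<in> special_orthogonal_group" using f(1) by (simp add: special_orthogonal_group_def)
  moreover have "\<phi> ` f ` M = \<phi> ` N" unfolding u(2)[symmetric] by (simp add: image_image f(2))
  then have "f ` M = N" by (simp add: inj_image_eq_iff[OF \<phi>_inj])
  ultimately show "\<exists>f\<in>special_orthogonal_group. f ` M = N" by blast
qed

lemma orthogonal_iff:
  "(\<exists>f\<in>orthogonal_group. f ` M = N) \<longleftrightarrow>
    (\<exists>u\<in>Q.rot. (*) u ` \<phi> ` M = \<phi> ` N \<or> (*) u ` cnj ` \<phi> ` M = \<phi> ` N)"
proof
  assume "\<exists>f\<in>orthogonal_group. f ` M = N"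
  then obtain f where f: "f \<in> orthogonal_group" "f ` M = N" by blast
  obtain u where u: "u \<in> Q.rot" "(\<forall>v. \<phi> (f v) = u * \<phi> v) \<or> (\<forall>v. \<phi> (f v) = u * cnj (\<phi> v))"
    using isometry_cases[OF f(1)] .
  have "(*) u ` \<phi> ` M = \<phi> ` N \<or> (*) u ` cnj ` \<phi> ` M = \<phi> ` N"
    using u(2) unfolding f(2)[symmetric] by (auto simp: image_image)
  then show "\<exists>u\<in>Q.rot. (*) u ` \<phi> ` M = \<phi> ` N \<or> (*) u ` cnj ` \<phi> ` M = \<phi> ` N" using u(1) by blast
next
  have from_rot: "\<exists>f\<in>orthogonal_group. f ` M = N"
    if u: "u \<in> Q.rot" and g: "g = id \<or> g = cnj" and eq: "(*) u ` g ` \<phi> ` M = \<phi> ` N" for u g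
  proof -
    obtain f where f: "f \<in> orthogonal_group" "\<And>v. \<phi> (f v) = u * g (\<phi> v)"
      using isometry_from_rot[OF u g] by blast
    have "\<phi> ` f ` M = \<phi> ` N" unfolding eq[symmetric] by (simp add: image_image f(2))
    then have "f ` M = N" by (simp add: inj_image_eq_iff[OF \<phi>_inj])
    then show ?thesis using f(1) by blast
  qed
  assume "\<exists>u\<in>Q.rot. (*) u ` \<phi> ` M = \<phi> ` N \<or> (*) u ` cnj ` \<phi> ` M = \<phi> ` N"
  then show "\<exists>f\<in>orthogonal_group. f ` M = N"
    using from_rot[of _ id] from_rot[of _ cnj] by auto
qed

lemma a_SL_eq: "m > 0 \<Longrightarrow> a_SL L m = card (subs \<A> m // Q.rot_rel \<A> m)"
  unfolding a_SL_def num_classes_def Q.rot_rel_def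
  by (rule card_quotient_transfer[OF bij_betw_sublattices]) (simp_all only: special_orthogonal_iff)

lemma a_GL_eq: "m > 0 \<Longrightarrow> a_GL L m = card (subs \<A> m // Q.orth_rel \<A> m)"
  unfolding a_GL_def num_classes_def Q.orth_rel_def
  by (rule card_quotient_transfer[OF bij_betw_sublattices]) (simp_all only: orthogonal_iff)

end

context posdef_quadratic_space
begin

lemma binary_lattice_exists:
  assumes dim: "dim UNIV = 2" and L: "lattice L"
    and disc: "imag_quadratic_discriminant (- 4 * lattice_det L)"
  obtains e1 e2 a b c \<tau> where "binary_lattice scale B L e1 e2 a b c \<tau>"
proof -
  \<comment> \<open>The very basis chosen inside \<open>lattice_det\<close>, so that the determinant
    can be expanded in it.\<close>
  define S where "S = (SOME S. basis_of_space S \<and> L = int_span S)"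
  have S: "basis_of_space S \<and> L = int_span S"
    unfolding S_def using L unfolding lattice_def by (intro someI_ex[of "\<lambda>S. basis_of_space S \<and> L = int_span S"]) blast
  have "card S = 2" using dim_eq_card[of S UNIV] S dim by (simp add: basis_of_space_def)
  then obtain e1 e2 where e: "S = {e1, e2}" "e1 \<noteq> e2" by (auto simp: card_2_iff)
  have L_eq: "L = int_span {e1, e2}" and basis: "basis_of_space {e1, e2}" using S e by auto
  have int: "B x x \<in> \<int>" if "x \<in> L" for x using L that by (simp add: lattice_def)
  have mem: "scale (of_int k) e1 + scale (of_int l) e2 \<in> L" for k l
    unfolding L_eq int_span_doubleton[OF e(2)] by blast
  \<comment> \<open>Only values of the quadratic form are integral, so polarisation yields 2 * B e1
    e2 as an integer while B e1 e2 may be a half-integer.\<close>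
  have "B e1 e1 \<in> \<int>" "B e2 e2 \<in> \<int>" "B (e1 + e2) (e1 + e2) \<in> \<int>"
    using int[OF mem[of 1 0]] int[OF mem[of 0 1]] int[OF mem[of 1 1]] by simp_all
  moreover have "2 * B e1 e2 = B (e1 + e2) (e1 + e2) - B e1 e1 - B e2 e2"
    by (simp add: B_add B_add_right B_sym[of e2 e1])
  ultimately have "B e1 e1 \<in> \<int>" "2 * B e1 e2 \<in> \<int>" "B e2 e2 \<in> \<int>" by simp_all
  then obtain a b c where abc: "B e1 e1 = of_int a" "2 * B e1 e2 = of_int b" "B e2 e2 = of_int c"
    by (auto elim!: Ints_cases)
  have "lattice_det L = B e1 e1 * B e2 e2 - B e1 e2 * B e2 e1"
    unfolding lattice_det_def S_def[symmetric] e(1) by (rule det_on_doubleton[OF e(2)])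
  then have det: "4 * lattice_det L = 4 * of_int a * of_int c - (of_int b)\<^sup>2"
    unfolding abc(1,3) abc(2)[symmetric] by (simp add: B_sym[of e2 e1] power2_eq_square)
  have "4 * lattice_det L > 0"
  proof -
    \<comment> \<open>The component of a e2 orthogonal to e1. Its value under the form is a times
      the Gram determinant, which is therefore positive.\<close>
    define x where "x = scale (of_int a) e2 - scale (B e1 e2) e1"
    have ind: "independent {e1, e2}" using basis by (simp add: basis_of_space_def)
    then have "e1 \<noteq> 0" using dependent_zero[of "{e1, e2}"] by auto
    then have a: "a > 0" using B_pos[of e1] abc(1) by simp
    have "x \<noteq> 0"
    proof
      assume "x = 0"
      then have "(\<Sum>v\<in>{e1, e2}. scale ((\<lambda>v. if v = e1 then - B e1 e2 else of_int a) v) v) = 0"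
        using e(2) by (simp add: x_def)
      from independentD[OF ind _ subset_refl this, of e2] show False using e(2) a by simp
    qed
    then have "0 < B x x" by (rule B_pos)
    also have "x = scale (of_int a) e2 + scale (- B e1 e2) e1" by (simp add: x_def)
    also have "B \<dots> \<dots> = of_int a * (of_int a * of_int c - B e1 e2 * B e1 e2)"
      unfolding B_add B_add_right B_scale B_scale_right B_sym[of e2 e1] abc(1,3) by (simp add: algebra_simps)
    finally have "of_int a * of_int c - B e1 e2 * B e1 e2 > 0" using a by (simp add: zero_less_mult_iff)
    then show ?thesis unfolding det abc(2)[symmetric] by (simp add: power2_eq_square)
  qed
  then have "rat_of_int (4 * a * c - b\<^sup>2) > 0" unfolding det by simp
  then have pos: "4 * a * c - b\<^sup>2 > 0" by (simp only: of_int_0_less_iff)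
  have "- 4 * lattice_det L = of_int (b\<^sup>2 - 4 * a * c)" using det by simp
  then have "imag_quadratic_discriminant (of_int (b\<^sup>2 - 4 * a * c))" using disc by simp
  then have "binary_lattice scale B L e1 e2 a b c (Complex (of_int b / 2) (sqrt (of_int (4 * a * c - b\<^sup>2)) / 2))"
    using basis e(2) L_eq abc int pos
    by (unfold_locales; (assumption | rule refl | blast))
  then show ?thesis by (rule that)
qed

end

theorem theorem1p5:
  fixes scale :: "rat \<Rightarrow> 'v::ab_group_add \<Rightarrow> 'v"
    and B :: "'v \<Rightarrow> 'v \<Rightarrow> rat"
    and L :: "'v set"
  assumes "posdef_quadratic_space scale B"
    and "vector_space.dim scale (UNIV :: 'v set) = 2"
    and "posdef_quadratic_space.lattice scale B L"
    and "imag_quadratic_discriminant (- 4 * posdef_quadratic_space.lattice_det scale B L)"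
  shows
    "(\<exists>F. meromorphic_continuation (posdef_quadratic_space.a_SL scale B L) {s. 1 < Re s} F
          \<and> simple_pole F 2)
     \<and> (\<exists>F. meromorphic_continuation (posdef_quadratic_space.a_GL scale B L) {s. 1 < Re s} F
          \<and> simple_pole F 2)
     \<and> abscissa_of_convergence (posdef_quadratic_space.a_SL scale B L) = 2
     \<and> abscissa_of_convergence (posdef_quadratic_space.a_GL scale B L) = 2"
proof -
  interpret V: posdef_quadratic_space scale B by (rule assms(1))
  obtain e1 e2 a b c \<tau> where "binary_lattice scale B L e1 e2 a b c \<tau>"
    using V.binary_lattice_exists[OF assms(2-4)] .
  then interpret binary_lattice scale B L e1 e2 a b c \<tau> .
  show ?thesis
    using Q.rot_classes_dirichlet_series[of "V.a_SL L"] Q.orth_classes_dirichlet_series[of "V.a_GL L"]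
      a_SL_eq a_GL_eq by blast
qed

end
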